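(* Let $X$, $A$, $N$, $F(x)=Ax+N(x)$, the equilibrium $\tilde x=0$, and the unit eigenvectors $\xi_1,\dots,\xi_d$ be as in the context. Suppose that the unstable spectrum of $DF(\tilde x)$ consists of only the unstable eigenvalues $\lambda_1,\dots,\lambda_d$, that each of these is real and has multiplicity one, and that $\lambda_1,\dots,\lambda_d$ are non-resonant. Then there is a $\delta>0$ such that for all non-zero real numbers $s_1,\dots,s_d$ with $$\max_{1\le j\le d}|s_j|\le\delta$$ there exists a unique analytic map $P\colon B_1\to X$ satisfying the first order constraints $$P(0)=\tilde x,\qquad \frac{\partial}{\partial\theta_j}P(0)=s_j\xi_j\quad(1\le j\le d),$$ and the invariance equation $$F(P(\theta))=DP(\theta)A_u\theta\qquad\text{for all }\theta\in B_1,$$ where $A_u=\mathrm{diag}(\lambda_1,\dots,\lambda_d)$. In particular, $P[B_1]$ is a local unstable manifold at $\tilde x$ for the differential equation $x'=F(x)$.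
   Context: $(X,* )$ is a commutative Banach algebra. One starts from $x'=\mathcal{A}x+G(x)$, where $\mathcal{A}$ is a closed, densely defined sectorial operator on $X$ with compact resolvent (so it generates a compact analytic semigroup) and $G\colon X\to X$ is analytic, and from a hyperbolic stationary solution, i.e. one at which the linearization $\mathcal{A}+DG$ has no eigenvalues on the imaginary axis. The linearization has at most finitely many unstable eigenvalues (eigenvalues with positive real part), denoted $\lambda_1,\dots,\lambda_d$, assumed real and of multiplicity one; $\xi_1,\dots,\xi_d$ are associated eigenvectors of unit norm. After an affine change of variables the stationary solution is $\tilde x=0$ and the equation is $$x'=Ax+N(x)=:F(x),$$ where, with respect to the spectral splitting $X=X_u\oplus X_s$, $X_u=\mathrm{span}\{\xi_1,\dots,\xi_d\}$, $A=DF(\tilde x)$ is block diagonal: $A=\mathrm{diag}(A_u,A_s)$ with $A\xi_j=\lambda_j\xi_j$, $A_u=\mathrm{diag}(\lambda_1,\dots,\lambda_d)$ (identified with a $d\times d$ matrix), and $A_s$ generates a compact semigroup with $\|e^{A_st}\|_{B(X)}\le Me^{-\mu_*t}$ for all $t\ge0$, for some constants $M,\mu_*>0$. The nonlinearity $N$ is analytic in a neighborhood of the origin and zero to second order: $$N(x)=\sum_{j=2}^\infty n_j*x^{*j},\quad n_j\in X,$$ where $x^{*j}$ is the $j$-fold product, and there is $R>0$ with $\sum_{j=2}^\infty\|n_j\|R^j<\infty$. Non-resonance: $\lambda_1,\dots,\lambda_d$ are non-resonant if there is no $m=(m_1,\dots,m_d)\in\mathbb{N}^d$ ($\mathbb{N}$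 includes $0$) with $|m|=m_1+\dots+m_d\ge2$ and no $1\le j\le d$ such that $m_1\lambda_1+\dots+m_d\lambda_d=\lambda_j$. $B_1=\{\theta=(\theta_1,\dots,\theta_d)\in\mathbb{R}^d:|\theta_j|<1,\ 1\le j\le d\}$. A map $P\colon B_1\to X$ is analytic if it is given on $B_1$ by a convergent power series $\sum_{m\in\mathbb{N}^d}p_m\theta^m$ with $p_m\in X$. Explicitly, $DP(\theta)A_u\theta=\sum_{j=1}^d\lambda_j\theta_j\,\partial P/\partial\theta_j(\theta)$; the invariance equation includes that $P(\theta)$ lies in the domain of $A$. *)

theory Defs
  imports "HOL-Analysis.Analysis"
begin

section \<open>Unbounded operators\<close>

text \<open>
  An unbounded operator on the real Banach space \<open>X\<close> is a pair of a domain \<open>D\<close> and a total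
  function \<open>A\<close> of which only the restriction to \<open>D\<close> matters.
\<close>

definition linear_on_dom :: "'a::real_vector set \<Rightarrow> ('a \<Rightarrow> 'a) \<Rightarrow> bool" where
  "linear_on_dom D A \<longleftrightarrow> subspace D \<and>
     (\<forall>x\<in>D. \<forall>y\<in>D. A (x + y) = A x + A y) \<and> (\<forall>c. \<forall>x\<in>D. A (c *\<^sub>R x) = c *\<^sub>R A x)"

definition closed_operator :: "'a::real_normed_vector set \<Rightarrow> ('a \<Rightarrow> 'a) \<Rightarrow> bool" where
  "closed_operator D A \<longleftrightarrow> linear_on_dom D A \<and> closed {(x, A x) | x. x \<in> D}"

definition densely_defined :: "'a::real_normed_vector set \<Rightarrow> bool" where
  "densely_defined D \<longleftrightarrow> closure D = UNIV"

definition compact_op_on :: "'b::real_normed_vector set \<Rightarrow> ('b \<Rightarrow> 'b) \<Rightarrow> bool" where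
  "compact_op_on Y T \<longleftrightarrow> compact (closure (T ` (Y \<inter> cball 0 1)))"

text \<open>
  Spectral notions are those of the complexification of \<open>X\<close>: the pair \<open>(x, y)\<close> stands for
  \<open>x + i y\<close>, and \<open>A\<close> acts as \<open>map_prod A A\<close> on \<open>D \<times> D\<close>. The norm of the product type is
  equivalent to any complexification norm, and all notions below are invariant under passing
  to an equivalent norm.
\<close>

definition cscale :: "complex \<Rightarrow> 'a::real_vector \<times> 'a \<Rightarrow> 'a \<times> 'a" where
  "cscale z w = (Re z *\<^sub>R fst w - Im z *\<^sub>R snd w, Im z *\<^sub>R fst w + Re z *\<^sub>R snd w)"

definition resolvent :: "'a::real_normed_vector set \<Rightarrow> ('a \<Rightarrow> 'a) \<Rightarrow> complex \<Rightarrow> 'a \<times> 'a \<Rightarrow> 'a \<times> 'a" where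
  "resolvent D A z = inv_into (D \<times> D) (\<lambda>w. cscale z w - map_prod A A w)"

definition resolvent_set :: "'a::real_normed_vector set \<Rightarrow> ('a \<Rightarrow> 'a) \<Rightarrow> complex set" where
  "resolvent_set D A =
     {z. bij_betw (\<lambda>w. cscale z w - map_prod A A w) (D \<times> D) UNIV \<and> bounded_linear (resolvent D A z)}"

definition op_spectrum :: "'a::real_normed_vector set \<Rightarrow> ('a \<Rightarrow> 'a) \<Rightarrow> complex set" where
  "op_spectrum D A = - resolvent_set D A"

definition op_eigenvalue :: "'a::real_normed_vector set \<Rightarrow> ('a \<Rightarrow> 'a) \<Rightarrow> complex \<Rightarrow> bool" where
  "op_eigenvalue D A z \<longleftrightarrow> (\<exists>w\<in>D \<times> D. w \<noteq> 0 \<and> map_prod A A w = cscale z w)"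

text \<open>Algebraic multiplicity of a real eigenvalue. The generalized eigenspace of the
  complexification is the complexification of the real one, so it is enough to count in \<open>X\<close>.\<close>

primrec ker_power :: "'a::real_vector set \<Rightarrow> ('a \<Rightarrow> 'a) \<Rightarrow> real \<Rightarrow> nat \<Rightarrow> 'a set" where
  "ker_power D A r 0 = {0}"
| "ker_power D A r (Suc k) = {x \<in> D. A x - r *\<^sub>R x \<in> ker_power D A r k}"

definition alg_multiplicity :: "'a::real_vector set \<Rightarrow> ('a \<Rightarrow> 'a) \<Rightarrow> real \<Rightarrow> nat" where
  "alg_multiplicity D A r = dim (\<Union>k. ker_power D A r k)"

definition compact_resolvent :: "'a::real_normed_vector set \<Rightarrow> ('a \<Rightarrow> 'a) \<Rightarrow> bool" where
  "compact_resolvent D A \<longleftrightarrow> (\<exists>z\<in>resolvent_set D A. compact_op_on UNIV (resolvent D A z))"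

text \<open>The sign convention is the one for which sectorial operators generate analytic semigroups.\<close>

definition sectorial :: "'a::real_normed_vector set \<Rightarrow> ('a \<Rightarrow> 'a) \<Rightarrow> bool" where
  "sectorial D A \<longleftrightarrow> closed_operator D A \<and> densely_defined D \<and>
     (\<exists>\<omega>::real. \<exists>\<phi> C. pi / 2 < \<phi> \<and> \<phi> < pi \<and>
        (\<forall>z. z \<noteq> of_real \<omega> \<and> \<bar>Arg (z - of_real \<omega>)\<bar> < \<phi> \<longrightarrow>
           z \<in> resolvent_set D A \<and> onorm (resolvent D A z) \<le> C / cmod (z - of_real \<omega>)))"


section \<open>Semigroups on a subspace\<close>

definition c0_semigroup_on :: "'a::real_normed_vector set \<Rightarrow> (real \<Rightarrow> 'a \<Rightarrow> 'a) \<Rightarrow> bool" where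
  "c0_semigroup_on Y S \<longleftrightarrow>
     (\<forall>t\<ge>0. linear_on_dom Y (S t) \<and> S t ` Y \<subseteq> Y \<and> (\<exists>C. \<forall>x\<in>Y. norm (S t x) \<le> C * norm x)) \<and>
     (\<forall>x\<in>Y. S 0 x = x) \<and>
     (\<forall>s\<ge>0. \<forall>t\<ge>0. \<forall>x\<in>Y. S (s + t) x = S s (S t x)) \<and>
     (\<forall>x\<in>Y. ((\<lambda>t. S t x) \<longlongrightarrow> x) (at_right 0))"

definition generates_on ::
  "'a::real_normed_vector set \<Rightarrow> 'a set \<Rightarrow> ('a \<Rightarrow> 'a) \<Rightarrow> (real \<Rightarrow> 'a \<Rightarrow> 'a) \<Rightarrow> bool" where
  "generates_on Y D A S \<longleftrightarrow> c0_semigroup_on Y S \<and> D \<subseteq> Y \<and>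
     (\<forall>x\<in>Y. \<forall>y. (x \<in> D \<and> A x = y) \<longleftrightarrow> ((\<lambda>h. (S h x - x) /\<^sub>R h) \<longlongrightarrow> y) (at_right 0))"


section \<open>The nonlinearity and the vector field\<close>

text \<open>The \<open>j\<close>-fold product for \<open>j \<ge> 1\<close>; the algebra need not have a unit, so the case \<open>j = 0\<close>
  has no meaning and is never used.\<close>

definition star_pow :: "'a::times \<Rightarrow> nat \<Rightarrow> 'a" where
  "star_pow x j = ((*) x ^^ (j - 1)) x"

definition N_dom :: "(nat \<Rightarrow> 'a::{banach,real_normed_algebra,comm_ring}) \<Rightarrow> 'a set" where
  "N_dom n = {x. summable (\<lambda>j. n (j + 2) * star_pow x (j + 2))}"

definition N_fun :: "(nat \<Rightarrow> 'a::{banach,real_normed_algebra,comm_ring}) \<Rightarrow> 'a \<Rightarrow> 'a" where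
  "N_fun n x = (\<Sum>j. n (j + 2) * star_pow x (j + 2))"

definition F_fun ::
  "('a \<Rightarrow> 'a) \<Rightarrow> (nat \<Rightarrow> 'a) \<Rightarrow> 'a \<Rightarrow> 'a::{banach,real_normed_algebra,comm_ring}" where
  "F_fun A n x = A x + N_fun n x"


section \<open>Parameterizations\<close>

definition nonresonant :: "('d::finite \<Rightarrow> real) \<Rightarrow> bool" where
  "nonresonant lam \<longleftrightarrow>
     \<not> (\<exists>m :: 'd \<Rightarrow> nat. \<exists>j. (\<Sum>i\<in>UNIV. m i) \<ge> 2 \<and> (\<Sum>i\<in>UNIV. real (m i) * lam i) = lam j)"

definition B1 :: "(real ^ 'd::finite) set" where
  "B1 = {\<theta>. \<forall>j. \<bar>\<theta> $ j\<bar> < 1}"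

definition analytic_on_B1 :: "(real ^ 'd::finite \<Rightarrow> 'a::real_normed_vector) \<Rightarrow> bool" where
  "analytic_on_B1 P \<longleftrightarrow> (\<exists>p :: ('d \<Rightarrow> nat) \<Rightarrow> 'a.
     \<forall>\<theta>\<in>B1. ((\<lambda>m. (\<Prod>j\<in>UNIV. (\<theta> $ j) ^ m j) *\<^sub>R p m) has_sum P \<theta>) UNIV)"

definition diag_matrix :: "('d::finite \<Rightarrow> real) \<Rightarrow> real ^ 'd ^ 'd" where
  "diag_matrix lam = (\<chi> i j. if i = j then lam i else 0)"

definition invariance_equation ::
  "'a::{banach,real_normed_algebra,comm_ring} set \<Rightarrow> ('a \<Rightarrow> 'a) \<Rightarrow> (nat \<Rightarrow> 'a) \<Rightarrow>
   ('d::finite \<Rightarrow> real) \<Rightarrow> (real ^ 'd \<Rightarrow> 'a) \<Rightarrow> bool" where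
  "invariance_equation D A n lam P \<longleftrightarrow> (\<forall>\<theta>\<in>B1.
     P \<theta> \<in> D \<inter> N_dom n \<and>
     F_fun A n (P \<theta>) = frechet_derivative P (at \<theta>) (diag_matrix lam *v \<theta>))"

text \<open>Analyticity makes \<open>P\<close> differentiable on \<open>B1\<close>, so the choice operator in
  \<open>frechet_derivative\<close> is harmless here.\<close>

definition unstable_parameterization ::
  "'a::{banach,real_normed_algebra,comm_ring} set \<Rightarrow> ('a \<Rightarrow> 'a) \<Rightarrow> (nat \<Rightarrow> 'a) \<Rightarrow>
   ('d::finite \<Rightarrow> real) \<Rightarrow> ('d \<Rightarrow> 'a) \<Rightarrow> ('d \<Rightarrow> real) \<Rightarrow> (real ^ 'd \<Rightarrow> 'a) \<Rightarrow> bool" where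
  "unstable_parameterization D A n lam \<xi> s P \<longleftrightarrow>
     analytic_on_B1 P \<and>
     P 0 = 0 \<and>
     (\<forall>j. ((\<lambda>h. P (h *\<^sub>R axis j 1)) has_vector_derivative s j *\<^sub>R \<xi> j) (at 0)) \<and>
     invariance_equation D A n lam P"


section \<open>Local unstable manifolds\<close>

text \<open>\<open>W\<^sup>u\<close> relative to \<open>U\<close>: the points with a backward solution of \<open>x' = F x\<close> that stays
  in \<open>U\<close> and converges to the equilibrium \<open>0\<close>.\<close>

definition local_unstable_set ::
  "'a::{banach,real_normed_algebra,comm_ring} set \<Rightarrow> ('a \<Rightarrow> 'a) \<Rightarrow> (nat \<Rightarrow> 'a) \<Rightarrow> 'a set \<Rightarrow> 'a set" where
  "local_unstable_set D A n U = {x0. \<exists>x :: real \<Rightarrow> 'a. x 0 = x0 \<and>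
     (\<forall>t\<le>0. x t \<in> U \<inter> D \<inter> N_dom n \<and>
             (x has_vector_derivative F_fun A n (x t)) (at t within {..0})) \<and>
     (x \<longlongrightarrow> 0) at_bot}"

text \<open>\<open>W\<close> is the unstable set relative to some neighborhood of \<open>0\<close>, and an analytically embedded
  \<open>d\<close>-dimensional disk tangent at \<open>0\<close> to the unstable eigenspace (\<open>d\<close> being the number of
  the \<open>\<xi> j\<close>).\<close>

definition local_unstable_manifold ::
  "'a::{banach,real_normed_algebra,comm_ring} set \<Rightarrow> ('a \<Rightarrow> 'a) \<Rightarrow> (nat \<Rightarrow> 'a) \<Rightarrow>
   ('d::finite \<Rightarrow> 'a) \<Rightarrow> 'a set \<Rightarrow> bool" where
  "local_unstable_manifold D A n \<xi> W \<longleftrightarrow>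
     (\<exists>U. open U \<and> 0 \<in> U \<and> W = local_unstable_set D A n U) \<and>
     (\<exists>\<phi> :: real ^ 'd \<Rightarrow> 'a. analytic_on_B1 \<phi> \<and>
        (\<exists>\<psi>. homeomorphism B1 W \<phi> \<psi>) \<and>
        (\<forall>\<theta>\<in>B1. inj (frechet_derivative \<phi> (at \<theta>))) \<and>
        \<phi> 0 = 0 \<and> range (frechet_derivative \<phi> (at 0)) = span (range \<xi>))"

end

(* Write P as a power series with coefficients p_m. The invariance equation becomes the family of
   homological equations (m.lambda - A) p_m = [coefficient of N(P) at m], whose right-hand sides only
   involve coefficients of lower degree. Non-resonance makes them uniquely solvable, and a bound on
   the resolvents that is uniform in m gives convergence by a majorant argument: on the unstable
   space the small divisors m.lambda - lambda_j stay away from 0 because the lambda_j are positive,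
   and on the stable space the decay of the semigroup bounds the resolvent for all positive
   arguments. Since p_m scales by s^m, one series serves all s.

   For the local manifold, a point x close to 0 is compared with the point P(y) having the same
   unstable coordinates. Along a solution, the difference x - P(y) contracts in forward time, so for
   a solution that stays close to 0 for all negative times it is 0. *)
theory Submission
  imports Defs
begin

section \<open>Power series in several variables\<close>

text \<open>Three obstacles shape the details. Summation in \<open>X\<close> is unconditional, which
  in infinite dimensions is weaker than absolute, so an arbitrary analytic solution gains absolute
  convergence only at a reduced radius; estimates therefore use a weighted l1 norm on coefficient
  families, which is submultiplicative for Cauchy products. Next, an unknown solution is only known
  to take its values in the domain of \<open>A\<close>, not to have its coefficients there; one
  bounded resolvent stands in for \<open>A\<close>, both in sums and when coefficients are compared.
  Finally, the stable part has only a forward semigroup and \<open>M\<close> may exceed 1, so the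
  decay estimate cannot simply be differentiated or run backwards: an equivalent norm with constant
  1 yields the resolvent bound and also one-sided growth estimates along solutions. The
  neighbourhood isolating the manifold is a ball intersected with a cylinder over the unstable
  coordinates of the disk, and invariance of domain makes it open.\<close>

definition mdeg :: "('d::finite \<Rightarrow> nat) \<Rightarrow> nat" where
  "mdeg m = (\<Sum>i\<in>UNIV. m i)"

definition monom_at :: "('d::finite \<Rightarrow> nat) \<Rightarrow> real ^ 'd \<Rightarrow> real" where
  "monom_at m \<theta> = (\<Prod>j\<in>UNIV. (\<theta> $ j) ^ m j)"

text \<open>Bounding every finite partial sum combines summability with a bound on the sum. It also
  passes to a family that agrees, on each finite set, with some member of a bounded sequence of
  families; the recursively built coefficients inherit their bound in this way.\<close>

definition majorized :: "(('d::finite \<Rightarrow> nat) \<Rightarrow> 'a::real_normed_vector) \<Rightarrow> real \<Rightarrow> real \<Rightarrow> bool" where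
  "majorized f r K \<longleftrightarrow> (\<forall>F. finite F \<longrightarrow> (\<Sum>m\<in>F. norm (f m) * r ^ mdeg m) \<le> K)"

definition pser :: "(('d::finite \<Rightarrow> nat) \<Rightarrow> 'a::real_normed_vector) \<Rightarrow> real ^ 'd \<Rightarrow> 'a" where
  "pser f \<theta> = (\<Sum>\<^sub>\<infinity>m. monom_at m \<theta> *\<^sub>R f m)"

text \<open>The Cauchy product. Truncated subtraction is exact here because \<open>a\<close> ranges
  below \<open>m\<close> pointwise.\<close>

definition conv :: "(('d::finite \<Rightarrow> nat) \<Rightarrow> 'a::real_normed_algebra) \<Rightarrow> (('d \<Rightarrow> nat) \<Rightarrow> 'a) \<Rightarrow> ('d \<Rightarrow> nat) \<Rightarrow> 'a" where
  "conv f g m = (\<Sum>a | a \<le> m. f a * g (\<lambda>i. m i - a i))"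

lemma mdeg_zero [simp]: "mdeg (\<lambda>_. 0) = 0"
  by (simp add: mdeg_def)

lemma mdeg_eq_0_iff: "mdeg m = 0 \<longleftrightarrow> m = (\<lambda>_. 0)"
  by (auto simp: mdeg_def)

lemma mdeg_add: "mdeg (\<lambda>i. a i + b i) = mdeg a + mdeg b"
  by (simp add: mdeg_def sum.distrib)

lemma mdeg_mono: "a \<le> m \<Longrightarrow> mdeg a \<le> mdeg m"
  by (simp add: mdeg_def le_fun_def sum_mono)

lemma mdeg_split: "a \<le> m \<Longrightarrow> mdeg m = mdeg a + mdeg (\<lambda>i. m i - a i)"
  unfolding mdeg_add[symmetric] by (simp add: le_fun_def)

lemma le_mdeg: "m i \<le> mdeg m"
  unfolding mdeg_def by (rule member_le_sum) auto

lemma finite_mdeg_le: "finite {m :: 'd::finite \<Rightarrow> nat. mdeg m \<le> k}"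
proof (rule finite_subset)
  show "{m :: 'd \<Rightarrow> nat. mdeg m \<le> k} \<subseteq> Pi\<^sub>E UNIV (\<lambda>_. {..k})"
    by (auto simp: PiE_def intro: order_trans[OF le_mdeg])
qed (simp add: finite_PiE)

lemma finite_le_multi: "finite {a :: 'd::finite \<Rightarrow> nat. a \<le> m}"
  by (rule finite_subset[OF _ finite_mdeg_le[of "mdeg m"]]) (auto intro: mdeg_mono)

lemma monom_at_add: "monom_at (\<lambda>i. a i + b i) \<theta> = monom_at a \<theta> * monom_at b \<theta>"
  by (simp add: monom_at_def power_add prod.distrib)

lemma monom_at_split: "a \<le> m \<Longrightarrow> monom_at m \<theta> = monom_at a \<theta> * monom_at (\<lambda>i. m i - a i) \<theta>"
  unfolding monom_at_add[symmetric] by (simp add: le_fun_def)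

lemma monom_at_zero: "monom_at m 0 = (if m = (\<lambda>_. 0) then 1 else 0)"
proof (cases "m = (\<lambda>_. 0)")
  case False
  then obtain j where "m j \<noteq> 0" by (auto simp: fun_eq_iff)
  then have "\<exists>j\<in>UNIV. (0 :: real ^ 'a) $ j ^ m j = 0" by (auto simp: power_0_left)
  then show ?thesis using False by (simp add: monom_at_def prod_zero_iff)
qed (simp add: monom_at_def)

lemma monom_at_const: "monom_at m (\<chi> j. r) = r ^ mdeg m"
  by (simp add: monom_at_def mdeg_def power_sum)

lemma monom_at_mult: "monom_at m (\<chi> j. s j * \<theta> $ j) = monom_at m (\<chi> j. s j) * monom_at m \<theta>"
  by (simp add: monom_at_def power_mult_distrib prod.distrib)

lemma abs_monom_at_le:
  assumes "\<And>j. \<bar>\<theta> $ j\<bar> \<le> r"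
  shows "\<bar>monom_at m \<theta>\<bar> \<le> r ^ mdeg m"
proof -
  have "\<bar>monom_at m \<theta>\<bar> = (\<Prod>j\<in>UNIV. \<bar>\<theta> $ j\<bar> ^ m j)"
    by (simp add: monom_at_def abs_prod power_abs)
  also have "\<dots> \<le> (\<Prod>j\<in>UNIV. r ^ m j)"
    using assms by (intro prod_mono) (simp add: power_mono)
  also have "\<dots> = r ^ mdeg m" by (simp add: mdeg_def power_sum)
  finally show ?thesis .
qed

lemma majorizedD: "majorized f r K \<Longrightarrow> finite F \<Longrightarrow> (\<Sum>m\<in>F. norm (f m) * r ^ mdeg m) \<le> K"
  by (simp add: majorized_def)

lemma majorized_nonneg: "majorized f r K \<Longrightarrow> 0 \<le> K"
  using majorizedD[of f r K "{}"] by simp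

lemma majorized_summable:
  assumes "majorized f r K" "r \<ge> 0"
  shows "(\<lambda>m. norm (f m) * r ^ mdeg m) summable_on UNIV"
proof (rule nonneg_bdd_above_summable_on)
  show "bdd_above (sum (\<lambda>m. norm (f m) * r ^ mdeg m) ` {F. F \<subseteq> UNIV \<and> finite F})"
    by (rule bdd_aboveI2[where M = K]) (simp add: majorizedD[OF assms(1)])
qed (simp add: assms)

lemma majorized_mono:
  assumes "majorized f r K" "0 \<le> r'" "r' \<le> r" "K \<le> K'"
    and "\<And>m. norm (g m) \<le> norm (f m)"
  shows "majorized g r' K'"
  unfolding majorized_def
proof (intro allI impI)
  fix F :: "('a \<Rightarrow> nat) set" assume "finite F"
  have "(\<Sum>m\<in>F. norm (g m) * r' ^ mdeg m) \<le> (\<Sum>m\<in>F. norm (f m) * r ^ mdeg m)"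
    using assms by (intro sum_mono mult_mono power_mono) auto
  also have "\<dots> \<le> K'" using majorizedD[OF assms(1) \<open>finite F\<close>] assms by simp
  finally show "(\<Sum>m\<in>F. norm (g m) * r' ^ mdeg m) \<le> K'" .
qed

lemma pser_abs_summable:
  assumes "majorized f r K" "\<And>j. \<bar>\<theta> $ j\<bar> \<le> r"
  shows "(\<lambda>m. norm (monom_at m \<theta> *\<^sub>R f m)) summable_on UNIV"
proof (rule Infinite_Sum.abs_summable_on_comparison_test')
  have "0 \<le> r" using assms(2) abs_ge_zero order_trans by blast
  then show "(\<lambda>m. norm (f m) * r ^ mdeg m) summable_on UNIV"
    using majorized_summable assms(1) by blast
  show "norm (monom_at m \<theta> *\<^sub>R f m) \<le> norm (f m) * r ^ mdeg m" for m
    using abs_monom_at_le[OF assms(2)] by (simp add: mult.commute mult_left_mono)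
qed

lemma pser_has_sum:
  fixes f :: "('d::finite \<Rightarrow> nat) \<Rightarrow> 'a::banach"
  assumes "majorized f r K" "\<And>j. \<bar>\<theta> $ j\<bar> \<le> r"
  shows "((\<lambda>m. monom_at m \<theta> *\<^sub>R f m) has_sum pser f \<theta>) UNIV"
  unfolding pser_def
  by (rule has_sum_infsum[OF abs_summable_summable[OF pser_abs_summable[OF assms]]])

lemma pser_eqI: "((\<lambda>m. monom_at m \<theta> *\<^sub>R f m) has_sum x) UNIV \<Longrightarrow> pser f \<theta> = x"
  unfolding pser_def by (rule infsumI)

lemma norm_pser_le:
  fixes f :: "('d::finite \<Rightarrow> nat) \<Rightarrow> 'a::banach"
  assumes "majorized f r K" "\<And>j. \<bar>\<theta> $ j\<bar> \<le> r"
  shows "norm (pser f \<theta>) \<le> K"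
proof -
  have r: "0 \<le> r" using assms(2) abs_ge_zero order_trans by blast
  have "norm (pser f \<theta>) \<le> (\<Sum>\<^sub>\<infinity>m. norm (f m) * r ^ mdeg m)"
    using abs_monom_at_le[OF assms(2)] r
    by (intro norm_infsum_le[OF pser_has_sum[OF assms] has_sum_infsum[OF majorized_summable[OF assms(1)]]])
       (auto simp: mult.commute mult_left_mono)
  also have "\<dots> \<le> K"
    using majorizedD[OF assms(1)] by (intro infsum_le_finite_sums majorized_summable[OF assms(1) r]) auto
  finally show ?thesis .
qed

section \<open>Cauchy products of absolutely convergent power series\<close>

lemma has_sum_mult_abs:
  fixes x :: "'i \<Rightarrow> 'a::{banach,real_normed_algebra}" and y :: "'j \<Rightarrow> 'a"
  assumes x: "(\<lambda>a. norm (x a)) summable_on UNIV" and y: "(\<lambda>b. norm (y b)) summable_on UNIV"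
  shows "((\<lambda>(a, b). x a * y b) has_sum (infsum x UNIV * infsum y UNIV)) (UNIV \<times> UNIV)"
proof -
  have "(\<lambda>(a, b). norm (x a) * norm (y b)) summable_on (UNIV \<times> UNIV)"
  proof (rule summable_on_SigmaI[where g = "\<lambda>a. norm (x a) * infsum (\<lambda>b. norm (y b)) UNIV"])
    show "((\<lambda>b. case (a, b) of (a, b) \<Rightarrow> norm (x a) * norm (y b)) has_sum
        norm (x a) * infsum (\<lambda>b. norm (y b)) UNIV) UNIV" for a
      using has_sum_cmult_right[OF has_sum_infsum[OF y]] by simp
    show "(\<lambda>a. norm (x a) * infsum (\<lambda>b. norm (y b)) UNIV) summable_on UNIV"
      by (rule summable_on_cmult_left[OF x])
  qed simp
  moreover have "norm (case z of (a, b) \<Rightarrow> x a * y b) \<le> (case z of (a, b) \<Rightarrow> norm (x a) * norm (y b))" for z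
    by (cases z) (simp add: norm_mult_ineq)
  ultimately have s: "(\<lambda>(a, b). x a * y b) summable_on (UNIV \<times> UNIV)"
    by (rule abs_summable_summable[OF Infinite_Sum.abs_summable_on_comparison_test'])
  have X: "(x has_sum infsum x UNIV) UNIV" and Y: "(y has_sum infsum y UNIV) UNIV"
    by (rule has_sum_infsum, rule abs_summable_summable, rule x, rule has_sum_infsum, rule abs_summable_summable, rule y)
  show ?thesis
  proof (rule has_sum_SigmaI[where g = "\<lambda>a. x a * infsum y UNIV"])
    show "((\<lambda>b. case (a, b) of (a, b) \<Rightarrow> x a * y b) has_sum x a * infsum y UNIV) UNIV" for a
      using has_sum_bounded_linear[OF bounded_linear_mult_right Y] by simp
    show "((\<lambda>a. x a * infsum y UNIV) has_sum infsum x UNIV * infsum y UNIV) UNIV"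
      by (rule has_sum_bounded_linear[OF bounded_linear_mult_left X])
  qed (rule s)
qed

text \<open>The Cauchy product regroups the double family over all pairs \<open>(a, b)\<close> by
  the value \<open>m\<close> of \<open>a + b\<close>; this bijection performs the
  regrouping.\<close>

lemma conv_reindex:
  "bij_betw (\<lambda>(m, a). (a, \<lambda>i. m i - a i)) (SIGMA m:UNIV. {a. a \<le> m})
     (UNIV \<times> (UNIV :: ('d::finite \<Rightarrow> nat) set))"
  by (rule bij_betw_byWitness[where f' = "\<lambda>(a, b). (\<lambda>i. a i + b i, a)"])
     (auto simp: le_fun_def fun_eq_iff)

lemma pser_conv:
  fixes f g :: "('d::finite \<Rightarrow> nat) \<Rightarrow> 'a::{banach,real_normed_algebra}"
  assumes f: "majorized f r K" and g: "majorized g r L" and \<theta>: "\<And>j. \<bar>\<theta> $ j\<bar> \<le> r"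
  shows "pser (conv f g) \<theta> = pser f \<theta> * pser g \<theta>"
proof (rule pser_eqI)
  define h where "h = (\<lambda>(a, b). (monom_at a \<theta> *\<^sub>R f a) * (monom_at b \<theta> *\<^sub>R g b))"
  have "(h has_sum (pser f \<theta> * pser g \<theta>)) (UNIV \<times> UNIV)"
    unfolding h_def pser_def
    by (rule has_sum_mult_abs[OF pser_abs_summable[OF f \<theta>] pser_abs_summable[OF g \<theta>]])
  then have *: "((\<lambda>z. h ((\<lambda>(m, a). (a, \<lambda>i. m i - a i)) z)) has_sum (pser f \<theta> * pser g \<theta>)) (SIGMA m:UNIV. {a. a \<le> m})"
    by (subst has_sum_reindex_bij_betw[OF conv_reindex])
  have **: "((\<lambda>a. h ((\<lambda>(m, a). (a, \<lambda>i. m i - a i)) (m, a))) has_sum monom_at m \<theta> *\<^sub>R conv f g m) {a. a \<le> m}" for m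
  proof -
    have "monom_at m \<theta> *\<^sub>R conv f g m =
      (\<Sum>a | a \<le> m. h ((\<lambda>(m, a). (a, \<lambda>i. m i - a i)) (m, a)))"
      unfolding conv_def scaleR_sum_right
    proof (rule sum.cong)
      fix a assume "a \<in> {a. a \<le> m}"
      then have "monom_at m \<theta> = monom_at a \<theta> * monom_at (\<lambda>i. m i - a i) \<theta>"
        by (intro monom_at_split) simp
      then show "monom_at m \<theta> *\<^sub>R (f a * g (\<lambda>i. m i - a i)) = h ((\<lambda>(m, a). (a, \<lambda>i. m i - a i)) (m, a))"
        by (simp add: h_def)
    qed simp
    then show ?thesis
      by (simp only:) (rule has_sum_finite[OF finite_le_multi])
  qed
  show "((\<lambda>m. monom_at m \<theta> *\<^sub>R conv f g m) has_sum (pser f \<theta> * pser g \<theta>)) UNIV"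
    by (rule has_sum_SigmaD[OF * **])
qed

lemma majorized_conv:
  fixes f g :: "('d::finite \<Rightarrow> nat) \<Rightarrow> 'a::real_normed_algebra"
  assumes f: "majorized f r K" and g: "majorized g r L" and r: "0 \<le> r"
  shows "majorized (conv f g) r (K * L)"
  unfolding majorized_def
proof (intro allI impI)
  fix F :: "('d \<Rightarrow> nat) set" assume F: "finite F"
  define h where "h = (\<lambda>(a, b). (norm (f a) * r ^ mdeg a) * (norm (g b) * r ^ mdeg b))"
  define \<phi> :: "('d \<Rightarrow> nat) \<times> ('d \<Rightarrow> nat) \<Rightarrow> ('d \<Rightarrow> nat) \<times> ('d \<Rightarrow> nat)"
    where "\<phi> = (\<lambda>(m, a). (a, \<lambda>i. m i - a i))"
  define H where "H = (SIGMA m:F. {a. a \<le> m})"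
  have H: "finite H" unfolding H_def using F finite_le_multi by auto
  have inj: "inj_on \<phi> H"
    unfolding \<phi>_def H_def by (rule inj_on_subset[OF bij_betw_imp_inj_on[OF conv_reindex]]) auto
  have "(\<Sum>m\<in>F. norm (conv f g m) * r ^ mdeg m) \<le> (\<Sum>m\<in>F. \<Sum>a | a \<le> m. h (\<phi> (m, a)))"
  proof (rule sum_mono)
    fix m
    have "norm (conv f g m) * r ^ mdeg m \<le> (\<Sum>a | a \<le> m. norm (f a) * norm (g (\<lambda>i. m i - a i))) * r ^ mdeg m"
      unfolding conv_def using r
      by (intro mult_right_mono order_trans[OF norm_sum] sum_mono norm_mult_ineq) auto
    also have "\<dots> = (\<Sum>a | a \<le> m. h (\<phi> (m, a)))"
      unfolding sum_distrib_right
    proof (rule sum.cong)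
      fix a assume "a \<in> {a. a \<le> m}"
      then have "mdeg m = mdeg a + mdeg (\<lambda>i. m i - a i)"
        by (intro mdeg_split) simp
      then show "norm (f a) * norm (g (\<lambda>i. m i - a i)) * r ^ mdeg m = h (\<phi> (m, a))"
        by (simp add: h_def \<phi>_def power_add)
    qed simp
    finally show "norm (conv f g m) * r ^ mdeg m \<le> (\<Sum>a | a \<le> m. h (\<phi> (m, a)))" .
  qed
  also have "\<dots> = (\<Sum>z\<in>H. h (\<phi> z))"
    unfolding H_def using F finite_le_multi by (subst sum.Sigma) auto
  also have "\<dots> = (\<Sum>z\<in>\<phi> ` H. h z)" by (simp add: sum.reindex[OF inj])
  \<comment> \<open>The index pairs are enclosed in the rectangle of their two projections. The
    added terms are nonnegative, and over a rectangle the sum factors.\<close>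
  also have "\<dots> \<le> (\<Sum>z\<in>(fst ` \<phi> ` H) \<times> (snd ` \<phi> ` H). h z)"
  proof (rule sum_mono2)
    show "\<phi> ` H \<subseteq> (fst ` \<phi> ` H) \<times> (snd ` \<phi> ` H)" by (rule subset_fst_snd)
  qed (use H r in \<open>auto simp: h_def\<close>)
  also have "\<dots> = (\<Sum>a\<in>fst ` \<phi> ` H. norm (f a) * r ^ mdeg a) * (\<Sum>b\<in>snd ` \<phi> ` H. norm (g b) * r ^ mdeg b)"
    by (simp add: h_def sum_product sum.cartesian_product)
  also have "\<dots> \<le> K * L"
    using H r majorized_nonneg[OF f]
    by (intro mult_mono majorizedD[OF f] majorizedD[OF g] sum_nonneg) auto
  finally show "(\<Sum>m\<in>F. norm (conv f g m) * r ^ mdeg m) \<le> K * L" .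
qed

section \<open>Composition with the nonlinearity\<close>

text \<open>The algebra may lack a unit, so the exponent is shifted: \<open>conv_pow p k\<close>
  belongs to the power \<open>k + 1\<close> of the series.\<close>

definition conv_pow :: "(('d::finite \<Rightarrow> nat) \<Rightarrow> 'a::real_normed_algebra) \<Rightarrow> nat \<Rightarrow> ('d \<Rightarrow> nat) \<Rightarrow> 'a" where
  "conv_pow p k = (conv p ^^ k) p"

text \<open>The coefficients of \<open>N \<circ> P\<close> if \<open>P\<close> has the coefficients \<open>p\<close> with \<open>p\<^sub>0 = 0\<close>: then the \<open>(k + 2)\<close>-nd power
  of \<open>P\<close> has no terms of degree below \<open>k + 2\<close>, so the sum over \<open>k\<close> may be cut off.\<close>

definition Ncoef :: "(nat \<Rightarrow> 'a::real_normed_algebra) \<Rightarrow> (('d::finite \<Rightarrow> nat) \<Rightarrow> 'a) \<Rightarrow> ('d \<Rightarrow> nat) \<Rightarrow> 'a" where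
  "Ncoef n p m = (\<Sum>k<mdeg m. n (k + 2) * conv_pow p (Suc k) m)"

lemma conv_pow_Suc: "conv_pow p (Suc k) = conv p (conv_pow p k)"
  by (simp add: conv_pow_def)

lemma majorized_conv_pow:
  assumes "majorized p r \<rho>" "0 \<le> r"
  shows "majorized (conv_pow p k) r (\<rho> ^ Suc k)"
proof (induction k)
  case 0
  then show ?case using assms by (simp add: conv_pow_def)
next
  case (Suc k)
  then show ?case
    using majorized_conv[OF assms(1) Suc assms(2)] by (simp add: conv_pow_Suc)
qed

lemma pser_conv_pow:
  fixes p :: "('d::finite \<Rightarrow> nat) \<Rightarrow> 'a::{banach,real_normed_algebra}"
  assumes "majorized p r \<rho>" "\<And>j. \<bar>\<theta> $ j\<bar> \<le> r"
  shows "pser (conv_pow p k) \<theta> = ((*) (pser p \<theta>) ^^ k) (pser p \<theta>)"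
proof (induction k)
  case 0
  then show ?case by (simp add: conv_pow_def)
next
  case (Suc k)
  have "0 \<le> r" using assms(2) abs_ge_zero order_trans by blast
  then show ?case
    using pser_conv[OF assms(1) majorized_conv_pow[OF assms(1)] assms(2)] Suc by (simp add: conv_pow_Suc)
qed

text \<open>Once the constant term vanishes, each of the \<open>k + 1\<close> factors has degree at
  least 1, so nothing of total degree \<open>k\<close> or less survives.\<close>

lemma conv_pow_low:
  assumes "p (\<lambda>_. 0) = 0" "mdeg m \<le> k"
  shows "conv_pow p k m = 0"
  using assms(2)
proof (induction k arbitrary: m)
  case 0
  then show ?case using assms(1) by (simp add: conv_pow_def mdeg_eq_0_iff)
next
  case (Suc k)
  have "p a * conv_pow p k (\<lambda>i. m i - a i) = 0" if a: "a \<le> m" for a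
  proof (cases "mdeg a = 0")
    case True
    then show ?thesis using assms(1) by (simp add: mdeg_eq_0_iff)
  next
    case False
    then show ?thesis using Suc mdeg_split[OF a] by simp
  qed
  then show ?case by (simp add: conv_pow_Suc conv_def)
qed

lemma conv_pow_cong:
  assumes "\<And>a. mdeg a < N \<Longrightarrow> p a = q a" "mdeg m < N"
  shows "conv_pow p k m = conv_pow q k m"
  using assms(2)
proof (induction k arbitrary: m)
  case 0
  then show ?case using assms(1) by (simp add: conv_pow_def)
next
  case (Suc k)
  have "p a * conv_pow p k (\<lambda>i. m i - a i) = q a * conv_pow q k (\<lambda>i. m i - a i)" if a: "a \<le> m" for a
    using Suc mdeg_split[OF a] assms(1) by simp
  then show ?case by (simp add: conv_pow_Suc conv_def)
qed

text \<open>Every power in \<open>N\<close> has at least two factors. If one factor carries the full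
  degree \<open>mdeg m\<close>, the other has degree 0 and vanishes; otherwise both degrees are
  smaller. This strictness turns the homological equations into a recursion.\<close>

lemma Ncoef_cong:
  assumes eq: "\<And>a. mdeg a < mdeg m \<Longrightarrow> p a = q a" and 0: "p (\<lambda>_. 0) = 0" "q (\<lambda>_. 0) = 0"
  shows "Ncoef n p m = Ncoef n q m"
proof -
  have "p a * conv_pow p k (\<lambda>i. m i - a i) = q a * conv_pow q k (\<lambda>i. m i - a i)" if a: "a \<le> m" for a k
  proof -
    consider "mdeg a = 0" | "mdeg (\<lambda>i. m i - a i) = 0" | "mdeg a < mdeg m" "mdeg (\<lambda>i. m i - a i) < mdeg m"
      using mdeg_split[OF a] by linarith
    then show ?thesis
    proof cases
      case 1
      then show ?thesis using 0 by (simp add: mdeg_eq_0_iff)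
    next
      case 2
      then show ?thesis using conv_pow_low 0 by (metis le0 mult_zero_right)
    next
      case 3
      then show ?thesis using eq conv_pow_cong[of "mdeg m" p q] by simp
    qed
  qed
  then show ?thesis by (simp add: Ncoef_def conv_pow_Suc conv_def)
qed

lemma conv_pow_scale:
  "conv_pow (\<lambda>m. monom_at m s *\<^sub>R p m) k m = monom_at m s *\<^sub>R conv_pow p k m"
proof (induction k arbitrary: m)
  case 0
  then show ?case by (simp add: conv_pow_def)
next
  case (Suc k)
  have "monom_at a s *\<^sub>R p a * (monom_at (\<lambda>i. m i - a i) s *\<^sub>R conv_pow p k (\<lambda>i. m i - a i))
      = monom_at m s *\<^sub>R (p a * conv_pow p k (\<lambda>i. m i - a i))" if a: "a \<le> m" for a
    by (subst monom_at_split[OF a]) simp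
  then show ?case unfolding conv_pow_Suc conv_def Suc scaleR_sum_right by (intro sum.cong) auto
qed

lemma Ncoef_scale: "Ncoef n (\<lambda>m. monom_at m s *\<^sub>R p m) m = monom_at m s *\<^sub>R Ncoef n p m"
  by (simp add: Ncoef_def conv_pow_scale scaleR_sum_right)

lemma Ncoef_deg_le_1:
  assumes "p (\<lambda>_. 0) = 0" "mdeg m \<le> 1"
  shows "Ncoef n p m = 0"
  using assms by (simp add: Ncoef_def conv_pow_low)

text \<open>Norms of products are replaced by products of norms, so the composition is dominated by
  the scalar norm series of \<open>N\<close> evaluated at \<open>\<rho>\<close>.\<close>

lemma majorized_Ncoef:
  fixes p :: "('d::finite \<Rightarrow> nat) \<Rightarrow> 'a::real_normed_algebra"
  assumes p: "majorized p r \<rho>" and r: "0 \<le> r" and sm: "summable (\<lambda>j. norm (n (j + 2)) * \<rho> ^ (j + 2))"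
  shows "majorized (Ncoef n p) r (\<Sum>j. norm (n (j + 2)) * \<rho> ^ (j + 2))"
  unfolding majorized_def
proof (intro allI impI)
  fix F :: "('d \<Rightarrow> nat) set" assume F: "finite F"
  \<comment> \<open>A common cutoff for all \<open>m\<close> in \<open>F\<close> allows the sums
    over \<open>m\<close> and \<open>k\<close> to be exchanged; the terms added beyond
    \<open>mdeg m\<close> are nonnegative.\<close>
  define B where "B = Max (insert 0 (mdeg ` F))"
  have B: "mdeg m \<le> B" if "m \<in> F" for m unfolding B_def using F that by (intro Max_ge) auto
  have \<rho>: "0 \<le> \<rho>" using majorized_nonneg[OF p] .
  have "(\<Sum>m\<in>F. norm (Ncoef n p m) * r ^ mdeg m)
      \<le> (\<Sum>m\<in>F. \<Sum>k<B. norm (n (k + 2)) * (norm (conv_pow p (Suc k) m) * r ^ mdeg m))"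
  proof (rule sum_mono)
    fix m assume m: "m \<in> F"
    have "norm (Ncoef n p m) \<le> (\<Sum>k<mdeg m. norm (n (k + 2)) * norm (conv_pow p (Suc k) m))"
      unfolding Ncoef_def by (intro order_trans[OF norm_sum] sum_mono norm_mult_ineq)
    also have "\<dots> \<le> (\<Sum>k<B. norm (n (k + 2)) * norm (conv_pow p (Suc k) m))"
      using B[OF m] by (intro sum_mono2) auto
    finally have "norm (Ncoef n p m) * r ^ mdeg m \<le>
        (\<Sum>k<B. norm (n (k + 2)) * norm (conv_pow p (Suc k) m)) * r ^ mdeg m"
      using r by (intro mult_right_mono) auto
    then show "norm (Ncoef n p m) * r ^ mdeg m
        \<le> (\<Sum>k<B. norm (n (k + 2)) * (norm (conv_pow p (Suc k) m) * r ^ mdeg m))"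
      by (simp add: sum_distrib_right mult.assoc)
  qed
  also have "\<dots> = (\<Sum>k<B. norm (n (k + 2)) * (\<Sum>m\<in>F. norm (conv_pow p (Suc k) m) * r ^ mdeg m))"
    by (subst sum.swap) (simp add: sum_distrib_left)
  also have "\<dots> \<le> (\<Sum>k<B. norm (n (k + 2)) * \<rho> ^ Suc (Suc k))"
    by (intro sum_mono mult_left_mono majorizedD[OF majorized_conv_pow[OF p r] F]) auto
  also have "\<dots> = (\<Sum>k<B. norm (n (k + 2)) * \<rho> ^ (k + 2))"
    by simp
  also have "\<dots> \<le> (\<Sum>j. norm (n (j + 2)) * \<rho> ^ (j + 2))"
    using \<rho> by (intro sum_le_suminf[OF sm]) auto
  finally show "(\<Sum>m\<in>F. norm (Ncoef n p m) * r ^ mdeg m) \<le> (\<Sum>j. norm (n (j + 2)) * \<rho> ^ (j + 2))" .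
qed

section \<open>Size, domain and Lipschitz estimates for the nonlinearity\<close>

lemma norm_funpow_mult_le:
  fixes x :: "'a::real_normed_algebra"
  shows "norm (((*) x ^^ k) x) \<le> norm x ^ Suc k"
proof (induction k)
  case (Suc k)
  have "norm (x * ((*) x ^^ k) x) \<le> norm x * norm (((*) x ^^ k) x)" by (rule norm_mult_ineq)
  also have "\<dots> \<le> norm x * norm x ^ Suc k" using Suc by (intro mult_left_mono) auto
  finally show ?case by simp
qed simp

text \<open>The factors \<open>x\<close> are exchanged for \<open>y\<close> one at a time: there are
  \<open>Suc k\<close> exchanges, and each leaves \<open>k\<close> factors of size at most
  \<open>\<rho>\<close>.\<close>

lemma norm_funpow_mult_diff_le:
  fixes x y :: "'a::real_normed_algebra"
  assumes "norm x \<le> \<rho>" "norm y \<le> \<rho>"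
  shows "norm (((*) x ^^ k) x - ((*) y ^^ k) y) \<le> real (Suc k) * \<rho> ^ k * norm (x - y)"
proof (induction k)
  case (Suc k)
  let ?X = "((*) x ^^ k) x" and ?Y = "((*) y ^^ k) y"
  have \<rho>: "0 \<le> \<rho>" using assms(1) norm_ge_zero order_trans by blast
  have "((*) x ^^ Suc k) x - ((*) y ^^ Suc k) y = x * (?X - ?Y) + (x - y) * ?Y"
    by (simp add: algebra_simps)
  also have "norm \<dots> \<le> norm x * norm (?X - ?Y) + norm (x - y) * norm ?Y"
    by (intro order_trans[OF norm_triangle_ineq] add_mono norm_mult_ineq)
  also have "\<dots> \<le> \<rho> * (real (Suc k) * \<rho> ^ k * norm (x - y)) + norm (x - y) * \<rho> ^ Suc k"
    using assms \<rho> Suc norm_funpow_mult_le[of k y] power_mono[OF assms(2) norm_ge_zero, of "Suc k"]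
    by (intro add_mono mult_mono) auto
  also have "\<dots> = real (Suc (Suc k)) * \<rho> ^ Suc k * norm (x - y)"
    by (simp add: algebra_simps)
  finally show ?case .
qed simp

lemma star_pow_add_2: "star_pow x (j + 2) = ((*) x ^^ Suc j) x"
  by (simp add: star_pow_def)

lemma N_series_abs_summable:
  fixes x :: "'a::{banach,real_normed_algebra,comm_ring}"
  assumes sm: "summable (\<lambda>j. norm (n (j + 2)) * \<rho> ^ (j + 2))" and x: "norm x \<le> \<rho>"
  shows "summable (\<lambda>j. norm (n (j + 2) * star_pow x (j + 2)))"
proof (rule summable_comparison_test'[OF sm])
  fix j
  have "norm (n (j + 2) * star_pow x (j + 2)) \<le> norm (n (j + 2)) * norm x ^ (j + 2)"
    using norm_funpow_mult_le[of "Suc j" x]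
    by (intro order_trans[OF norm_mult_ineq] mult_left_mono) (simp_all add: star_pow_def)
  also have "\<dots> \<le> norm (n (j + 2)) * \<rho> ^ (j + 2)"
    using x by (intro mult_left_mono power_mono) auto
  finally show "norm (norm (n (j + 2) * star_pow x (j + 2))) \<le> norm (n (j + 2)) * \<rho> ^ (j + 2)" by simp
qed

lemma N_dom_ball:
  fixes x :: "'a::{banach,real_normed_algebra,comm_ring}"
  assumes "summable (\<lambda>j. norm (n (j + 2)) * \<rho> ^ (j + 2))" "norm x \<le> \<rho>"
  shows "x \<in> N_dom n"
  unfolding N_dom_def using summable_norm_cancel[OF N_series_abs_summable[OF assms]] by simp

text \<open>The double family over \<open>(k, m)\<close> is absolutely summable and may be summed in
  either order: over \<open>m\<close> first it gives the terms of \<open>N_fun\<close>, over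
  \<open>k\<close> first the coefficients \<open>Ncoef\<close>.\<close>

lemma pser_Ncoef:
  fixes p :: "('d::finite \<Rightarrow> nat) \<Rightarrow> 'a::{banach,real_normed_algebra,comm_ring}"
  assumes p: "majorized p r \<rho>" and \<theta>: "\<And>j. \<bar>\<theta> $ j\<bar> \<le> r"
    and sm: "summable (\<lambda>j. norm (n (j + 2)) * \<rho> ^ (j + 2))" and p0: "p (\<lambda>_. 0) = 0"
  shows "pser (Ncoef n p) \<theta> = N_fun n (pser p \<theta>)"
proof -
  define h where "h = (\<lambda>(k, m). n (k + 2) * (monom_at m \<theta> *\<^sub>R conv_pow p (Suc k) m))"
  have r: "0 \<le> r" using \<theta> abs_ge_zero order_trans by blast
  have \<rho>: "0 \<le> \<rho>" using majorized_nonneg[OF p] .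
  have mj: "majorized (conv_pow p (Suc k)) r (\<rho> ^ (k + 2))" for k
    using majorized_conv_pow[OF p r, of "Suc k"] by simp
  define g where "g k = (\<Sum>\<^sub>\<infinity>m. norm (conv_pow p (Suc k) m) * r ^ mdeg m)" for k
  have g: "g k \<le> \<rho> ^ (k + 2)" for k
    unfolding g_def using majorizedD[OF mj]
    by (intro infsum_le_finite_sums majorized_summable[OF mj r]) auto
  have g0: "0 \<le> g k" for k unfolding g_def using r by (intro infsum_nonneg) auto
  have "summable (\<lambda>k. norm (n (k + 2)) * g k)"
    using g g0 by (intro summable_comparison_test'[OF sm]) (auto intro!: mult_left_mono)
  then have gs: "(\<lambda>k. norm (n (k + 2)) * g k) summable_on UNIV"
    using g0 by (intro summable_nonneg_imp_summable_on) auto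
  have "(\<lambda>(k, m). norm (n (k + 2)) * (norm (conv_pow p (Suc k) m) * r ^ mdeg m)) summable_on (UNIV \<times> UNIV)"
  proof (rule summable_on_SigmaI[OF _ gs])
    show "((\<lambda>m. case (k, m) of (k, m) \<Rightarrow> norm (n (k + 2)) * (norm (conv_pow p (Suc k) m) * r ^ mdeg m))
        has_sum norm (n (k + 2)) * g k) UNIV" for k
      using has_sum_cmult_right[OF has_sum_infsum[OF majorized_summable[OF mj r]]]
      by (simp add: g_def)
  qed (use r in auto)
  moreover have "norm (h z) \<le> (case z of (k, m) \<Rightarrow> norm (n (k + 2)) * (norm (conv_pow p (Suc k) m) * r ^ mdeg m))" for z
  proof (cases z)
    case (Pair k m)
    have "norm (h (k, m)) \<le> norm (n (k + 2)) * (\<bar>monom_at m \<theta>\<bar> * norm (conv_pow p (Suc k) m))"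
      unfolding h_def using norm_mult_ineq[of "n (k + 2)" "monom_at m \<theta> *\<^sub>R conv_pow p (Suc k) m"] by simp
    also have "\<dots> \<le> norm (n (k + 2)) * (r ^ mdeg m * norm (conv_pow p (Suc k) m))"
      by (intro mult_left_mono mult_right_mono abs_monom_at_le[OF \<theta>]) auto
    finally show ?thesis using Pair by (simp add: mult.commute)
  qed
  ultimately have s: "h summable_on (UNIV \<times> UNIV)"
    by (rule abs_summable_summable[OF Infinite_Sum.abs_summable_on_comparison_test'])
  have Nx: "(\<lambda>j. n (j + 2) * star_pow (pser p \<theta>) (j + 2)) sums N_fun n (pser p \<theta>)"
    unfolding N_fun_def
    by (rule summable_sums[OF summable_norm_cancel[OF N_series_abs_summable[OF sm norm_pser_le[OF p \<theta>]]]])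
  have "((\<lambda>j. n (j + 2) * star_pow (pser p \<theta>) (j + 2)) has_sum N_fun n (pser p \<theta>)) UNIV"
    by (rule norm_summable_imp_has_sum[OF N_series_abs_summable[OF sm norm_pser_le[OF p \<theta>]] Nx])
  moreover have "((\<lambda>m. h (k, m)) has_sum n (k + 2) * star_pow (pser p \<theta>) (k + 2)) UNIV" for k
    unfolding h_def using has_sum_bounded_linear[OF bounded_linear_mult_right pser_has_sum[OF mj \<theta>]]
    by (simp add: star_pow_def pser_conv_pow[OF p \<theta>])
  ultimately have "(h has_sum N_fun n (pser p \<theta>)) (UNIV \<times> UNIV)"
    using s by (intro has_sum_SigmaI) auto
  then have H: "((\<lambda>(m, k). h (k, m)) has_sum N_fun n (pser p \<theta>)) (UNIV \<times> UNIV)"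
    by (subst has_sum_swap) simp
  have "((\<lambda>m. monom_at m \<theta> *\<^sub>R Ncoef n p m) has_sum N_fun n (pser p \<theta>)) UNIV"
  proof (rule has_sum_SigmaD[OF H])
    fix m :: "'d \<Rightarrow> nat"
    \<comment> \<open>Only finitely many \<open>k\<close> contribute, since a high power of a series
      without constant term has no coefficient at \<open>m\<close>.\<close>
    have "((\<lambda>k. h (k, m)) has_sum (\<Sum>k<mdeg m. h (k, m))) UNIV"
      using conv_pow_low[of p m, OF p0] by (intro has_sum_finite_neutralI) (auto simp: h_def)
    moreover have "(\<Sum>k<mdeg m. h (k, m)) = monom_at m \<theta> *\<^sub>R Ncoef n p m"
      by (simp add: h_def Ncoef_def scaleR_sum_right)
    ultimately show "((\<lambda>k. case (m, k) of (m, k) \<Rightarrow> h (k, m)) has_sum monom_at m \<theta> *\<^sub>R Ncoef n p m) UNIV"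
      by simp
  qed
  then show ?thesis by (rule pser_eqI)
qed

text \<open>Since \<open>N\<close> starts with quadratic terms, its Lipschitz constant on the ball
  of radius \<open>\<rho>\<close> is proportional to \<open>\<rho>\<close>, hence as small as
  desired near the equilibrium. The restriction to \<open>R / 2\<close> pays for the factor
  \<open>j + 2\<close> that comes from the difference of two powers.\<close>

lemma N_fun_lipschitz:
  fixes n :: "nat \<Rightarrow> 'a::{banach,real_normed_algebra,comm_ring}"
  assumes R: "R > 0" and sm: "summable (\<lambda>j. norm (n (j + 2)) * R ^ (j + 2))"
  obtains L where "L > 0"
    "\<And>\<rho> x y. \<rho> \<le> R / 2 \<Longrightarrow> norm x \<le> \<rho> \<Longrightarrow> norm y \<le> \<rho> \<Longrightarrow>
       norm (N_fun n x - N_fun n y) \<le> L * \<rho> * norm (x - y)"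
proof -
  define L where "L = 2 / R\<^sup>2 * (\<Sum>j. norm (n (j + 2)) * R ^ (j + 2))"
  have L0: "L \<ge> 0" unfolding L_def by (intro mult_nonneg_nonneg suminf_nonneg sm) (use R in auto)
  have "norm (N_fun n x - N_fun n y) \<le> L * \<rho> * norm (x - y)"
    if \<rho>R: "\<rho> \<le> R / 2" and x: "norm x \<le> \<rho>" and y: "norm y \<le> \<rho>" for \<rho> x y
  proof -
    have \<rho>: "0 \<le> \<rho>" using x norm_ge_zero order_trans by blast
    have dom: "summable (\<lambda>j. n (j + 2) * star_pow z (j + 2))" if "norm z \<le> \<rho>" for z
      using summable_norm_cancel[OF N_series_abs_summable[OF sm, of z]] that \<rho>R R by simp
    have sterm: "norm (n (j + 2) * star_pow x (j + 2) - n (j + 2) * star_pow y (j + 2)) \<le>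
        norm (n (j + 2)) * R ^ (j + 2) * (2 / R\<^sup>2 * \<rho> * norm (x - y))" for j
    proof -
      have "norm (n (j + 2) * star_pow x (j + 2) - n (j + 2) * star_pow y (j + 2))
        \<le> norm (n (j + 2)) * norm (((*) x ^^ Suc j) x - ((*) y ^^ Suc j) y)"
        unfolding star_pow_add_2 right_diff_distrib[symmetric] by (rule norm_mult_ineq)
      also have "\<dots> \<le> norm (n (j + 2)) * (real (j + 2) * \<rho> ^ Suc j * norm (x - y))"
        using norm_funpow_mult_diff_le[OF x y, of "Suc j"] by (intro mult_left_mono) auto
      also have "\<dots> \<le> norm (n (j + 2)) * ((2 * R ^ j * \<rho>) * norm (x - y))"
      proof (intro mult_left_mono mult_right_mono)
        have "real (j + 2) \<le> 2 * 2 ^ j"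
          by (induction j) auto
        then have "real (j + 2) * (\<rho> ^ j * \<rho>) \<le> (2 * 2 ^ j) * ((R / 2) ^ j * \<rho>)"
          using \<rho> \<rho>R R by (intro mult_mono power_mono mult_right_mono) auto
        also have "\<dots> = 2 * R ^ j * \<rho>" by (simp add: power_divide)
        finally show "real (j + 2) * \<rho> ^ Suc j \<le> 2 * R ^ j * \<rho>" by (simp add: mult.commute)
      qed auto
      also have "\<dots> = norm (n (j + 2)) * R ^ (j + 2) * (2 / R\<^sup>2 * \<rho> * norm (x - y))"
        using R by (simp add: power_add power2_eq_square field_simps)
      finally show ?thesis .
    qed
    have sd: "summable (\<lambda>j. norm (n (j + 2)) * R ^ (j + 2) * (2 / R\<^sup>2 * \<rho> * norm (x - y)))"
      by (rule summable_mult2[OF sm])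
    have "N_fun n x - N_fun n y = (\<Sum>j. n (j + 2) * star_pow x (j + 2) - n (j + 2) * star_pow y (j + 2))"
      unfolding N_fun_def by (rule suminf_diff[OF dom[OF x] dom[OF y]])
    also have "norm \<dots> \<le> (\<Sum>j. norm (n (j + 2)) * R ^ (j + 2) * (2 / R\<^sup>2 * \<rho> * norm (x - y)))"
      by (rule norm_suminf_le[OF sterm sd])
    also have "\<dots> = L * \<rho> * norm (x - y)"
      unfolding L_def by (subst suminf_mult2[OF sm, symmetric]) simp
    finally show ?thesis .
  qed
  note * = this
  \<comment> \<open>The added 1 makes the constant strictly positive even when \<open>N\<close>
    vanishes.\<close>
  show thesis
  proof (rule that[of "L + 1"])
    fix \<rho> and x y :: 'a assume a: "\<rho> \<le> R / 2" "norm x \<le> \<rho>" "norm y \<le> \<rho>"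
    have "L * \<rho> * norm (x - y) \<le> (L + 1) * \<rho> * norm (x - y)"
      using order_trans[OF norm_ge_zero a(2)] by (intro mult_right_mono) auto
    with *[OF a] show "norm (N_fun n x - N_fun n y) \<le> (L + 1) * \<rho> * norm (x - y)" by linarith
  qed (use L0 in simp)
qed

section \<open>Termwise differentiation\<close>

lemma has_sum_diff:
  fixes f g :: "'i \<Rightarrow> 'a::real_normed_vector"
  assumes "(f has_sum a) A" "(g has_sum b) A"
  shows "((\<lambda>i. f i - g i) has_sum (a - b)) A"
  using has_sum_add[OF assms(1), of "\<lambda>i. - g i" "- b"] assms(2) by (simp add: has_sum_uminus)

text \<open>By the mean value inequality each term is Lipschitz with constant \<open>b i\<close>. A
  finite part is differentiated exactly, and the error of the remaining terms is controlled by the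
  tail of \<open>b\<close>.\<close>

lemma has_derivative_infsum:
  fixes f :: "'i \<Rightarrow> 'b::real_normed_vector \<Rightarrow> 'a::banach"
  assumes S: "open S" "convex S" and x: "x \<in> S"
    and f': "\<And>i y. y \<in> S \<Longrightarrow> (f i has_derivative f' i y) (at y)"
    and bd: "\<And>i y v. y \<in> S \<Longrightarrow> norm (f' i y v) \<le> b i * norm v"
    and b: "b summable_on UNIV" "\<And>i. 0 \<le> b i"
    and sf: "\<And>y. y \<in> S \<Longrightarrow> (\<lambda>i. f i y) summable_on UNIV"
  shows "((\<lambda>y. \<Sum>\<^sub>\<infinity>i. f i y) has_derivative (\<lambda>v. \<Sum>\<^sub>\<infinity>i. f' i x v)) (at x)"
  unfolding has_derivative_at_alt
proof (intro conjI allI impI)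
  have lin: "bounded_linear (f' i x)" for i using f'[OF x] by (rule has_derivative_bounded_linear)
  have sf': "(\<lambda>i. f' i x v) summable_on UNIV" for v
    by (rule abs_summable_summable, rule Infinite_Sum.abs_summable_on_comparison_test'[where g = "\<lambda>i. b i * norm v"])
       (use b bd[OF x] in \<open>auto intro: summable_on_cmult_left\<close>)
  have nb: "norm (\<Sum>\<^sub>\<infinity>i\<in>A. g i) \<le> infsum b A * c"
    if "\<And>i. norm (g i) \<le> b i * c" "g summable_on A" for g :: "'i \<Rightarrow> 'a" and c A
    by (rule norm_infsum_le[OF has_sum_infsum[OF that(2)]
          has_sum_cmult_left[OF has_sum_infsum[OF summable_on_subset_banach[OF b(1)]]]]) (use that in auto)
  show "bounded_linear (\<lambda>v. \<Sum>\<^sub>\<infinity>i. f' i x v)"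
  proof (rule bounded_linear_intro[where K = "infsum b UNIV"])
    show "(\<Sum>\<^sub>\<infinity>i. f' i x (v + w)) = (\<Sum>\<^sub>\<infinity>i. f' i x v) + (\<Sum>\<^sub>\<infinity>i. f' i x w)" for v w
      using infsum_add[OF sf' sf'] by (simp add: bounded_linear.linear[OF lin] linear_add)
    show "(\<Sum>\<^sub>\<infinity>i. f' i x (c *\<^sub>R v)) = c *\<^sub>R (\<Sum>\<^sub>\<infinity>i. f' i x v)" for c v
      by (simp add: bounded_linear.linear[OF lin] linear_scale infsum_scaleR_right)
    show "norm (\<Sum>\<^sub>\<infinity>i. f' i x v) \<le> norm v * infsum b UNIV" for v
      using nb[OF bd[OF x] sf', of v] by (simp add: mult.commute)
  qed
  fix e :: real assume e: "0 < e"
  \<comment> \<open>The tail enters twice, through the increment and through the derivative, so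
    \<open>e / 4\<close> here leaves \<open>e / 2\<close> for the finite part.\<close>
  obtain F where F: "finite F" "dist (sum b F) (infsum b UNIV) \<le> e / 4"
    using has_sum_finite_approximation[OF has_sum_infsum[OF b(1)], of "e / 4"] e by auto
  have "infsum b (UNIV - F) = infsum b UNIV - infsum b F"
    by (rule infsum_Diff) (use b F in auto)
  moreover have "\<bar>sum b F - infsum b UNIV\<bar> \<le> e / 4" using F(2) by (simp add: dist_real_def)
  ultimately have tail: "infsum b (UNIV - F) \<le> e / 4" using F(1) unfolding abs_le_iff by simp
  obtain d1 where d1: "d1 > 0" "ball x d1 \<subseteq> S" using S x openE by blast
  have "((\<lambda>y. \<Sum>i\<in>F. f i y) has_derivative (\<lambda>v. \<Sum>i\<in>F. f' i x v)) (at x)"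
    by (intro has_derivative_sum f'[OF x])
  then obtain d2 where d2: "d2 > 0" "\<And>y. norm (y - x) < d2 \<Longrightarrow>
      norm ((\<Sum>i\<in>F. f i y) - (\<Sum>i\<in>F. f i x) - (\<Sum>i\<in>F. f' i x (y - x))) \<le> e / 2 * norm (y - x)"
    unfolding has_derivative_at_alt using e by (metis half_gt_zero)
  show "\<exists>d>0. \<forall>y. norm (y - x) < d \<longrightarrow>
      norm ((\<Sum>\<^sub>\<infinity>i. f i y) - (\<Sum>\<^sub>\<infinity>i. f i x) - (\<Sum>\<^sub>\<infinity>i. f' i x (y - x))) \<le> e * norm (y - x)"
  proof (intro exI[of _ "min d1 d2"] conjI allI impI)
    fix y assume y: "norm (y - x) < min d1 d2"
    then have yS: "y \<in> S" using d1 by (auto simp: subset_iff dist_norm norm_minus_commute)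
    define D where "D i = f i y - f i x - f' i x (y - x)" for i
    have Dh: "(D has_sum ((\<Sum>\<^sub>\<infinity>i. f i y) - (\<Sum>\<^sub>\<infinity>i. f i x) - (\<Sum>\<^sub>\<infinity>i. f' i x (y - x)))) UNIV"
      unfolding D_def by (intro has_sum_diff has_sum_infsum sf sf' x yS)
    then have Ds: "D summable_on UNIV" by (rule has_sum_imp_summable)
    have "(\<Sum>\<^sub>\<infinity>i. f i y) - (\<Sum>\<^sub>\<infinity>i. f i x) - (\<Sum>\<^sub>\<infinity>i. f' i x (y - x)) = infsum D UNIV"
      using infsumI[OF Dh] by simp
    also have "\<dots> = infsum D F + infsum D (UNIV - F)"
      using infsum_Diff[OF Ds, of F] F by simp
    finally have eq: "(\<Sum>\<^sub>\<infinity>i. f i y) - (\<Sum>\<^sub>\<infinity>i. f i x) - (\<Sum>\<^sub>\<infinity>i. f' i x (y - x)) = sum D F + infsum D (UNIV - F)"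
      using F by simp
    have "norm (D i) \<le> b i * (2 * norm (y - x))" for i
    proof -
      have "norm (f i y - f i x) \<le> b i * norm (y - x)"
      proof (rule differentiable_bound[OF S(2) _ _ yS x])
        show "(f i has_derivative f' i z) (at z within S)" if "z \<in> S" for z
          using f'[OF that] has_derivative_at_withinI by blast
        show "onorm (f' i z) \<le> b i" if "z \<in> S" for z
          by (rule onorm_bound[OF b(2) bd[OF that]])
      qed
      then show ?thesis
        unfolding D_def using norm_triangle_ineq4[of "f i y - f i x" "f' i x (y - x)"] bd[OF x, of i "y - x"]
        by simp
    qed
    then have "norm (infsum D (UNIV - F)) \<le> infsum b (UNIV - F) * (2 * norm (y - x))"
      by (intro nb summable_on_subset_banach[OF Ds]) auto
    also have "\<dots> \<le> e / 4 * (2 * norm (y - x))"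
      using tail by (intro mult_right_mono) auto
    finally have "norm (infsum D (UNIV - F)) \<le> e / 2 * norm (y - x)" by simp
    moreover have "norm (sum D F) \<le> e / 2 * norm (y - x)"
      using d2(2)[of y] y by (simp add: D_def sum_subtractf)
    ultimately show "norm ((\<Sum>\<^sub>\<infinity>i. f i y) - (\<Sum>\<^sub>\<infinity>i. f i x) - (\<Sum>\<^sub>\<infinity>i. f' i x (y - x))) \<le> e * norm (y - x)"
      unfolding eq using norm_triangle_ineq[of "sum D F" "infsum D (UNIV - F)"] by simp
  qed (use d1 d2 in auto)
qed

section \<open>Derivatives of monomials and of power series\<close>

definition dmonom :: "('d::finite \<Rightarrow> nat) \<Rightarrow> real ^ 'd \<Rightarrow> real ^ 'd \<Rightarrow> real" where
  "dmonom m \<theta> v = (\<Sum>i\<in>UNIV. v $ i * (real (m i) * (\<theta> $ i) ^ (m i - 1)) * (\<Prod>j\<in>UNIV - {i}. (\<theta> $ j) ^ m j))"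

lemma monom_at_has_derivative: "(monom_at m has_derivative dmonom m \<theta>) (at \<theta>)"
  unfolding monom_at_def[abs_def] dmonom_def[abs_def]
  by (rule has_derivative_prod)
     (auto intro!: derivative_eq_intros bounded_linear.has_derivative[OF bounded_linear_vec_nth])

text \<open>Monomials are eigenfunctions of differentiation along the linear field given by
  \<open>lam\<close>. The eigenvalue is the factor of the coefficient at \<open>m\<close> in the
  homological equation.\<close>

lemma dmonom_diag:
  "dmonom m \<theta> (diag_matrix lam *v \<theta>) = (\<Sum>i\<in>UNIV. real (m i) * lam i) * monom_at m \<theta>"
proof -
  have "(diag_matrix lam *v \<theta>) $ i = lam i * \<theta> $ i" for i
    by (simp add: diag_matrix_def matrix_vector_mult_def if_distrib[of "\<lambda>x. x * _"] cong: if_cong)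
  moreover have "lam i * \<theta> $ i * (real (m i) * (\<theta> $ i) ^ (m i - 1)) * (\<Prod>j\<in>UNIV - {i}. (\<theta> $ j) ^ m j)
      = real (m i) * lam i * monom_at m \<theta>" for i
  proof (cases "m i")
    case (Suc k)
    have "monom_at m \<theta> = \<theta> $ i ^ m i * (\<Prod>j\<in>UNIV - {i}. (\<theta> $ j) ^ m j)"
      unfolding monom_at_def by (rule prod.remove) auto
    then show ?thesis by (simp add: Suc)
  qed simp
  ultimately show ?thesis unfolding dmonom_def sum_distrib_right by (intro sum.cong) simp_all
qed

lemma abs_dmonom_le:
  assumes \<theta>: "\<And>j. \<bar>\<theta> $ j\<bar> \<le> r"
  shows "\<bar>dmonom m \<theta> v\<bar> \<le> real (mdeg m) * r ^ (mdeg m - 1) * norm v"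
proof -
  have r: "0 \<le> r" using \<theta> abs_ge_zero order_trans by blast
  have *: "\<bar>v $ i * (real (m i) * (\<theta> $ i) ^ (m i - 1)) * (\<Prod>j\<in>UNIV - {i}. (\<theta> $ j) ^ m j)\<bar>
      \<le> real (m i) * (r ^ (mdeg m - 1) * norm v)" for i
  proof (cases "m i")
    case (Suc k)
    have "\<bar>\<Prod>j\<in>UNIV - {i}. (\<theta> $ j) ^ m j\<bar> \<le> (\<Prod>j\<in>UNIV - {i}. r ^ m j)"
      unfolding abs_prod using \<theta> by (intro prod_mono) (auto simp: power_abs intro: power_mono)
    also have "\<dots> = r ^ (\<Sum>j\<in>UNIV - {i}. m j)" by (simp add: power_sum)
    finally have 1: "\<bar>\<Prod>j\<in>UNIV - {i}. (\<theta> $ j) ^ m j\<bar> \<le> r ^ (\<Sum>j\<in>UNIV - {i}. m j)" .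
    have 2: "mdeg m - 1 = k + (\<Sum>j\<in>UNIV - {i}. m j)"
      unfolding mdeg_def by (subst sum.remove[of UNIV i]) (simp_all add: Suc)
    have "\<bar>v $ i * (real (m i) * (\<theta> $ i) ^ (m i - 1)) * (\<Prod>j\<in>UNIV - {i}. (\<theta> $ j) ^ m j)\<bar>
       = (\<bar>v $ i\<bar> * (real (m i) * \<bar>\<theta> $ i\<bar> ^ k)) * \<bar>\<Prod>j\<in>UNIV - {i}. (\<theta> $ j) ^ m j\<bar>"
      by (simp add: abs_mult power_abs Suc)
    also have "\<dots> \<le> (norm v * (real (m i) * r ^ k)) * r ^ (\<Sum>j\<in>UNIV - {i}. m j)"
      using r \<theta> 1 component_le_norm_cart[of v i]
      by (intro mult_mono power_mono mult_nonneg_nonneg) auto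
    also have "\<dots> = real (m i) * (r ^ (mdeg m - 1) * norm v)"
      unfolding 2 power_add by simp
    finally show ?thesis .
  qed simp
  have "\<bar>dmonom m \<theta> v\<bar> \<le> (\<Sum>i\<in>UNIV. real (m i) * (r ^ (mdeg m - 1) * norm v))"
    unfolding dmonom_def by (intro order_trans[OF sum_abs] sum_mono *)
  then show ?thesis by (simp add: mdeg_def sum_distrib_right[symmetric])
qed

lemma open_box_set: "open {\<theta> :: real ^ 'd::finite. \<forall>j. \<bar>\<theta> $ j\<bar> < r}"
proof -
  have "{\<theta> :: real ^ 'd. \<forall>j. \<bar>\<theta> $ j\<bar> < r} = (\<Inter>j. {\<theta>. \<bar>\<theta> $ j\<bar> < r})" by auto
  moreover have "open (\<Inter>j\<in>UNIV. {\<theta> :: real ^ 'd. \<bar>\<theta> $ j\<bar> < r})"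
    by (intro open_INT ballI open_Collect_less continuous_intros) auto
  ultimately show ?thesis by simp
qed

lemma convex_box_set: "convex {\<theta> :: real ^ 'd::finite. \<forall>j. \<bar>\<theta> $ j\<bar> < r}"
proof -
  have "{\<theta> :: real ^ 'd. \<forall>j. \<bar>\<theta> $ j\<bar> < r} = (\<Inter>j. (\<lambda>\<theta>. \<theta> $ j) -` {-r<..<r})" by (auto simp: abs_less_iff minus_less_iff)
  moreover have "convex (\<Inter>j. (\<lambda>\<theta> :: real ^ 'd. \<theta> $ j) -` {-r<..<r})"
    by (intro convex_INT convex_linear_vimage bounded_linear.linear[OF bounded_linear_vec_nth]) auto
  ultimately show ?thesis by simp
qed

lemma convex_closed_box: "convex {\<theta> :: real ^ 'd::finite. \<forall>j. \<bar>\<theta> $ j\<bar> \<le> r}"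
proof -
  have "{\<theta> :: real ^ 'd. \<forall>j. \<bar>\<theta> $ j\<bar> \<le> r} = (\<Inter>j. (\<lambda>\<theta>. \<theta> $ j) -` {-r..r})" by (auto simp: abs_le_iff minus_le_iff)
  moreover have "convex (\<Inter>j. (\<lambda>\<theta> :: real ^ 'd. \<theta> $ j) -` {-r..r})"
    by (intro convex_INT convex_linear_vimage bounded_linear.linear[OF bounded_linear_vec_nth]) auto
  ultimately show ?thesis by simp
qed

lemma monom_at_lipschitz:
  assumes "\<And>j. \<bar>x $ j\<bar> \<le> t" "\<And>j. \<bar>y $ j\<bar> \<le> t"
  shows "\<bar>monom_at m x - monom_at m y\<bar> \<le> real (mdeg m) * t ^ (mdeg m - 1) * norm (x - y)"
proof -
  have "norm (monom_at m x - monom_at m y) \<le> (real (mdeg m) * t ^ (mdeg m - 1)) * norm (x - y)"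
  proof (rule differentiable_bound[OF convex_closed_box[of t]])
    show "(monom_at m has_derivative dmonom m z) (at z within {\<theta>. \<forall>j. \<bar>\<theta> $ j\<bar> \<le> t})" for z
      by (rule has_derivative_at_withinI[OF monom_at_has_derivative])
    show "onorm (dmonom m z) \<le> real (mdeg m) * t ^ (mdeg m - 1)" if "z \<in> {\<theta>. \<forall>j. \<bar>\<theta> $ j\<bar> \<le> t}" for z
      using abs_dmonom_le[of z t m] that by (intro onorm_le) auto
  qed (use assms in auto)
  then show ?thesis by simp
qed

text \<open>Shrinking the radius absorbs the factor \<open>k\<close> produced by
  differentiation.\<close>

lemma mult_power_le_const:
  fixes r r' :: real
  assumes "0 < r'" "r' < r"
  obtains C where "C > 0" "\<And>k. real k * r' ^ (k - 1) \<le> C * r ^ k"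
proof -
  have "(\<lambda>k. real k * (r' / r) ^ k) \<longlonglongrightarrow> 0"
    using assms by (intro powser_times_n_limit_0) auto
  then have "Bseq (\<lambda>k. real k * (r' / r) ^ k)"
    by (intro convergent_imp_Bseq convergentI)
  then obtain C0 where C0: "C0 > 0" "\<And>k. norm (real k * (r' / r) ^ k) \<le> C0"
    by (auto simp: Bseq_def)
  have "real k * r' ^ (k - 1) \<le> C0 / r' * r ^ k" for k
  proof (cases k)
    case (Suc l)
    have "real k * (r' / r) ^ k \<le> C0" using C0(2)[of k] by simp
    then show ?thesis using assms Suc by (simp add: field_simps)
  qed (use assms C0 in simp)
  with C0 assms show thesis by (intro that[of "C0 / r'"]) auto
qed

lemma pser_has_derivative:
  fixes f :: "('d::finite \<Rightarrow> nat) \<Rightarrow> 'a::banach"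
  assumes f: "majorized f r K" and \<theta>: "\<And>j. \<bar>\<theta> $ j\<bar> < r"
  shows "(pser f has_derivative (\<lambda>v. \<Sum>\<^sub>\<infinity>m. dmonom m \<theta> v *\<^sub>R f m)) (at \<theta>)"
    and "(\<lambda>m. dmonom m \<theta> v *\<^sub>R f m) summable_on UNIV"
proof -
  \<comment> \<open>\<open>a\<close> is the largest absolute coordinate of \<open>\<theta>\<close>.
    A radius strictly between \<open>a\<close> and \<open>r\<close> leaves an open box around
    \<open>\<theta>\<close> and a margin for the derivative bounds.\<close>
  define a where "a = Max (range (\<lambda>j. \<bar>\<theta> $ j\<bar>))"
  have a: "\<bar>\<theta> $ j\<bar> \<le> a" for j unfolding a_def by (intro Max_ge) auto
  have "a \<in> range (\<lambda>j. \<bar>\<theta> $ j\<bar>)" unfolding a_def by (intro Max_in) auto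
  then have ar: "a < r" "0 \<le> a" using \<theta> by auto
  obtain r' where r': "a < r'" "r' < r" using ar dense by blast
  with ar have r0: "0 < r'" by simp
  obtain C where C: "C > 0" "\<And>k. real k * r' ^ (k - 1) \<le> C * r ^ k"
    using mult_power_le_const[OF r0 r'(2)] by blast
  let ?S = "{\<theta> :: real ^ 'd. \<forall>j. \<bar>\<theta> $ j\<bar> < r'}"
  have xS: "\<theta> \<in> ?S" using a r' by (auto intro: le_less_trans)
  define b where "b m = C * (norm (f m) * r ^ mdeg m)" for m
  have b: "b summable_on UNIV" "\<And>m. 0 \<le> b m"
    unfolding b_def using C(1) r' r0 by (auto intro!: summable_on_cmult_right majorized_summable[OF f])
  have bd: "norm (dmonom m y v *\<^sub>R f m) \<le> b m * norm v" if "y \<in> ?S" for m y v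
  proof -
    have "norm (dmonom m y v *\<^sub>R f m) \<le> (real (mdeg m) * r' ^ (mdeg m - 1) * norm v) * norm (f m)"
      using abs_dmonom_le[of y r' m v] that by (simp add: mult_right_mono less_imp_le)
    also have "\<dots> \<le> (C * r ^ mdeg m * norm v) * norm (f m)"
      using C(2)[of "mdeg m"] by (intro mult_right_mono) auto
    finally show ?thesis by (simp add: b_def mult_ac)
  qed
  show "(pser f has_derivative (\<lambda>v. \<Sum>\<^sub>\<infinity>m. dmonom m \<theta> v *\<^sub>R f m)) (at \<theta>)"
    unfolding pser_def[abs_def]
  proof (rule has_derivative_infsum[OF open_box_set convex_box_set xS _ bd b])
    show "((\<lambda>y. monom_at m y *\<^sub>R f m) has_derivative (\<lambda>v. dmonom m y v *\<^sub>R f m)) (at y)" for m y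
      by (rule has_derivative_scaleR_left[OF monom_at_has_derivative])
    show "(\<lambda>m. monom_at m y *\<^sub>R f m) summable_on UNIV" if "y \<in> ?S" for y
      using that r' by (intro has_sum_imp_summable[OF pser_has_sum[OF f]]) (auto intro: less_imp_le less_trans)
  qed
  show "(\<lambda>m. dmonom m \<theta> v *\<^sub>R f m) summable_on UNIV"
    by (rule abs_summable_summable,
        rule Infinite_Sum.abs_summable_on_comparison_test'[OF summable_on_cmult_left[OF b(1)] bd[OF xS]])
qed

text \<open>\<open>Q\<close> is only required to agree with the series near \<open>\<theta>\<close>,
  because an arbitrary solution is represented by its series on \<open>B1\<close> alone.\<close>

lemma pser_derivative_diag:
  fixes f :: "('d::finite \<Rightarrow> nat) \<Rightarrow> 'a::banach"
  assumes f: "majorized f r K" and \<theta>: "\<And>j. \<bar>\<theta> $ j\<bar> < r"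
    and Q: "(Q has_derivative Q') (at \<theta>)" and U: "open U" "\<theta> \<in> U" "\<And>x. x \<in> U \<Longrightarrow> Q x = pser f x"
  shows "((\<lambda>m. monom_at m \<theta> *\<^sub>R ((\<Sum>i\<in>UNIV. real (m i) * lam i) *\<^sub>R f m)) has_sum Q' (diag_matrix lam *v \<theta>)) UNIV"
proof -
  have "(pser f has_derivative Q') (at \<theta>)"
    using has_derivative_transform_within_open[OF Q U] .
  then have "Q' = (\<lambda>v. \<Sum>\<^sub>\<infinity>m. dmonom m \<theta> v *\<^sub>R f m)"
    using pser_has_derivative(1)[OF f \<theta>] has_derivative_unique by blast
  then show ?thesis
    using has_sum_infsum[OF pser_has_derivative(2)[OF f \<theta>, of "diag_matrix lam *v \<theta>"]]
    by (simp add: dmonom_diag mult.commute)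
qed

text \<open>Without terms of degree 0 and 1 the Lipschitz constant on the box of size
  \<open>t\<close> is of order \<open>t\<close>. As for \<open>N\<close>, halving the radius turns
  the factor \<open>k + 2\<close> from the derivative into a geometric one.\<close>

lemma pser_remainder_lipschitz:
  fixes f :: "('d::finite \<Rightarrow> nat) \<Rightarrow> 'a::banach"
  assumes f: "majorized f r K" and r: "0 < r" and f0: "\<And>m. mdeg m \<le> 1 \<Longrightarrow> f m = 0"
    and t: "t \<le> r / 2" and x: "\<And>j. \<bar>x $ j\<bar> \<le> t" and y: "\<And>j. \<bar>y $ j\<bar> \<le> t"
  shows "norm (pser f x - pser f y) \<le> 2 * K / r\<^sup>2 * t * norm (x - y)"
proof -
  have t0: "0 \<le> t" using x abs_ge_zero order_trans by blast
  have xr: "\<bar>x $ j\<bar> \<le> r" and yr: "\<bar>y $ j\<bar> \<le> r" for j using x[of j] y[of j] t r by auto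
  define c where "c = 2 * t / r\<^sup>2 * norm (x - y)"
  have c0: "0 \<le> c" unfolding c_def using t0 r by auto
  have "norm (monom_at m x *\<^sub>R f m - monom_at m y *\<^sub>R f m) \<le> norm (f m) * r ^ mdeg m * c" for m
  proof (cases "mdeg m \<le> 1")
    case False
    then obtain k where k: "mdeg m = k + 2" by (metis add.commute le_Suc_ex not_less_eq_eq numeral_2_eq_2 One_nat_def)
    have "real (k + 2) \<le> 2 * 2 ^ k" by (induction k) auto
    then have "real (k + 2) * (t ^ k * t) \<le> (2 * 2 ^ k) * ((r / 2) ^ k * t)"
      using t0 t by (intro mult_mono power_mono mult_right_mono) auto
    also have "\<dots> = r ^ mdeg m * (2 * t / r\<^sup>2)"
      using r by (simp add: k power_add power_divide power2_eq_square)
    finally have "real (mdeg m) * t ^ (mdeg m - 1) \<le> r ^ mdeg m * (2 * t / r\<^sup>2)"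
      by (simp add: k mult.commute)
    then have "real (mdeg m) * t ^ (mdeg m - 1) * norm (x - y) \<le> r ^ mdeg m * (2 * t / r\<^sup>2) * norm (x - y)"
      by (rule mult_right_mono) simp
    then have "\<bar>monom_at m x - monom_at m y\<bar> \<le> r ^ mdeg m * c"
      using monom_at_lipschitz[OF x y, of m] by (simp add: c_def mult.assoc)
    then have "\<bar>monom_at m x - monom_at m y\<bar> * norm (f m) \<le> r ^ mdeg m * c * norm (f m)"
      by (rule mult_right_mono) simp
    then show ?thesis by (simp add: scaleR_left_diff_distrib[symmetric] mult_ac)
  qed (simp add: f0)
  moreover have "((\<lambda>m. monom_at m x *\<^sub>R f m - monom_at m y *\<^sub>R f m) has_sum (pser f x - pser f y)) UNIV"
    by (intro has_sum_diff pser_has_sum[OF f] xr yr)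
  ultimately have "norm (pser f x - pser f y) \<le> (\<Sum>\<^sub>\<infinity>m. norm (f m) * r ^ mdeg m) * c"
    by (intro norm_infsum_le[OF _ has_sum_cmult_left[OF has_sum_infsum[OF majorized_summable[OF f]]]]) (use r in auto)
  also have "\<dots> \<le> K * c"
    using majorizedD[OF f] r
    by (intro mult_right_mono c0 infsum_le_finite_sums majorized_summable[OF f]) auto
  finally show ?thesis by (simp add: c_def mult_ac)
qed

section \<open>Uniqueness of the coefficients\<close>

lemma base_expansion_inj:
  fixes f g :: "nat \<Rightarrow> nat"
  assumes "\<And>i. f i < b" "\<And>i. g i < b" "(\<Sum>i<k. f i * b ^ i) = (\<Sum>i<k. g i * b ^ i)" "i < k"
  shows "f i = g i"
  using assms
proof (induction k arbitrary: f g i)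
  case (Suc k)
  have b: "b > 0" using Suc.prems(1)[of 0] by simp
  have s: "(\<Sum>i<Suc k. h i * b ^ i) = h 0 + b * (\<Sum>i<k. h (Suc i) * b ^ i)" for h :: "nat \<Rightarrow> nat"
    by (simp only: sum.lessThan_Suc_shift) (simp add: sum_distrib_left mult_ac)
  have e: "f 0 + b * (\<Sum>i<k. f (Suc i) * b ^ i) = g 0 + b * (\<Sum>i<k. g (Suc i) * b ^ i)"
    using Suc.prems(3) unfolding s .
  then have "(f 0 + b * (\<Sum>i<k. f (Suc i) * b ^ i)) mod b = (g 0 + b * (\<Sum>i<k. g (Suc i) * b ^ i)) mod b"
    by simp
  then have f0: "f 0 = g 0" using Suc.prems(1)[of 0] Suc.prems(2)[of 0] by simp
  then have "(\<Sum>i<k. f (Suc i) * b ^ i) = (\<Sum>i<k. g (Suc i) * b ^ i)" using e b by simp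
  then have "f (Suc i) = g (Suc i)" if "i < k" for i
    using Suc.IH[of "\<lambda>i. f (Suc i)" "\<lambda>i. g (Suc i)" i] Suc.prems(1,2) that by simp
  with f0 Suc.prems(4) show ?case by (cases i) auto
qed simp

text \<open>The weights are distinct powers of \<open>N + 1\<close>. A multi-index of degree at most
  \<open>N\<close> has entries below this base, so they are the digits of its weighted sum and can
  be read off from it.\<close>

lemma separating_weight:
  obtains w :: "'d::finite \<Rightarrow> nat" where
    "inj_on (\<lambda>m. \<Sum>j\<in>UNIV. m j * w j) {m. mdeg m \<le> N}"
proof -
  obtain e :: "nat \<Rightarrow> 'd" where e: "bij_betw e {..<CARD('d)} UNIV"
    using ex_bij_betw_nat_finite[of "UNIV :: 'd set"] by (auto simp: atLeast0LessThan)
  define w where "w j = Suc N ^ inv_into {..<CARD('d)} e j" for j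
  have eq: "(\<Sum>j\<in>UNIV. m j * w j) = (\<Sum>i<CARD('d). m (e i) * Suc N ^ i)" for m
  proof -
    have "(\<Sum>j\<in>UNIV. m j * w j) = (\<Sum>i<CARD('d). m (e i) * w (e i))"
      by (rule sum.reindex_bij_betw[OF e, symmetric])
    also have "\<dots> = (\<Sum>i<CARD('d). m (e i) * Suc N ^ i)"
      unfolding w_def using bij_betw_inv_into_left[OF e] by (intro sum.cong) auto
    finally show ?thesis .
  qed
  have "inj_on (\<lambda>m. \<Sum>j\<in>UNIV. m j * w j) {m. mdeg m \<le> N}"
  proof (rule inj_onI)
    fix m m' assume m: "m \<in> {m. mdeg m \<le> N}" "m' \<in> {m. mdeg m \<le> N}"
      and W: "(\<Sum>j\<in>UNIV. m j * w j) = (\<Sum>j\<in>UNIV. m' j * w j)"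
    have s: "(\<Sum>i<CARD('d). m (e i) * Suc N ^ i) = (\<Sum>i<CARD('d). m' (e i) * Suc N ^ i)"
      using W unfolding eq .
    have lt: "m i < Suc N" "m' i < Suc N" for i
      using m le_mdeg[of m i] le_mdeg[of m' i] by auto
    have "m (e i) = m' (e i)" if "i < CARD('d)" for i
      using base_expansion_inj[of "\<lambda>i. m (e i)" "Suc N" "\<lambda>i. m' (e i)", OF lt s that] .
    moreover have "\<exists>i<CARD('d). e i = j" for j
      using e by (auto simp: bij_betw_def image_iff set_eq_iff) (metis lessThan_iff)
    ultimately show "m = m'" by (metis ext)
  qed
  then show thesis by (rule that)
qed

text \<open>Substituting \<open>\<theta>\<^sub>j = r t ^ w\<^sub>j\<close> with weights \<open>w\<close> that single out one multi-index of minimal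
  weight in the support isolates its coefficient as \<open>t \<longlonglongrightarrow> 0\<close>.\<close>

lemma pser_zero_coeff:
  fixes c :: "('d::finite \<Rightarrow> nat) \<Rightarrow> 'a::banach"
  assumes c: "majorized c r K" and r: "0 < r"
    and z: "\<And>\<theta>. (\<And>j. \<bar>\<theta> $ j\<bar> \<le> r) \<Longrightarrow> pser c \<theta> = 0"
  shows "c m = 0"
proof (rule ccontr)
  assume "c m \<noteq> 0"
  define N where "N = (LEAST k. \<exists>m. c m \<noteq> 0 \<and> mdeg m = k)"
  have N: "\<exists>m. c m \<noteq> 0 \<and> mdeg m = N"
    unfolding N_def by (rule LeastI_ex) (use \<open>c m \<noteq> 0\<close> in blast)
  have Nmin: "N \<le> mdeg a" if "c a \<noteq> 0" for a
    unfolding N_def by (rule Least_le) (use that in blast)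
  obtain w :: "'d \<Rightarrow> nat" where w: "inj_on (\<lambda>m. \<Sum>j\<in>UNIV. m j * w j) {m. mdeg m \<le> N}"
    using separating_weight by blast
  define W where "W m = (\<Sum>j\<in>UNIV. m j * w j)" for m :: "'d \<Rightarrow> nat"
  define m0 where "m0 = arg_min_on W {m. c m \<noteq> 0 \<and> mdeg m = N}"
  have fin: "finite {m. c m \<noteq> 0 \<and> mdeg m = N}"
    by (rule finite_subset[OF _ finite_mdeg_le[of N]]) auto
  have m0: "c m0 \<noteq> 0" "mdeg m0 = N"
    using arg_min_if_finite(1)[OF fin, of W] N by (auto simp: m0_def)
  have m0min: "W m0 \<le> W a" if "c a \<noteq> 0" "mdeg a = N" for a
    unfolding m0_def by (rule arg_min_least[OF fin]) (use that in auto)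
  \<comment> \<open>One extra degree adds \<open>V\<close>, which exceeds \<open>W m0\<close>. Hence
    every multi-index of higher degree also has larger total weight than \<open>m0\<close>, although
    its \<open>W\<close> may be small.\<close>
  define V where "V = Suc (W m0)"
  define v where "v j = V + w j" for j
  have Wv: "(\<Sum>j\<in>UNIV. a j * v j) = V * mdeg a + W a" for a
    by (simp add: v_def W_def mdeg_def sum.distrib sum_distrib_left distrib_left mult.commute)
  define e where "e = V * N + W m0"
  have gap: "Suc e \<le> V * mdeg a + W a" if a: "c a \<noteq> 0" "a \<noteq> m0" for a
  proof (cases "mdeg a = N")
    case True
    have "W a \<noteq> W m0" using inj_onD[OF w, of a m0] True m0(2) a(2) by (auto simp: W_def)
    then show ?thesis using m0min[OF a(1) True] True by (simp add: e_def)
  next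
    case False
    then have "Suc N \<le> mdeg a" using Nmin[OF a(1)] by simp
    then have "V * Suc N \<le> V * mdeg a" by (rule mult_le_mono2)
    then show ?thesis by (simp add: e_def V_def)
  qed
  have bound: "norm (c m0) * r ^ N \<le> t * K" if t: "0 < t" "t \<le> 1" for t
  proof -
    define \<theta> :: "real ^ 'd" where "\<theta> = (\<chi> j. r * t ^ v j)"
    have "t ^ v j \<le> 1" for j using t by (intro power_le_one) auto
    then have \<theta>: "\<bar>\<theta> $ j\<bar> \<le> r" for j
      using r t by (simp add: \<theta>_def abs_mult mult_left_le)
    have mon: "monom_at a \<theta> = r ^ mdeg a * t ^ (V * mdeg a + W a)" for a
    proof -
      have "monom_at a \<theta> = r ^ mdeg a * (\<Prod>j\<in>UNIV. (t ^ v j) ^ a j)"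
        by (simp add: monom_at_def \<theta>_def power_mult_distrib prod.distrib mdeg_def power_sum)
      also have "(\<Prod>j\<in>UNIV. (t ^ v j) ^ a j) = t ^ (\<Sum>j\<in>UNIV. a j * v j)"
        by (simp add: power_sum power_mult[symmetric] mult.commute)
      finally show ?thesis unfolding Wv .
    qed
    have "((\<lambda>a. monom_at a \<theta> *\<^sub>R c a) has_sum 0) UNIV"
      using pser_has_sum[OF c \<theta>] z[OF \<theta>] by simp
    moreover have "((\<lambda>a. if a = m0 then monom_at m0 \<theta> *\<^sub>R c m0 else 0) has_sum monom_at m0 \<theta> *\<^sub>R c m0) UNIV"
      by (rule has_sum_finite_neutralI[of "{m0}"]) auto
    ultimately have "((\<lambda>a. monom_at a \<theta> *\<^sub>R c a - (if a = m0 then monom_at m0 \<theta> *\<^sub>R c m0 else 0))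
        has_sum (0 - monom_at m0 \<theta> *\<^sub>R c m0)) UNIV"
      by (rule has_sum_diff)
    moreover have "(\<lambda>a. monom_at a \<theta> *\<^sub>R c a - (if a = m0 then monom_at m0 \<theta> *\<^sub>R c m0 else 0))
        = (\<lambda>a. if a = m0 then 0 else monom_at a \<theta> *\<^sub>R c a)" by auto
    ultimately have hs: "((\<lambda>a. if a = m0 then 0 else monom_at a \<theta> *\<^sub>R c a) has_sum - (monom_at m0 \<theta> *\<^sub>R c m0)) UNIV"
      by simp
    have "norm (- (monom_at m0 \<theta> *\<^sub>R c m0)) \<le> t ^ Suc e * (\<Sum>\<^sub>\<infinity>a. norm (c a) * r ^ mdeg a)"
    proof (rule norm_infsum_le[OF hs has_sum_cmult_right[OF has_sum_infsum[OF majorized_summable[OF c]]]])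
      fix a
      show "norm (if a = m0 then 0 else monom_at a \<theta> *\<^sub>R c a) \<le> t ^ Suc e * (norm (c a) * r ^ mdeg a)"
      proof (cases "a = m0 \<or> c a = 0")
        case False
        then have "t ^ (V * mdeg a + W a) \<le> t ^ Suc e"
          using t gap[of a] by (intro power_decreasing) auto
        then have "t ^ (V * mdeg a + W a) * (norm (c a) * r ^ mdeg a) \<le> t ^ Suc e * (norm (c a) * r ^ mdeg a)"
          using r by (intro mult_right_mono) auto
        then show ?thesis using False r t by (simp add: mon abs_mult mult_ac)
      qed (use r t in auto)
    qed (use r in simp)
    also have "\<dots> \<le> t ^ Suc e * K"
      using t r majorizedD[OF c]
      by (intro mult_left_mono infsum_le_finite_sums majorized_summable[OF c]) auto
    finally have "t ^ e * (norm (c m0) * r ^ N) \<le> t ^ e * (t * K)"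
      using r t by (simp add: mon m0 e_def abs_mult mult_ac)
    then show ?thesis using t by simp
  qed
  have "norm (c m0) * r ^ N \<le> 0"
  proof (rule ccontr)
    assume "\<not> norm (c m0) * r ^ N \<le> 0"
    then have p: "0 < norm (c m0) * r ^ N" by simp
    \<comment> \<open>Small enough that the bound \<open>t * K\<close> is at most half of the
      quantity it is supposed to dominate; \<open>K + 1\<close> avoids a zero denominator.\<close>
    define t where "t = min 1 (norm (c m0) * r ^ N / (2 * (K + 1)))"
    have K: "0 \<le> K" by (rule majorized_nonneg[OF c])
    have t: "0 < t" "t \<le> 1" using p K by (auto simp: t_def)
    have "t * K \<le> (norm (c m0) * r ^ N / (2 * (K + 1))) * (K + 1)"
      using t K by (intro mult_mono) (auto simp: t_def)
    also have "\<dots> = norm (c m0) * r ^ N / 2" using K by (simp add: divide_simps)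
    also have "\<dots> < norm (c m0) * r ^ N" using p by linarith
    finally show False using bound[OF t] by simp
  qed
  then show False using m0 zero_less_power[OF r, of N] by (simp add: mult_le_0_iff)
qed

lemma majorized_diff:
  assumes f: "majorized f r K" and g: "majorized g r L" and r: "0 \<le> r"
  shows "majorized (\<lambda>m. f m - g m) r (K + L)"
  unfolding majorized_def
proof (intro allI impI)
  fix F :: "('a \<Rightarrow> nat) set" assume F: "finite F"
  have "(\<Sum>m\<in>F. norm (f m - g m) * r ^ mdeg m) \<le> (\<Sum>m\<in>F. norm (f m) * r ^ mdeg m + norm (g m) * r ^ mdeg m)"
    using r by (intro sum_mono) (simp add: distrib_right[symmetric] mult_right_mono norm_triangle_ineq4)
  then show "(\<Sum>m\<in>F. norm (f m - g m) * r ^ mdeg m) \<le> K + L"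
    using majorizedD[OF f F] majorizedD[OF g F] by (simp add: sum.distrib)
qed

lemma pser_coeff_unique:
  fixes f g :: "('d::finite \<Rightarrow> nat) \<Rightarrow> 'a::banach"
  assumes f: "majorized f r K" and g: "majorized g r L" and r: "0 < r"
    and eq: "\<And>\<theta>. (\<And>j. \<bar>\<theta> $ j\<bar> \<le> r) \<Longrightarrow> pser f \<theta> = pser g \<theta>"
  shows "f m = g m"
proof -
  have "f m - g m = 0"
  proof (rule pser_zero_coeff[OF majorized_diff[OF f g less_imp_le[OF r]] r])
    fix \<theta> :: "real ^ 'd" assume \<theta>: "\<And>j. \<bar>\<theta> $ j\<bar> \<le> r"
    show "pser (\<lambda>m. f m - g m) \<theta> = 0"
      using has_sum_diff[OF pser_has_sum[OF f \<theta>] pser_has_sum[OF g \<theta>]] eq[OF \<theta>]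
      by (intro pser_eqI) (simp add: scaleR_right_diff_distrib)
  qed
  then show ?thesis by simp
qed

section \<open>From convergence on the unit box to absolute convergence at a smaller radius\<close>

lemma majorized_of_bounded:
  fixes c :: "('d::finite \<Rightarrow> nat) \<Rightarrow> 'a::real_normed_vector"
  assumes c: "\<And>m. norm (c m) * \<rho> ^ mdeg m \<le> C" and r: "0 \<le> r" "r < \<rho>"
  shows "\<exists>K. majorized c r K"
proof (intro exI)
  define q where "q = r / \<rho>"
  have q: "0 \<le> q" "q < 1" using r by (auto simp: q_def)
  have C: "0 \<le> C" using order_trans[OF _ c[of "\<lambda>_. 0"]] by simp
  show "majorized c r (C * (1 / (1 - q)) ^ CARD('d))"
    unfolding majorized_def
  proof (intro allI impI)
    fix F :: "('d \<Rightarrow> nat) set" assume F: "finite F"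
    define B where "B = Max (insert 0 (mdeg ` F))"
    have B: "m j \<le> B" if "m \<in> F" for m j
    proof -
      have "mdeg m \<le> B" unfolding B_def using F that by (intro Max_ge) auto
      then show ?thesis using le_mdeg[of m j] by simp
    qed
    have "(\<Sum>m\<in>F. norm (c m) * r ^ mdeg m) \<le> (\<Sum>m\<in>F. C * q ^ mdeg m)"
    proof (rule sum_mono)
      fix m
      have "norm (c m) * r ^ mdeg m = (norm (c m) * \<rho> ^ mdeg m) * q ^ mdeg m"
        using r by (simp add: q_def power_divide)
      also have "\<dots> \<le> C * q ^ mdeg m" using c q by (intro mult_right_mono) auto
      finally show "norm (c m) * r ^ mdeg m \<le> C * q ^ mdeg m" .
    qed
    also have "\<dots> = C * (\<Sum>m\<in>F. q ^ mdeg m)" by (simp add: sum_distrib_left)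
    \<comment> \<open>Enlarging \<open>F\<close> to a cube lets the sum factor into one geometric
      sum per coordinate.\<close>
    also have "(\<Sum>m\<in>F. q ^ mdeg m) \<le> (\<Sum>m\<in>Pi\<^sub>E UNIV (\<lambda>_ :: 'd. {..B}). q ^ mdeg m)"
      by (rule sum_mono2) (use B q in \<open>auto intro: finite_PiE\<close>)
    also have "\<dots> = (\<Sum>m\<in>Pi\<^sub>E UNIV (\<lambda>_ :: 'd. {..B}). \<Prod>j\<in>UNIV. q ^ m j)"
      by (simp add: mdeg_def power_sum)
    also have "\<dots> = (\<Prod>j\<in>(UNIV :: 'd set). \<Sum>k\<in>{..B}. q ^ k)"
      by (rule prod_sum_PiE[symmetric]) auto
    also have "\<dots> = (\<Sum>k\<le>B. q ^ k) ^ CARD('d)" by simp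
    also have "\<dots> \<le> (1 / (1 - q)) ^ CARD('d)"
    proof (intro power_mono)
      have "(\<Sum>k\<le>B. q ^ k) \<le> (\<Sum>k. q ^ k)"
        using q by (intro sum_le_suminf summable_geometric) auto
      then show "(\<Sum>k\<le>B. q ^ k) \<le> 1 / (1 - q)" using q by (simp add: suminf_geometric)
    qed (use q in \<open>auto intro: sum_nonneg\<close>)
    finally show "(\<Sum>m\<in>F. norm (c m) * r ^ mdeg m) \<le> C * (1 / (1 - q)) ^ CARD('d)"
      using C by (simp add: mult_left_mono)
  qed
qed

text \<open>A term outside a suitable finite set is the difference of two partial sums within
  distance 1 of the limit, so its norm is at most 2. The finitely many other terms are bounded
  trivially.\<close>

lemma has_sum_term_bounded:
  fixes f :: "'i \<Rightarrow> 'a::real_normed_vector"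
  assumes "(f has_sum S) UNIV"
  obtains C where "\<And>i. norm (f i) \<le> C"
proof -
  obtain F where F: "finite F" "\<And>G. finite G \<Longrightarrow> F \<subseteq> G \<Longrightarrow> dist (sum f G) S < 1"
    using assms tendstoD[of "sum f" S "finite_subsets_at_top UNIV" 1]
    by (auto simp: has_sum_def eventually_finite_subsets_at_top)
  have "norm (f i) \<le> (\<Sum>i\<in>F. norm (f i)) + 2" for i
  proof (cases "i \<in> F")
    case True
    then have "norm (f i) \<le> (\<Sum>i\<in>F. norm (f i))" using F by (intro member_le_sum) auto
    then show ?thesis by simp
  next
    case False
    then have "f i = (sum f (insert i F) - S) - (sum f F - S)" using F by simp
    also have "norm \<dots> \<le> norm (sum f (insert i F) - S) + norm (sum f F - S)" by (rule norm_triangle_ineq4)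
    also have "\<dots> \<le> 2"
      using F(2)[OF F(1) subset_refl] F(2)[OF finite.insertI[OF F(1)] subset_insertI, of i]
      unfolding dist_norm by linarith
    finally show ?thesis using sum_nonneg[of F "\<lambda>i. norm (f i)"] by simp
  qed
  then show thesis by (rule that)
qed

text \<open>Convergence at the one point with all coordinates equal to \<open>\<rho>\<close>,
  between \<open>r\<close> and 1, bounds the terms there; the smaller radius \<open>r\<close> then
  gives absolute convergence.\<close>

lemma analytic_on_B1_majorized:
  fixes Q :: "real ^ 'd::finite \<Rightarrow> 'a::banach"
  assumes q: "\<And>\<theta>. \<theta> \<in> B1 \<Longrightarrow> ((\<lambda>m. (\<Prod>j\<in>UNIV. (\<theta> $ j) ^ m j) *\<^sub>R q m) has_sum Q \<theta>) UNIV"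
    and r: "0 \<le> r" "r < 1"
  shows "\<exists>K. majorized q r K"
proof -
  obtain \<rho> where \<rho>: "r < \<rho>" "\<rho> < 1" using dense r by blast
  have "(\<chi> j. \<rho>) \<in> (B1 :: (real ^ 'd) set)" using r \<rho> by (simp add: B1_def)
  from q[OF this] obtain C where C: "\<And>m. norm ((\<Prod>j\<in>UNIV. ((\<chi> j. \<rho>) $ j) ^ m j) *\<^sub>R q m) \<le> C"
    using has_sum_term_bounded by blast
  have "norm (q m) * \<rho> ^ mdeg m \<le> C" for m
    using C[of m] monom_at_const[of m \<rho>] r \<rho> by (simp add: monom_at_def mult.commute)
  then show ?thesis using majorized_of_bounded r \<rho> by blast
qed

section \<open>The split operator and the stable semigroup\<close>

definition wdot :: "('d::finite \<Rightarrow> real) \<Rightarrow> ('d \<Rightarrow> nat) \<Rightarrow> real" where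
  "wdot lam m = (\<Sum>i\<in>UNIV. real (m i) * lam i)"

definition unit_index :: "'d \<Rightarrow> 'd \<Rightarrow> nat" where
  "unit_index j = (\<lambda>i. if i = j then 1 else 0)"

lemma mdeg_unit_index [simp]: "mdeg (unit_index j) = 1"
  by (simp add: mdeg_def unit_index_def)

lemma mdeg_eq_1D:
  assumes "mdeg m = 1"
  obtains j where "m = unit_index j"
proof -
  have "m \<noteq> (\<lambda>_. 0)" using assms by auto
  then obtain j where j: "m j \<noteq> 0" by (auto simp: fun_eq_iff)
  have "mdeg m = m j + (\<Sum>i\<in>UNIV - {j}. m i)" unfolding mdeg_def by (rule sum.remove) auto
  with assms j have mj: "m j = 1" and s: "(\<Sum>i\<in>UNIV - {j}. m i) = 0" by linarith+
  from s have "m i = 0" if "i \<noteq> j" for i using that by auto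
  with mj have "m i = unit_index j i" for i by (cases "i = j") (simp_all add: unit_index_def)
  then have "m = unit_index j" by blast
  then show thesis by (rule that)
qed

lemma wdot_unit_index [simp]: "wdot lam (unit_index j) = lam j"
proof -
  have "wdot lam (unit_index j) = (\<Sum>i\<in>UNIV. if i = j then lam i else 0)"
    unfolding wdot_def unit_index_def by (intro sum.cong) auto
  then show ?thesis by simp
qed

lemma monom_at_unit_index: "monom_at (unit_index j) \<theta> = \<theta> $ j"
proof -
  have "monom_at (unit_index j) \<theta> = (\<Prod>i\<in>UNIV. if i = j then \<theta> $ i else 1)"
    unfolding monom_at_def unit_index_def by (intro prod.cong) auto
  then show ?thesis by simp
qed

text \<open>The homological equations meet only the real positive points \<open>m . lam\<close>, so
  the spectral hypotheses are reduced to real resolvents at positive points off the eigenvalues. The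
  map \<open>cc\<close> is the spectral projection onto the unstable space written in the basis
  \<open>\<xi>\<close>, with kernel \<open>Xs\<close>.\<close>

locale split_operator =
  fixes D :: "'a::{banach,real_normed_algebra,comm_ring} set"
    and A :: "'a \<Rightarrow> 'a"
    and n :: "nat \<Rightarrow> 'a"
    and R M \<mu> :: real
    and lam :: "'d::finite \<Rightarrow> real"
    and \<xi> :: "'d \<Rightarrow> 'a"
    and Xs :: "'a set"
    and S :: "real \<Rightarrow> 'a \<Rightarrow> 'a"
    and cc :: "'a \<Rightarrow> real ^ 'd"
  assumes A_lin: "linear_on_dom D A"
    and lam_pos: "\<And>j. 0 < lam j"
    and xi_dom: "\<And>j. \<xi> j \<in> D" and xi_eig: "\<And>j. A (\<xi> j) = lam j *\<^sub>R \<xi> j"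
    and A_Xs: "\<And>v. v \<in> D \<Longrightarrow> v \<in> Xs \<Longrightarrow> A v \<in> Xs"
    and cc_bl: "bounded_linear cc" and cc_xi: "\<And>j. cc (\<xi> j) = axis j 1"
    and cc_Xs: "\<And>v. cc v = 0 \<longleftrightarrow> v \<in> Xs"
    and resolv: "\<And>z. 0 < z \<Longrightarrow> z \<notin> range lam \<Longrightarrow>
      \<exists>T. bounded_linear T \<and> (\<forall>y. T y \<in> D \<and> z *\<^sub>R T y - A (T y) = y) \<and> (\<forall>x\<in>D. T (z *\<^sub>R x - A x) = x)"
    and S_gen: "generates_on Xs (D \<inter> Xs) A S"
    and M_pos: "M > 0" and mu_pos: "\<mu> > 0"
    and S_decay: "\<And>t x. t \<ge> 0 \<Longrightarrow> x \<in> Xs \<Longrightarrow> norm (S t x) \<le> M * exp (- \<mu> * t) * norm x"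
    and R_pos: "R > 0" and N_sum: "summable (\<lambda>j. norm (n (j + 2)) * R ^ (j + 2))"
    and nonres: "nonresonant lam"
begin

lemma D_sub: "subspace D" and A_add: "\<And>x y. x \<in> D \<Longrightarrow> y \<in> D \<Longrightarrow> A (x + y) = A x + A y"
  and A_scale: "\<And>c x. x \<in> D \<Longrightarrow> A (c *\<^sub>R x) = c *\<^sub>R A x"
  using A_lin by (auto simp: linear_on_dom_def)

lemma A_diff: "x \<in> D \<Longrightarrow> y \<in> D \<Longrightarrow> A (x - y) = A x - A y"
  using A_add[of x "-1 *\<^sub>R y"] A_scale[of y "-1"] subspace_scale[OF D_sub, of y "-1"] by simp

lemma A_sum: "finite I \<Longrightarrow> (\<And>i. i \<in> I \<Longrightarrow> x i \<in> D) \<Longrightarrow> A (\<Sum>i\<in>I. x i) = (\<Sum>i\<in>I. A (x i))"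
proof (induction I rule: finite_induct)
  case empty
  then show ?case using A_scale[OF subspace_0[OF D_sub], of 0] by simp
next
  case (insert i I)
  then show ?case using A_add[of "x i" "\<Sum>i\<in>I. x i"] subspace_sum[OF D_sub, of I x] by simp
qed

lemma Xs_sub: "subspace Xs"
  unfolding subspace_def by (simp add: cc_Xs[symmetric] linear_0 linear_add linear_scale bounded_linear.linear[OF cc_bl] del: cc_Xs)

definition pu :: "'a \<Rightarrow> 'a" where "pu x = (\<Sum>j\<in>UNIV. cc x $ j *\<^sub>R \<xi> j)"

lemma pu_bl: "bounded_linear pu"
  unfolding pu_def[abs_def]
  by (intro bounded_linear_sum bounded_linear_scaleR_const bounded_linear_compose[OF bounded_linear_vec_nth cc_bl])

lemma pu_dom: "pu x \<in> D"
  unfolding pu_def by (intro subspace_sum[OF D_sub] subspace_scale[OF D_sub] xi_dom)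

lemma cc_sum_xi: "cc (\<Sum>j\<in>UNIV. c j *\<^sub>R \<xi> j) = (\<chi> j. c j)"
proof -
  have "cc (\<Sum>j\<in>UNIV. c j *\<^sub>R \<xi> j) = (\<Sum>j\<in>UNIV. c j *\<^sub>R axis j 1)"
    by (simp add: linear_sum[OF bounded_linear.linear[OF cc_bl]] linear_scale[OF bounded_linear.linear[OF cc_bl]] cc_xi)
  also have "\<dots> = (\<chi> j. c j)"
    by (simp add: vec_eq_iff axis_def if_distrib cong: if_cong)
  finally show ?thesis .
qed

lemma cc_diff: "cc (x - y) = cc x - cc y"
  by (rule linear_diff[OF bounded_linear.linear[OF cc_bl]])

lemma cc_scale: "cc (c *\<^sub>R x) = c *\<^sub>R cc x"
  by (rule linear_scale[OF bounded_linear.linear[OF cc_bl]])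

lemma cc_pu: "cc (pu x) = cc x"
  unfolding pu_def cc_sum_xi by (simp add: vec_eq_iff)

lemma ps_Xs: "x - pu x \<in> Xs"
  unfolding cc_Xs[symmetric] by (simp add: cc_diff cc_pu)

lemma A_pu: "A (pu x) = (\<Sum>j\<in>UNIV. (lam j * cc x $ j) *\<^sub>R \<xi> j)"
  unfolding pu_def by (subst A_sum) (simp_all add: subspace_scale[OF D_sub] xi_dom A_scale xi_eig mult.commute)

text \<open>The stable part of \<open>x\<close> is mapped into \<open>Xs\<close>, where
  \<open>cc\<close> vanishes, so in these coordinates only the diagonal action on the eigenvectors
  remains.\<close>

lemma cc_A:
  assumes "x \<in> D"
  shows "cc (A x) $ j = lam j * cc x $ j"
proof -
  have "x - pu x \<in> D" by (intro subspace_diff[OF D_sub] assms pu_dom)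
  then have "A (x - pu x) \<in> Xs" using A_Xs ps_Xs by blast
  then have "cc (A x - A (pu x)) = 0"
    using A_diff[OF assms pu_dom, of x] cc_Xs by simp
  then have "cc (A x) = cc (A (pu x))" by (simp add: cc_diff)
  then show ?thesis unfolding A_pu cc_sum_xi by simp
qed

section \<open>The stable semigroup, an adapted norm and the stable resolvent\<close>

lemma S_c0: "c0_semigroup_on Xs S"
  using S_gen unfolding generates_on_def by blast

lemma S_linear_maps: "t \<ge> 0 \<Longrightarrow> linear_on_dom Xs (S t) \<and> S t ` Xs \<subseteq> Xs"
  using S_c0 unfolding c0_semigroup_on_def by blast

lemma S_props:
  "t \<ge> 0 \<Longrightarrow> v \<in> Xs \<Longrightarrow> S t v \<in> Xs"
  "t \<ge> 0 \<Longrightarrow> v \<in> Xs \<Longrightarrow> w \<in> Xs \<Longrightarrow> S t (v + w) = S t v + S t w"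
  "t \<ge> 0 \<Longrightarrow> v \<in> Xs \<Longrightarrow> S t (c *\<^sub>R v) = c *\<^sub>R S t v"
  using S_linear_maps[of t] unfolding linear_on_dom_def by (blast, metis, metis)

lemma S_zero: "v \<in> Xs \<Longrightarrow> S 0 v = v"
  and S_semigroup: "s \<ge> 0 \<Longrightarrow> t \<ge> 0 \<Longrightarrow> v \<in> Xs \<Longrightarrow> S (s + t) v = S s (S t v)"
  using S_c0 unfolding c0_semigroup_on_def by (metis, metis)

lemma S_derivative: "v \<in> D \<Longrightarrow> v \<in> Xs \<Longrightarrow> ((\<lambda>h. (S h v - v) /\<^sub>R h) \<longlongrightarrow> A v) (at_right 0)"
  using S_gen unfolding generates_on_def by blast

text \<open>In the norm \<open>ns\<close>, equivalent to the original one on \<open>Xs\<close>, the decay estimate holds with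
  constant \<open>1\<close>, so that it can be differentiated at \<open>t = 0\<close>.\<close>

definition ns :: "'a \<Rightarrow> real" where "ns v = (SUP t\<in>{0..}. exp (\<mu> * t) * norm (S t v))"

lemma ns_term_le:
  assumes "v \<in> Xs" "t \<ge> 0"
  shows "exp (\<mu> * t) * norm (S t v) \<le> M * norm v"
proof -
  have "exp (\<mu> * t) * norm (S t v) \<le> exp (\<mu> * t) * (M * exp (- \<mu> * t) * norm v)"
    using S_decay[OF assms(2,1)] by (intro mult_left_mono) auto
  also have "\<dots> = M * norm v" by (simp add: exp_minus)
  finally show ?thesis .
qed

lemma ns_bdd: "v \<in> Xs \<Longrightarrow> bdd_above ((\<lambda>t. exp (\<mu> * t) * norm (S t v)) ` {0..})"
  using ns_term_le by (intro bdd_aboveI2[where M = "M * norm v"]) auto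

lemma ns_upper: "v \<in> Xs \<Longrightarrow> t \<ge> 0 \<Longrightarrow> exp (\<mu> * t) * norm (S t v) \<le> ns v"
  unfolding ns_def by (rule cSUP_upper[OF _ ns_bdd]) auto

lemma ns_least: "(\<And>t. t \<ge> 0 \<Longrightarrow> exp (\<mu> * t) * norm (S t v) \<le> c) \<Longrightarrow> ns v \<le> c"
  unfolding ns_def by (rule cSUP_least) auto

lemma norm_le_ns: "v \<in> Xs \<Longrightarrow> norm v \<le> ns v"
  using ns_upper[of v 0] S_zero by simp

lemma ns_le_norm: "v \<in> Xs \<Longrightarrow> ns v \<le> M * norm v"
  by (rule ns_least) (rule ns_term_le)

lemma ns_add_le:
  assumes "v \<in> Xs" "w \<in> Xs"
  shows "ns (v + w) \<le> ns v + ns w"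
proof (rule ns_least)
  fix t :: real assume t: "t \<ge> 0"
  have "exp (\<mu> * t) * norm (S t (v + w)) \<le> exp (\<mu> * t) * norm (S t v) + exp (\<mu> * t) * norm (S t w)"
    unfolding S_props(2)[OF t assms] distrib_left[symmetric]
    by (intro mult_left_mono norm_triangle_ineq) auto
  also have "\<dots> \<le> ns v + ns w" by (intro add_mono ns_upper assms t)
  finally show "exp (\<mu> * t) * norm (S t (v + w)) \<le> ns v + ns w" .
qed

lemma ns_scale_le:
  assumes "v \<in> Xs"
  shows "ns (c *\<^sub>R v) \<le> \<bar>c\<bar> * ns v"
proof (rule ns_least)
  fix t :: real assume t: "t \<ge> 0"
  show "exp (\<mu> * t) * norm (S t (c *\<^sub>R v)) \<le> \<bar>c\<bar> * ns v"
    using mult_left_mono[OF ns_upper[OF assms t], of "\<bar>c\<bar>"] S_props(3)[OF t assms, of c]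
    by (simp add: mult_ac)
qed

text \<open>By the semigroup law the supremum for \<open>S h v\<close> runs over the later times
  \<open>t + h\<close> only, and the weight supplies the factor
  \<open>exp (- \<mu> * h)\<close>.\<close>

lemma ns_S_le:
  assumes v: "v \<in> Xs" and h: "h \<ge> 0"
  shows "ns (S h v) \<le> exp (- \<mu> * h) * ns v"
proof (rule ns_least)
  fix t :: real assume t: "t \<ge> 0"
  have "exp (\<mu> * t) * norm (S t (S h v)) = exp (- \<mu> * h) * (exp (\<mu> * (t + h)) * norm (S (t + h) v))"
    using S_semigroup[OF t h v] by (simp add: exp_add[symmetric] mult.assoc[symmetric] distrib_left)
  also have "\<dots> \<le> exp (- \<mu> * h) * ns v"
    using t h by (intro mult_left_mono ns_upper v) auto
  finally show "exp (\<mu> * t) * norm (S t (S h v)) \<le> exp (- \<mu> * h) * ns v" .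
qed

text \<open>The rational factor makes the later limits and comparisons in \<open>h\<close>
  elementary algebra.\<close>

lemma ns_S_le': 
  assumes v: "v \<in> Xs" and h: "h \<ge> 0"
  shows "ns (S h v) \<le> ns v / (1 + \<mu> * h)"
proof -
  have "1 + \<mu> * h \<le> exp (\<mu> * h)" by (rule exp_ge_add_one_self)
  then have "exp (- \<mu> * h) \<le> 1 / (1 + \<mu> * h)"
    using mu_pos h by (simp add: exp_minus inverse_eq_divide frac_le add_pos_nonneg)
  then have "exp (- \<mu> * h) * ns v \<le> 1 / (1 + \<mu> * h) * ns v"
    using order_trans[OF norm_ge_zero norm_le_ns[OF v]] by (rule mult_right_mono)
  then show ?thesis using ns_S_le[OF v h] by simp
qed

text \<open>In the norm \<open>ns\<close> the semigroup contracts at rate \<open>\<mu>\<close>, so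
  \<open>A + \<mu>\<close> is dissipative on \<open>Xs\<close> and \<open>(\<mu> + z) * ns v\<close>
  is at most \<open>ns\<close> of the right-hand side. The inequality comes from one short step of
  the semigroup in the limit \<open>h \<rightarrow> 0\<close>; returning to the original norm costs
  the factor \<open>M\<close>.\<close>

lemma stable_resolvent_bound:
  assumes v: "v \<in> D" "v \<in> Xs" and z: "z > 0"
  shows "norm v \<le> M / \<mu> * norm (z *\<^sub>R v - A v)"
proof -
  define w where "w = z *\<^sub>R v - A v"
  have w: "w \<in> Xs" unfolding w_def by (intro subspace_diff[OF Xs_sub] subspace_scale[OF Xs_sub] v A_Xs)
  have nn: "0 \<le> ns x" if "x \<in> Xs" for x using norm_le_ns[OF that] norm_ge_zero order_trans by blast
  define q where "q h = (S h v - v) /\<^sub>R h - A v" for h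
  have lim: "((\<lambda>h. norm (q h)) \<longlongrightarrow> 0) (at_right 0)"
    unfolding q_def by (intro tendsto_norm_zero) (use S_derivative[OF v] in \<open>simp add: LIM_zero\<close>)
  have ineq: "(\<mu> / (1 + \<mu> * h) + z) * ns v \<le> ns w + M * norm (q h)" if h: "h > 0" for h
  proof -
    have Sh: "S h v \<in> Xs" using S_props(1) v h by simp
    have q: "q h \<in> Xs"
      unfolding q_def by (intro subspace_diff[OF Xs_sub] subspace_scale[OF Xs_sub] v A_Xs Sh)
    have hq: "h *\<^sub>R q h = S h v - v - h *\<^sub>R A v" using h by (simp add: q_def scaleR_right_diff_distrib)
    \<comment> \<open>\<open>X\<close> is \<open>v + h z v\<close> expressed through one semigroup
      step: \<open>S h v\<close> plus \<open>h\<close> times the right-hand side \<open>w\<close>,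
      up to the error \<open>q h\<close>, which tends to 0.\<close>
    define X where "X = S h v + h *\<^sub>R (w + (-1) *\<^sub>R q h)"
    have hz: "1 + h * z > 0" using h z by (simp add: add_pos_pos)
    have "(1 + h * z) *\<^sub>R v = X"
      by (simp add: X_def w_def scaleR_right_diff_distrib scaleR_left_distrib hq)
    moreover have "v = (1 / (1 + h * z)) *\<^sub>R ((1 + h * z) *\<^sub>R v)" using hz by simp
    ultimately have eq: "v = (1 / (1 + h * z)) *\<^sub>R X" by simp
    have X1: "w + (-1) *\<^sub>R q h \<in> Xs" by (intro subspace_add[OF Xs_sub] subspace_scale[OF Xs_sub] w q)
    have X2: "h *\<^sub>R (w + (-1) *\<^sub>R q h) \<in> Xs" by (intro subspace_scale[OF Xs_sub] X1)
    have X: "X \<in> Xs" unfolding X_def by (intro subspace_add[OF Xs_sub] Sh X2)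
    have "ns v \<le> \<bar>1 / (1 + h * z)\<bar> * ns X"
      by (subst eq) (rule ns_scale_le[OF X])
    then have "(1 + h * z) * ns v \<le> ns X"
      using hz by (simp add: field_simps)
    then have "(1 + h * z) * ns v \<le> ns (S h v + h *\<^sub>R (w + (-1) *\<^sub>R q h))"
      by (simp add: X_def)
    also have "\<dots> \<le> ns (S h v) + ns (h *\<^sub>R (w + (-1) *\<^sub>R q h))"
      by (rule ns_add_le[OF Sh X2])
    also have "\<dots> \<le> ns v / (1 + \<mu> * h) + h * (ns w + M * norm (q h))"
    proof (intro add_mono)
      show "ns (S h v) \<le> ns v / (1 + \<mu> * h)" using ns_S_le' v h by simp
      have "ns (h *\<^sub>R (w + (-1) *\<^sub>R q h)) \<le> h * ns (w + (-1) *\<^sub>R q h)"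
        using ns_scale_le[OF X1, of h] h by simp
      also have "\<dots> \<le> h * (ns w + ns ((-1) *\<^sub>R q h))"
        using h by (intro mult_left_mono ns_add_le w subspace_scale[OF Xs_sub] q) auto
      also have "\<dots> \<le> h * (ns w + M * norm (q h))"
        using h ns_scale_le[OF q, of "-1"] ns_le_norm[OF q] by (intro mult_left_mono add_left_mono) auto
      finally show "ns (h *\<^sub>R (w + (-1) *\<^sub>R q h)) \<le> h * (ns w + M * norm (q h))" .
    qed
    finally have "(1 + h * z) * ns v - ns v / (1 + \<mu> * h) \<le> h * (ns w + M * norm (q h))" by simp
    moreover have "(1 + h * z) * ns v - ns v / (1 + \<mu> * h) = h * ((\<mu> / (1 + \<mu> * h) + z) * ns v)"
    proof -
      have "1 + \<mu> * h \<noteq> 0" using mu_pos h by (metis add_pos_pos less_irrefl mult_pos_pos zero_less_one)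
      then show ?thesis by (simp add: field_simps)
    qed
    ultimately show ?thesis using h by simp
  qed
  have "(\<mu> / (1 + \<mu> * 0) + z) * ns v \<le> ns w + M * 0"
  proof (rule tendsto_le[of "at_right (0::real)"])
    show "((\<lambda>h. ns w + M * norm (q h)) \<longlongrightarrow> ns w + M * 0) (at_right 0)"
      by (intro tendsto_intros lim)
    show "((\<lambda>h. (\<mu> / (1 + \<mu> * h) + z) * ns v) \<longlongrightarrow> (\<mu> / (1 + \<mu> * 0) + z) * ns v) (at_right 0)"
      by (intro tendsto_intros) auto
    show "\<forall>\<^sub>F h in at_right 0. (\<mu> / (1 + \<mu> * h) + z) * ns v \<le> ns w + M * norm (q h)"
      using eventually_at_right_less[of "0::real"] by eventually_elim (rule ineq)
  qed simp
  then have "(\<mu> + z) * ns v \<le> ns w" by simp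
  moreover have "\<mu> * ns v \<le> (\<mu> + z) * ns v" using z nn[OF v(2)] by (intro mult_right_mono) auto
  ultimately have "\<mu> * ns v \<le> M * norm w" using ns_le_norm[OF w] by linarith
  moreover have "\<mu> * norm v \<le> \<mu> * ns v" using mu_pos norm_le_ns[OF v(2)] by simp
  ultimately have "\<mu> * norm v \<le> M * norm w" by (rule order_trans[rotated])
  then show ?thesis using mu_pos by (simp add: w_def field_simps)
qed

end

section \<open>The homological equations\<close>

context split_operator begin

definition lmin :: real where "lmin = Min (range lam)"

lemma lmin_pos: "0 < lmin" and lmin_le: "lmin \<le> lam j"
  unfolding lmin_def using lam_pos by (auto simp: Min_gr_iff)

lemma wdot_ge: "lmin * real (mdeg m) \<le> wdot lam m"
  unfolding wdot_def mdeg_def of_nat_sum sum_distrib_left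
  by (intro sum_mono) (metis lmin_le mult.commute mult_left_mono of_nat_0_le_iff)

lemma wdot_pos: "1 \<le> mdeg m \<Longrightarrow> 0 < wdot lam m"
  using wdot_ge[of m] lmin_pos by (smt (verit) mult_pos_pos of_nat_0_less_iff less_le_trans zero_less_one)

lemma wdot_neq_lam: "2 \<le> mdeg m \<Longrightarrow> wdot lam m \<noteq> lam j"
  using nonres unfolding nonresonant_def wdot_def mdeg_def by blast

text \<open>From some degree on, \<open>m . lam\<close> exceeds every \<open>lam j\<close> by at
  least 1. Only finitely many multi-indices remain, and for these non-resonance excludes the value
  0.\<close>

lemma small_divisors_bounded_below:
  obtains \<kappa> where "\<kappa> > 0" "\<And>m j. 2 \<le> mdeg m \<Longrightarrow> \<kappa> \<le> \<bar>wdot lam m - lam j\<bar>"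
proof -
  define lmax where "lmax = Max (range lam)"
  have lmax: "lam j \<le> lmax" for j unfolding lmax_def by (intro Max_ge) auto
  obtain k :: nat where k: "(lmax + 1) / lmin \<le> real k" using real_arch_simple by blast
  define G where "G = {m :: 'd \<Rightarrow> nat. mdeg m \<le> k \<and> 2 \<le> mdeg m} \<times> (UNIV :: 'd set)"
  have finG: "finite G"
    unfolding G_def by (intro finite_cartesian_product finite_subset[OF _ finite_mdeg_le[of k]]) auto
  \<comment> \<open>The inserted 1 is the bound for high degrees and keeps the set
    non-empty.\<close>
  define \<kappa> where "\<kappa> = Min (insert 1 ((\<lambda>(m, j). \<bar>wdot lam m - lam j\<bar>) ` G))"
  have "\<kappa> > 0" unfolding \<kappa>_def using finG wdot_neq_lam by (auto simp: Min_gr_iff G_def)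
  moreover have "\<kappa> \<le> \<bar>wdot lam m - lam j\<bar>" if m: "2 \<le> mdeg m" for m j
  proof (cases "mdeg m \<le> k")
    case True
    then show ?thesis unfolding \<kappa>_def using finG m by (intro Min_le) (auto simp: G_def intro!: image_eqI[of _ _ "(m, j)"])
  next
    case False
    have "lmax + 1 \<le> lmin * real k" using k lmin_pos by (simp add: field_simps)
    also have "\<dots> \<le> lmin * real (mdeg m)" using False lmin_pos by (intro mult_left_mono) auto
    finally have "1 \<le> wdot lam m - lam j" using wdot_ge[of m] lmax[of j] by linarith
    moreover have "\<kappa> \<le> 1" unfolding \<kappa>_def using finG by (intro Min_le) auto
    ultimately show ?thesis by linarith
  qed
  ultimately show thesis by (rule that)
qed

lemma resolvent_uniform_bound:
  obtains K where "K > 0"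
    "\<And>m x. 2 \<le> mdeg m \<Longrightarrow> x \<in> D \<Longrightarrow> norm x \<le> K * norm (wdot lam m *\<^sub>R x - A x)"
proof -
  obtain \<kappa> where \<kappa>: "\<kappa> > 0" "\<And>m j. 2 \<le> mdeg m \<Longrightarrow> \<kappa> \<le> \<bar>wdot lam m - lam j\<bar>"
    using small_divisors_bounded_below by blast
  obtain C1 where C1: "C1 > 0" "\<And>y. norm (cc y) \<le> norm y * C1"
    using bounded_linear.pos_bounded[OF cc_bl] by blast
  obtain C2 where C2: "C2 > 0" "\<And>y. norm (y - pu y) \<le> norm y * C2"
    using bounded_linear.pos_bounded[OF bounded_linear_sub[OF bounded_linear_ident pu_bl]] by blast
  define E where "E = (\<Sum>j\<in>UNIV. norm (\<xi> j))"
  have E: "0 \<le> E" unfolding E_def by (intro sum_nonneg) auto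
  \<comment> \<open>The first summand bounds the unstable component through the divisors, the second
    the stable component through \<open>stable_resolvent_bound\<close>; neither depends on
    \<open>m\<close>.\<close>
  define K where "K = C1 / \<kappa> * E + M / \<mu> * C2"
  have "K > 0" unfolding K_def using C1 \<kappa> E C2 M_pos mu_pos by (intro add_nonneg_pos) auto
  moreover have "norm x \<le> K * norm (wdot lam m *\<^sub>R x - A x)" if m: "2 \<le> mdeg m" and x: "x \<in> D" for m x
  proof -
    define z where "z = wdot lam m"
    define y where "y = z *\<^sub>R x - A x"
    have z: "z > 0" unfolding z_def using wdot_pos[of m] m by simp
    have ccy: "cc y $ j = (z - lam j) * cc x $ j" for j
      by (simp add: y_def cc_diff cc_scale cc_A[OF x] left_diff_distrib)
    have ccx: "\<bar>cc x $ j\<bar> \<le> C1 / \<kappa> * norm y" for j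
    proof -
      have "\<kappa> * \<bar>cc x $ j\<bar> \<le> \<bar>z - lam j\<bar> * \<bar>cc x $ j\<bar>"
        using \<kappa>(2)[OF m] by (intro mult_right_mono) (auto simp: z_def)
      also have "\<dots> = \<bar>cc y $ j\<bar>" by (simp add: ccy abs_mult)
      also have "\<dots> \<le> norm y * C1" using component_le_norm_cart[of "cc y" j] C1(2)[of y] by linarith
      finally show ?thesis using \<kappa>(1) by (simp add: field_simps)
    qed
    have "norm (pu x) \<le> (\<Sum>j\<in>UNIV. (C1 / \<kappa> * norm y) * norm (\<xi> j))"
      unfolding pu_def
    proof (intro order_trans[OF norm_sum] sum_mono)
      show "norm (cc x $ j *\<^sub>R \<xi> j) \<le> C1 / \<kappa> * norm y * norm (\<xi> j)" for j
        using mult_right_mono[OF ccx norm_ge_zero] by simp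
    qed
    then have 1: "norm (pu x) \<le> C1 / \<kappa> * E * norm y"
      unfolding sum_distrib_left[symmetric] E_def[symmetric] by (simp add: mult_ac)
    have vD: "x - pu x \<in> D" by (intro subspace_diff[OF D_sub] x pu_dom)
    have "z *\<^sub>R pu x - A (pu x) = pu y"
      unfolding A_pu
      unfolding pu_def[of y] pu_def[of x] scaleR_sum_right sum_subtractf[symmetric]
      by (intro sum.cong) (simp_all add: ccy algebra_simps)
    then have "z *\<^sub>R (x - pu x) - A (x - pu x) = y - pu y"
      unfolding A_diff[OF x pu_dom] y_def by (simp add: algebra_simps)
    then have "norm (x - pu x) \<le> M / \<mu> * norm (y - pu y)"
      using stable_resolvent_bound[OF vD ps_Xs z] by simp
    also have "\<dots> \<le> M / \<mu> * (norm y * C2)"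
      using M_pos mu_pos C2(2) by (intro mult_left_mono) auto
    finally have 2: "norm (x - pu x) \<le> M / \<mu> * C2 * norm y" by (simp add: mult_ac)
    have "norm x \<le> norm (pu x) + norm (x - pu x)" using norm_triangle_ineq[of "pu x" "x - pu x"] by simp
    also have "\<dots> \<le> K * norm y" using 1 2 by (simp add: K_def distrib_right)
    finally show ?thesis by (simp add: y_def z_def)
  qed
  ultimately show thesis by (rule that)
qed

section \<open>Solving the homological equations degree by degree\<close>

definition Res :: "real \<Rightarrow> 'a \<Rightarrow> 'a" where
  "Res z = (SOME T. bounded_linear T \<and> (\<forall>y. T y \<in> D \<and> z *\<^sub>R T y - A (T y) = y) \<and> (\<forall>x\<in>D. T (z *\<^sub>R x - A x) = x))"

lemma Res:
  assumes "0 < z" "z \<notin> range lam"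
  shows "bounded_linear (Res z)" "Res z y \<in> D" "z *\<^sub>R Res z y - A (Res z y) = y"
    "x \<in> D \<Longrightarrow> Res z (z *\<^sub>R x - A x) = x"
  using someI_ex[OF resolv[OF assms]] unfolding Res_def[symmetric] by blast+

lemma Res_wdot:
  assumes "2 \<le> mdeg m"
  shows "Res (wdot lam m) y \<in> D" "wdot lam m *\<^sub>R Res (wdot lam m) y - A (Res (wdot lam m) y) = y"
    "x \<in> D \<Longrightarrow> Res (wdot lam m) (wdot lam m *\<^sub>R x - A x) = x"
proof -
  have "0 < wdot lam m" "wdot lam m \<notin> range lam" using wdot_pos[of m] wdot_neq_lam[of m] assms by auto
  note r = Res[OF this]
  show "Res (wdot lam m) y \<in> D" "wdot lam m *\<^sub>R Res (wdot lam m) y - A (Res (wdot lam m) y) = y"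
    "x \<in> D \<Longrightarrow> Res (wdot lam m) (wdot lam m *\<^sub>R x - A x) = x" using r by blast+
qed

text \<open>In degree 1 the entries of \<open>m\<close> themselves select the eigenvector that
  belongs to \<open>m\<close>, so the index \<open>j\<close> need not be chosen.\<close>

definition linear_coef :: "('d \<Rightarrow> nat) \<Rightarrow> 'a" where
  "linear_coef m = (if mdeg m = 1 then \<Sum>j\<in>UNIV. real (m j) *\<^sub>R \<xi> j else 0)"

lemma linear_coef_unit: "linear_coef (unit_index j) = \<xi> j"
proof -
  have "linear_coef (unit_index j) = (\<Sum>i\<in>UNIV. real (unit_index j i) *\<^sub>R \<xi> i)"
    by (simp add: linear_coef_def)
  also have "\<dots> = (\<Sum>i\<in>UNIV. if i = j then \<xi> i else 0)"
    by (intro sum.cong) (auto simp: unit_index_def)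
  finally show ?thesis by simp
qed

text \<open>\<open>Ncoef n p m\<close> involves only coefficients of degree below that of \<open>m\<close>, so iterating \<open>coef_step\<close>
  fixes the coefficient at \<open>m\<close> after \<open>mdeg m\<close> steps.\<close>

definition coef_step :: "(('d \<Rightarrow> nat) \<Rightarrow> 'a) \<Rightarrow> ('d \<Rightarrow> nat) \<Rightarrow> 'a" where
  "coef_step p m = (if mdeg m \<le> 1 then linear_coef m else Res (wdot lam m) (Ncoef n p m))"

definition coef :: "('d \<Rightarrow> nat) \<Rightarrow> 'a" where
  "coef m = (coef_step ^^ mdeg m) (\<lambda>_. 0) m"

lemma coef_step_zero: "coef_step p (\<lambda>_. 0) = 0"
  by (simp add: coef_step_def linear_coef_def)

lemma coef_iter_zero: "(coef_step ^^ k) (\<lambda>_. 0) (\<lambda>_. 0) = 0"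
  by (cases k) (simp_all add: coef_step_zero)

lemma coef_step_cong:
  assumes "\<And>a. mdeg a < mdeg m \<Longrightarrow> p a = q a" "p (\<lambda>_. 0) = 0" "q (\<lambda>_. 0) = 0"
  shows "coef_step p m = coef_step q m"
  using Ncoef_cong[of m p q n] assms by (simp add: coef_step_def)

lemma coef_iter_Suc: "mdeg m \<le> k \<Longrightarrow> (coef_step ^^ Suc k) (\<lambda>_. 0) m = (coef_step ^^ k) (\<lambda>_. 0) m"
proof (induction k arbitrary: m)
  case 0
  then have "m = (\<lambda>_. 0)" by (simp add: mdeg_eq_0_iff)
  then show ?case by (simp add: coef_step_zero)
next
  case (Suc k)
  have "coef_step ((coef_step ^^ Suc k) (\<lambda>_. 0)) m = coef_step ((coef_step ^^ k) (\<lambda>_. 0)) m"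
  proof (rule coef_step_cong)
    show "(coef_step ^^ Suc k) (\<lambda>_. 0) a = (coef_step ^^ k) (\<lambda>_. 0) a" if "mdeg a < mdeg m" for a
      by (rule Suc.IH) (use that Suc.prems in simp)
  qed (rule coef_iter_zero)+
  then show ?case by simp
qed

lemma coef_iter: "mdeg m \<le> k \<Longrightarrow> (coef_step ^^ k) (\<lambda>_. 0) m = coef m"
proof (induction k rule: dec_induct)
  case base
  then show ?case by (simp add: coef_def)
next
  case (step k)
  then show ?case using coef_iter_Suc by simp
qed

lemma coef_zero: "coef (\<lambda>_. 0) = 0"
  by (simp add: coef_def)

lemma coef_fixpoint: "coef_step coef m = coef m"
proof -
  have "coef_step coef m = coef_step ((coef_step ^^ mdeg m) (\<lambda>_. 0)) m"
    by (rule coef_step_cong) (simp_all add: coef_iter coef_zero coef_iter_zero)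
  also have "\<dots> = (coef_step ^^ Suc (mdeg m)) (\<lambda>_. 0) m" by simp
  also have "\<dots> = coef m" by (rule coef_iter) simp
  finally show ?thesis .
qed

lemma coef_unit: "coef (unit_index j) = \<xi> j"
  using coef_fixpoint[of "unit_index j"] by (simp add: coef_step_def linear_coef_unit)

lemma coef_dom: "coef m \<in> D" and coef_eq: "A (coef m) = wdot lam m *\<^sub>R coef m - Ncoef n coef m"
proof -
  consider "mdeg m = 0" | "mdeg m = 1" | "2 \<le> mdeg m" by linarith
  then have "coef m \<in> D \<and> A (coef m) = wdot lam m *\<^sub>R coef m - Ncoef n coef m"
  proof cases
    case 1
    then have "coef m = 0" using coef_zero by (simp add: mdeg_eq_0_iff)
    then show ?thesis using subspace_0[OF D_sub] A_scale[OF subspace_0[OF D_sub], of 0] 1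
      by (simp add: Ncoef_def)
  next
    case 2
    then obtain j where "m = unit_index j" by (rule mdeg_eq_1D)
    then show ?thesis using xi_dom xi_eig Ncoef_deg_le_1[of coef m, OF coef_zero] by (simp add: coef_unit)
  next
    case 3
    then have "coef m = Res (wdot lam m) (Ncoef n coef m)"
      using coef_fixpoint[of m] by (simp add: coef_step_def)
    then show ?thesis using Res_wdot(1,2)[OF 3, of "Ncoef n coef m"] by (simp add: algebra_simps)
  qed
  then show "coef m \<in> D" "A (coef m) = wdot lam m *\<^sub>R coef m - Ncoef n coef m" by auto
qed

text \<open>As \<open>N\<close> is of second order, its norm series is at most a constant times the
  square of \<open>\<rho>\<close>. The quadratic factor allows a small ball of coefficient families
  to be mapped into itself.\<close>

lemma N_majorant_le:
  assumes "0 \<le> \<rho>" "\<rho> \<le> R"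
  shows "summable (\<lambda>j. norm (n (j + 2)) * \<rho> ^ (j + 2))"
    "(\<Sum>j. norm (n (j + 2)) * \<rho> ^ (j + 2)) \<le> (\<Sum>j. norm (n (j + 2)) * R ^ (j + 2)) / R\<^sup>2 * \<rho>\<^sup>2"
proof -
  have t: "norm (n (j + 2)) * \<rho> ^ (j + 2) \<le> norm (n (j + 2)) * R ^ (j + 2) * (\<rho>\<^sup>2 / R\<^sup>2)" for j
  proof -
    have "\<rho> ^ (j + 2) \<le> R ^ j * \<rho>\<^sup>2"
      unfolding power_add using assms by (intro mult_right_mono power_mono) auto
    also have "\<dots> = R ^ (j + 2) * (\<rho>\<^sup>2 / R\<^sup>2)" using R_pos by (simp add: power_add power2_eq_square)
    finally have "norm (n (j + 2)) * \<rho> ^ (j + 2) \<le> norm (n (j + 2)) * (R ^ (j + 2) * (\<rho>\<^sup>2 / R\<^sup>2))"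
      by (rule mult_left_mono) simp
    then show ?thesis by (simp only: mult.assoc)
  qed
  have sm: "summable (\<lambda>j. norm (n (j + 2)) * R ^ (j + 2) * (\<rho>\<^sup>2 / R\<^sup>2))"
    by (rule summable_mult2[OF N_sum])
  show s: "summable (\<lambda>j. norm (n (j + 2)) * \<rho> ^ (j + 2))"
    by (rule summable_comparison_test'[OF sm]) (use t assms in simp)
  have "(\<Sum>j. norm (n (j + 2)) * \<rho> ^ (j + 2)) \<le> (\<Sum>j. norm (n (j + 2)) * R ^ (j + 2) * (\<rho>\<^sup>2 / R\<^sup>2))"
    by (rule suminf_le[OF t s sm])
  also have "\<dots> = (\<Sum>j. norm (n (j + 2)) * R ^ (j + 2)) * (\<rho>\<^sup>2 / R\<^sup>2)"
    by (rule suminf_mult2[OF N_sum, symmetric])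
  finally show "(\<Sum>j. norm (n (j + 2)) * \<rho> ^ (j + 2)) \<le> (\<Sum>j. norm (n (j + 2)) * R ^ (j + 2)) / R\<^sup>2 * \<rho>\<^sup>2"
    by simp
qed

text \<open>Families with majorant \<open>\<rho>\<close> at radius \<open>\<delta>\<close> are
  preserved by \<open>coef_step\<close>: the choice of \<open>\<rho>\<close> keeps the contribution
  of degrees above 1 below \<open>\<rho> / 2\<close>, and the choice of \<open>\<delta>\<close> does
  the same for the linear terms. All iterates from 0 stay in this set, and stationarity of each
  coefficient takes the place of a contraction argument.\<close>

lemma coef_majorized:
  obtains \<delta> \<rho> where "\<delta> > 0" "\<rho> > 0" "\<rho> \<le> R" "majorized coef \<delta> \<rho>"
proof -
  obtain K where K: "K > 0"
    "\<And>m x. 2 \<le> mdeg m \<Longrightarrow> x \<in> D \<Longrightarrow> norm x \<le> K * norm (wdot lam m *\<^sub>R x - A x)"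
    using resolvent_uniform_bound by blast
  define C where "C = (\<Sum>j. norm (n (j + 2)) * R ^ (j + 2)) / R\<^sup>2 + 1"
  have C: "C > 0" unfolding C_def using R_pos
    by (intro add_nonneg_pos divide_nonneg_nonneg suminf_nonneg[OF N_sum]) auto
  define E where "E = (\<Sum>m | mdeg m \<le> 1. norm (linear_coef m)) + 1"
  have E: "E > 0" unfolding E_def by (intro add_nonneg_pos sum_nonneg) auto
  define \<rho> where "\<rho> = min R (1 / (2 * K * C))"
  define \<delta> where "\<delta> = min 1 (\<rho> / (2 * E))"
  have \<rho>: "\<rho> > 0" "\<rho> \<le> R" using R_pos K C by (auto simp: \<rho>_def)
  have \<delta>: "\<delta> > 0" "\<delta> \<le> 1" "E * \<delta> \<le> \<rho> / 2"
    using E \<rho> by (auto simp: \<delta>_def min_def field_simps)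
  have KC: "K * (C * \<rho>\<^sup>2) \<le> \<rho> / 2"
  proof -
    have "K * C * \<rho> \<le> K * C * (1 / (2 * K * C))"
      using K C by (intro mult_left_mono) (auto simp: \<rho>_def)
    also have "\<dots> = 1 / 2" using K C by simp
    finally have "K * C * \<rho> * \<rho> \<le> 1 / 2 * \<rho>" using \<rho> by (intro mult_right_mono) auto
    then show ?thesis by (simp add: power2_eq_square mult.assoc)
  qed
  have step: "majorized (coef_step p) \<delta> \<rho>" if p: "majorized p \<delta> \<rho>" for p
    unfolding majorized_def
  proof (intro allI impI)
    fix F :: "('d \<Rightarrow> nat) set" assume F: "finite F"
    let ?L = "{m \<in> F. mdeg m \<le> 1}" and ?H = "{m \<in> F. \<not> mdeg m \<le> 1}"
    have 1: "(\<Sum>m\<in>?L. norm (coef_step p m) * \<delta> ^ mdeg m) \<le> \<rho> / 2"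
    proof -
      have "(\<Sum>m\<in>?L. norm (coef_step p m) * \<delta> ^ mdeg m) \<le> (\<Sum>m\<in>?L. norm (linear_coef m) * \<delta>)"
      proof (rule sum_mono)
        fix m assume "m \<in> ?L"
        then show "norm (coef_step p m) * \<delta> ^ mdeg m \<le> norm (linear_coef m) * \<delta>"
          by (cases "mdeg m = 1") (auto simp: coef_step_def linear_coef_def)
      qed
      also have "\<dots> \<le> (\<Sum>m | mdeg m \<le> 1. norm (linear_coef m) * \<delta>)"
        using \<delta> by (intro sum_mono2 finite_mdeg_le) auto
      also have "\<dots> \<le> E * \<delta>" using \<delta> by (simp add: E_def sum_distrib_right[symmetric] mult_right_mono)
      finally show ?thesis using \<delta> by simp
    qed
    have 2: "(\<Sum>m\<in>?H. norm (coef_step p m) * \<delta> ^ mdeg m) \<le> \<rho> / 2"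
    proof -
      have "(\<Sum>m\<in>?H. norm (coef_step p m) * \<delta> ^ mdeg m) \<le> (\<Sum>m\<in>?H. K * (norm (Ncoef n p m) * \<delta> ^ mdeg m))"
      proof (rule sum_mono)
        fix m assume "m \<in> ?H"
        then have m: "2 \<le> mdeg m" by simp
        have "norm (coef_step p m) \<le> K * norm (Ncoef n p m)"
          using K(2)[OF m Res_wdot(1)[OF m], of "Ncoef n p m"] m by (simp add: coef_step_def Res_wdot(2))
        then show "norm (coef_step p m) * \<delta> ^ mdeg m \<le> K * (norm (Ncoef n p m) * \<delta> ^ mdeg m)"
          using \<delta> by (simp add: mult.assoc[symmetric] mult_right_mono)
      qed
      also have "\<dots> = K * (\<Sum>m\<in>?H. norm (Ncoef n p m) * \<delta> ^ mdeg m)" by (simp add: sum_distrib_left)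
      also have "\<dots> \<le> K * (\<Sum>j. norm (n (j + 2)) * \<rho> ^ (j + 2))"
        using K F \<delta> N_majorant_le(1)[of \<rho>] \<rho>
        by (intro mult_left_mono majorizedD[OF majorized_Ncoef[OF p]]) auto
      also have "\<dots> \<le> K * (C * \<rho>\<^sup>2)"
      proof (intro mult_left_mono)
        have "(\<Sum>j. norm (n (j + 2)) * \<rho> ^ (j + 2)) \<le> (\<Sum>j. norm (n (j + 2)) * R ^ (j + 2)) / R\<^sup>2 * \<rho>\<^sup>2"
          using N_majorant_le(2)[of \<rho>] \<rho> by simp
        also have "\<dots> \<le> C * \<rho>\<^sup>2" unfolding C_def by (intro mult_right_mono) auto
        finally show "(\<Sum>j. norm (n (j + 2)) * \<rho> ^ (j + 2)) \<le> C * \<rho>\<^sup>2" .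
      qed (use K in simp)
      finally show ?thesis using KC by simp
    qed
    have "(\<Sum>m\<in>F. norm (coef_step p m) * \<delta> ^ mdeg m) =
        (\<Sum>m\<in>?L. norm (coef_step p m) * \<delta> ^ mdeg m) + (\<Sum>m\<in>?H. norm (coef_step p m) * \<delta> ^ mdeg m)"
      using F by (subst sum.union_disjoint[symmetric]) (auto intro: sum.cong)
    then show "(\<Sum>m\<in>F. norm (coef_step p m) * \<delta> ^ mdeg m) \<le> \<rho>" using 1 2 by simp
  qed
  have iter: "majorized ((coef_step ^^ k) (\<lambda>_. 0)) \<delta> \<rho>" for k
  proof (induction k)
    case 0
    then show ?case using \<rho> by (simp add: majorized_def)
  next
    case (Suc k)
    then show ?case using step by simp
  qed
  \<comment> \<open>On a finite set of indices the coefficients are those of one sufficiently late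
    iterate.\<close>
  have "majorized coef \<delta> \<rho>"
    unfolding majorized_def
  proof (intro allI impI)
    fix F :: "('d \<Rightarrow> nat) set" assume F: "finite F"
    define k where "k = Max (insert 0 (mdeg ` F))"
    have "mdeg m \<le> k" if "m \<in> F" for m unfolding k_def using F that by (intro Max_ge) auto
    then have "(\<Sum>m\<in>F. norm (coef m) * \<delta> ^ mdeg m) = (\<Sum>m\<in>F. norm ((coef_step ^^ k) (\<lambda>_. 0) m) * \<delta> ^ mdeg m)"
      by (intro sum.cong) (auto simp: coef_iter)
    also have "\<dots> \<le> \<rho>" by (rule majorizedD[OF iter F])
    finally show "(\<Sum>m\<in>F. norm (coef m) * \<delta> ^ mdeg m) \<le> \<rho>" .
  qed
  with \<delta> \<rho> show thesis by (intro that) auto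
qed

end

section \<open>The parameterization\<close>

lemma pser_linear_part:
  fixes c :: "('d::finite \<Rightarrow> nat) \<Rightarrow> 'a::banach"
  assumes c: "majorized c r K" and c0: "c (\<lambda>_. 0) = 0" and \<theta>: "\<And>j. \<bar>\<theta> $ j\<bar> \<le> r"
  shows "pser c \<theta> = (\<Sum>j\<in>UNIV. \<theta> $ j *\<^sub>R c (unit_index j)) + pser (\<lambda>m. if mdeg m \<le> 1 then 0 else c m) \<theta>"
proof (rule pser_eqI)
  have r: "0 \<le> r" using \<theta> abs_ge_zero order_trans by blast
  define U where "U = range (unit_index :: 'd \<Rightarrow> 'd \<Rightarrow> nat)"
  have inj: "inj (unit_index :: 'd \<Rightarrow> 'd \<Rightarrow> nat)"
    by (rule injI) (metis unit_index_def zero_neq_one)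
  have U: "m \<in> U \<longleftrightarrow> mdeg m = 1" for m
    unfolding U_def by (metis imageE mdeg_eq_1D mdeg_unit_index rangeI)
  have "(\<Sum>j\<in>UNIV. \<theta> $ j *\<^sub>R c (unit_index j)) = (\<Sum>m\<in>U. monom_at m \<theta> *\<^sub>R c m)"
    unfolding U_def by (simp add: sum.reindex[OF inj] monom_at_unit_index)
  then have 1: "((\<lambda>m. if mdeg m = 1 then monom_at m \<theta> *\<^sub>R c m else 0)
      has_sum (\<Sum>j\<in>UNIV. \<theta> $ j *\<^sub>R c (unit_index j))) UNIV"
    using U by (intro has_sum_finite_neutralI[of U]) (auto simp: U_def)
  have rem: "majorized (\<lambda>m. if mdeg m \<le> 1 then 0 else c m) r K"
    by (rule majorized_mono[OF c r]) auto
  have eq: "(if mdeg m = 1 then monom_at m \<theta> *\<^sub>R c m else 0) + monom_at m \<theta> *\<^sub>R (if mdeg m \<le> 1 then 0 else c m)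
      = monom_at m \<theta> *\<^sub>R c m" for m
  proof (cases "mdeg m = 0")
    case True
    then show ?thesis using c0 by (simp add: mdeg_eq_0_iff)
  qed auto
  show "((\<lambda>m. monom_at m \<theta> *\<^sub>R c m) has_sum
      ((\<Sum>j\<in>UNIV. \<theta> $ j *\<^sub>R c (unit_index j)) + pser (\<lambda>m. if mdeg m \<le> 1 then 0 else c m) \<theta>)) UNIV"
    using has_sum_add[OF 1 pser_has_sum[OF rem \<theta>]] unfolding eq .
qed

lemma pser_at_0:
  fixes c :: "('d::finite \<Rightarrow> nat) \<Rightarrow> 'a::banach"
  shows "pser c 0 = c (\<lambda>_. 0)"
proof (rule pser_eqI)
  show "((\<lambda>m. monom_at m 0 *\<^sub>R c m) has_sum c (\<lambda>_. 0)) UNIV"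
    by (rule has_sum_finite_neutralI[of "{\<lambda>_. 0}"]) (auto simp: monom_at_zero)
qed

text \<open>The terms of degree at least 2 are Lipschitz on the box of size \<open>norm y\<close>
  with a constant of that order, so their sum is quadratic at 0 and only the linear coefficients
  remain.\<close>

lemma pser_has_derivative_0:
  fixes c :: "('d::finite \<Rightarrow> nat) \<Rightarrow> 'a::banach"
  assumes c: "majorized c r K" and c0: "c (\<lambda>_. 0) = 0" and r: "0 < r"
  shows "(pser c has_derivative (\<lambda>v. \<Sum>j\<in>UNIV. v $ j *\<^sub>R c (unit_index j))) (at 0)"
proof -
  define g where "g m = (if mdeg m \<le> 1 then 0 else c m)" for m
  have g: "majorized g r K" unfolding g_def by (rule majorized_mono[OF c]) (use r in auto)
  define C where "C = 2 * K / r\<^sup>2 + 1"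
  have C: "C > 0" unfolding C_def using majorized_nonneg[OF c] r by (intro add_nonneg_pos) auto
  have "(pser g has_derivative (\<lambda>_. 0)) (at 0)"
    unfolding has_derivative_at_alt
  proof (intro conjI allI impI)
    fix e :: real assume e: "0 < e"
    show "\<exists>d>0. \<forall>y. norm (y - 0) < d \<longrightarrow> norm (pser g y - pser g 0 - 0) \<le> e * norm (y - 0)"
    proof (intro exI[of _ "min (r / 2) (e / C)"] conjI allI impI)
      fix y :: "real ^ 'd" assume y: "norm (y - 0) < min (r / 2) (e / C)"
      have "\<bar>y $ j\<bar> \<le> norm y" for j by (rule component_le_norm_cart)
      then have "norm (pser g y - pser g 0) \<le> 2 * K / r\<^sup>2 * norm y * norm (y - 0)"
        by (intro pser_remainder_lipschitz[OF g r]) (use y in \<open>auto simp: g_def\<close>)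
      also have "\<dots> \<le> C * norm y * norm (y - 0)"
        unfolding C_def by (intro mult_right_mono) auto
      also have "\<dots> \<le> e * norm (y - 0)"
        using y C by (intro mult_right_mono) (auto simp: field_simps)
      finally show "norm (pser g y - pser g 0 - 0) \<le> e * norm (y - 0)" by simp
    qed (use r e C in auto)
  qed simp
  moreover have "((\<lambda>\<theta>. \<Sum>j\<in>UNIV. \<theta> $ j *\<^sub>R c (unit_index j)) has_derivative (\<lambda>v. \<Sum>j\<in>UNIV. v $ j *\<^sub>R c (unit_index j))) (at 0)"
    by (intro bounded_linear_imp_has_derivative bounded_linear_sum bounded_linear_scaleR_const bounded_linear_vec_nth)
  ultimately have d: "((\<lambda>\<theta>. (\<Sum>j\<in>UNIV. \<theta> $ j *\<^sub>R c (unit_index j)) + pser g \<theta>) has_derivative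
      (\<lambda>v. (\<Sum>j\<in>UNIV. v $ j *\<^sub>R c (unit_index j)) + 0)) (at 0)"
    by (intro has_derivative_add)
  have "(pser c has_derivative (\<lambda>v. (\<Sum>j\<in>UNIV. v $ j *\<^sub>R c (unit_index j)) + 0)) (at 0)"
  proof (rule has_derivative_transform_within_open[OF d open_box_set[of r]])
    show "(\<Sum>j\<in>UNIV. \<theta> $ j *\<^sub>R c (unit_index j)) + pser g \<theta> = pser c \<theta>" if "\<theta> \<in> {\<theta>. \<forall>j. \<bar>\<theta> $ j\<bar> < r}" for \<theta>
      using pser_linear_part[OF c c0, of \<theta>] that by (simp add: g_def[abs_def] less_imp_le)
  qed (use r in auto)
  then show ?thesis by simp
qed

lemma open_B1: "open (B1 :: (real ^ 'd::finite) set)"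
  unfolding B1_def by (rule open_box_set)

lemma has_vector_derivative_axis:
  fixes Q :: "real ^ 'd::finite \<Rightarrow> 'a::real_normed_vector"
  assumes "(Q has_derivative Q') (at 0)"
  shows "((\<lambda>h. Q (h *\<^sub>R axis j 1)) has_vector_derivative Q' (axis j 1)) (at 0)"
proof -
  have "((\<lambda>h::real. h *\<^sub>R (axis j 1 :: real ^ 'd)) has_derivative (\<lambda>h. h *\<^sub>R axis j 1)) (at 0)"
    by (intro bounded_linear_imp_has_derivative bounded_linear_scaleR_left)
  moreover have "(Q has_derivative Q') (at (0 *\<^sub>R axis j 1))" using assms by simp
  ultimately have "((\<lambda>h. Q (h *\<^sub>R axis j 1)) has_derivative (\<lambda>h. Q' (h *\<^sub>R axis j 1))) (at 0)"
    by (rule has_derivative_compose)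
  then show ?thesis
    by (simp add: has_vector_derivative_def linear_scale[OF bounded_linear.linear[OF has_derivative_bounded_linear[OF assms]]])
qed

context split_operator begin

text \<open>A positive real point to the right of all \<open>lam j\<close>, hence one with a bounded
  real resolvent.\<close>

definition z0 :: real where "z0 = Max (range lam) + 1"

lemma z0: "0 < z0" "z0 \<notin> range lam"
proof -
  have le: "lam j \<le> Max (range lam)" for j by (intro Max_ge) auto
  show "0 < z0" unfolding z0_def using le[of undefined] lam_pos[of undefined] by linarith
  show "z0 \<notin> range lam"
  proof
    assume "z0 \<in> range lam"
    then obtain j where "z0 = lam j" by auto
    then show False using le[of j] unfolding z0_def by linarith
  qed
qed

text \<open>The bounded operator \<open>Res z0\<close> passes through the sum of
  \<open>z0 x - A x\<close> and returns \<open>X\<close>. This places \<open>X\<close> in the range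
  of the resolvent, hence in \<open>D\<close>, and applying \<open>z0 - A\<close> gives its
  image.\<close>

lemma A_has_sum:
  assumes x: "\<And>i. x i \<in> D" "(x has_sum X) I" and Ax: "((\<lambda>i. A (x i)) has_sum Y) I"
  shows "X \<in> D" "A X = Y"
proof -
  have "((\<lambda>i. z0 *\<^sub>R x i - A (x i)) has_sum (z0 *\<^sub>R X - Y)) I"
    by (intro has_sum_diff Ax has_sum_scaleR x)
  from has_sum_bounded_linear[OF Res(1)[OF z0] this]
  have "(x has_sum Res z0 (z0 *\<^sub>R X - Y)) I" using Res(4)[OF z0 x(1)] by simp
  then have X: "X = Res z0 (z0 *\<^sub>R X - Y)" using x(2) infsumI by metis
  then show "X \<in> D" using Res(2)[OF z0] by metis
  show "A X = Y" using Res(3)[OF z0, of "z0 *\<^sub>R X - Y"] X by simp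
qed

lemma pser_invariance:
  fixes Q :: "real ^ 'd \<Rightarrow> 'a"
  assumes c: "majorized c r \<rho>" "\<rho> \<le> R" and \<theta>: "\<And>j. \<bar>\<theta> $ j\<bar> < r"
    and c0: "c (\<lambda>_. 0) = 0" and cD: "\<And>m. c m \<in> D"
    and cA: "\<And>m. A (c m) = wdot lam m *\<^sub>R c m - Ncoef n c m"
  shows "pser c \<theta> \<in> D" "pser c \<theta> \<in> N_dom n"
    "F_fun A n (pser c \<theta>) = frechet_derivative (pser c) (at \<theta>) (diag_matrix lam *v \<theta>)"
proof -
  have \<theta>': "\<And>j. \<bar>\<theta> $ j\<bar> \<le> r" using \<theta> by (simp add: less_imp_le)
  have r: "0 \<le> r" using \<theta>' abs_ge_zero order_trans by blast
  have sm: "summable (\<lambda>j. norm (n (j + 2)) * \<rho> ^ (j + 2))"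
    using N_majorant_le(1)[OF majorized_nonneg[OF c(1)] c(2)] .
  show "pser c \<theta> \<in> N_dom n" by (rule N_dom_ball[OF sm norm_pser_le[OF c(1) \<theta>']])
  have dF: "(pser c has_derivative frechet_derivative (pser c) (at \<theta>)) (at \<theta>)"
    using pser_has_derivative(1)[OF c(1) \<theta>] frechet_derivative_works differentiable_def by blast
  have 1: "((\<lambda>m. monom_at m \<theta> *\<^sub>R (wdot lam m *\<^sub>R c m)) has_sum
      frechet_derivative (pser c) (at \<theta>) (diag_matrix lam *v \<theta>)) UNIV"
    unfolding wdot_def by (rule pser_derivative_diag[OF c(1) \<theta> dF open_UNIV]) auto
  have 2: "((\<lambda>m. monom_at m \<theta> *\<^sub>R Ncoef n c m) has_sum N_fun n (pser c \<theta>)) UNIV"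
    using pser_has_sum[OF majorized_Ncoef[OF c(1) r sm] \<theta>'] pser_Ncoef[OF c(1) \<theta>' sm c0] by simp
  have "((\<lambda>m. A (monom_at m \<theta> *\<^sub>R c m)) has_sum
      (frechet_derivative (pser c) (at \<theta>) (diag_matrix lam *v \<theta>) - N_fun n (pser c \<theta>))) UNIV"
    using has_sum_diff[OF 1 2] by (simp add: A_scale[OF cD] cA scaleR_right_diff_distrib)
  note AS = A_has_sum[OF subspace_scale[OF D_sub cD] pser_has_sum[OF c(1) \<theta>'] this]
  show "pser c \<theta> \<in> D" by (rule AS(1))
  show "F_fun A n (pser c \<theta>) = frechet_derivative (pser c) (at \<theta>) (diag_matrix lam *v \<theta>)"
    unfolding F_fun_def AS(2) by simp
qed

section \<open>Rescaling by \<open>s\<close>, existence and uniqueness of the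
  parameterization\<close>

definition scoef :: "('d \<Rightarrow> real) \<Rightarrow> ('d \<Rightarrow> nat) \<Rightarrow> 'a" where
  "scoef s m = monom_at m (\<chi> j. s j) *\<^sub>R coef m"

lemma scoef_zero: "scoef s (\<lambda>_. 0) = 0" by (simp add: scoef_def coef_zero)

lemma scoef_unit: "scoef s (unit_index j) = s j *\<^sub>R \<xi> j"
  by (simp add: scoef_def coef_unit monom_at_unit_index)

lemma scoef_dom: "scoef s m \<in> D"
  unfolding scoef_def by (intro subspace_scale[OF D_sub] coef_dom)

lemma scoef_eq: "A (scoef s m) = wdot lam m *\<^sub>R scoef s m - Ncoef n (scoef s) m"
  unfolding scoef_def[abs_def] Ncoef_scale
  by (simp add: A_scale[OF coef_dom] coef_eq scaleR_right_diff_distrib)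

text \<open>Smallness of \<open>s\<close> is traded for radius: in degree \<open>k\<close> the
  weight \<open>\<sigma> ^ k * r ^ k\<close> stays below \<open>\<delta> ^ k\<close>. Small scalings
  thus push the radius beyond 1.\<close>

lemma scoef_majorized:
  assumes c: "majorized coef \<delta> \<rho>" and s: "\<And>j. \<bar>s j\<bar> \<le> \<sigma>" and r: "0 \<le> r" "r * \<sigma> \<le> \<delta>"
  shows "majorized (scoef s) r \<rho>"
  unfolding majorized_def
proof (intro allI impI)
  fix F :: "('d \<Rightarrow> nat) set" assume F: "finite F"
  have \<sigma>: "0 \<le> \<sigma>" using s abs_ge_zero order_trans by blast
  have "(\<Sum>m\<in>F. norm (scoef s m) * r ^ mdeg m) \<le> (\<Sum>m\<in>F. norm (coef m) * \<delta> ^ mdeg m)"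
  proof (rule sum_mono)
    fix m
    have "\<bar>monom_at m (\<chi> j. s j)\<bar> \<le> \<sigma> ^ mdeg m" by (rule abs_monom_at_le) (simp add: s)
    then have "\<bar>monom_at m (\<chi> j. s j)\<bar> * r ^ mdeg m \<le> \<sigma> ^ mdeg m * r ^ mdeg m"
      using r by (intro mult_right_mono) auto
    also have "\<dots> = (r * \<sigma>) ^ mdeg m" by (simp add: power_mult_distrib)
    also have "\<dots> \<le> \<delta> ^ mdeg m" using r \<sigma> by (intro power_mono) auto
    finally have "norm (coef m) * (\<bar>monom_at m (\<chi> j. s j)\<bar> * r ^ mdeg m) \<le> norm (coef m) * \<delta> ^ mdeg m"
      by (rule mult_left_mono) simp
    then show "norm (scoef s m) * r ^ mdeg m \<le> norm (coef m) * \<delta> ^ mdeg m"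
      by (simp add: scoef_def mult_ac)
  qed
  also have "\<dots> \<le> \<rho>" by (rule majorizedD[OF c F])
  finally show "(\<Sum>m\<in>F. norm (scoef s m) * r ^ mdeg m) \<le> \<rho>" .
qed

lemma pser_scoef: "pser (scoef s) \<theta> = pser coef (\<chi> j. s j * \<theta> $ j)"
  unfolding pser_def scoef_def monom_at_mult by (simp add: mult.commute)

lemma parameterization:
  assumes c: "majorized (scoef s) r \<rho>" "1 < r" "\<rho> \<le> R"
  shows "unstable_parameterization D A n lam \<xi> s (pser (scoef s))"
  unfolding unstable_parameterization_def
proof (intro conjI allI)
  have B: "\<bar>\<theta> $ j\<bar> < r" if "\<theta> \<in> B1" for \<theta> j using that c(2) by (auto simp: B1_def intro: less_trans)
  show "analytic_on_B1 (pser (scoef s))"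
    unfolding analytic_on_B1_def monom_at_def[symmetric]
    by (intro exI[of _ "scoef s"] ballI pser_has_sum[OF c(1)] less_imp_le B)
  show "pser (scoef s) 0 = 0" by (simp add: pser_at_0 scoef_zero)
  show "((\<lambda>h. pser (scoef s) (h *\<^sub>R axis j 1)) has_vector_derivative s j *\<^sub>R \<xi> j) (at 0)" for j
  proof -
    have "0 < r" using c(2) by simp
    have "(\<Sum>i\<in>UNIV. axis j 1 $ i *\<^sub>R scoef s (unit_index i)) = (\<Sum>i\<in>UNIV. if i = j then scoef s (unit_index j) else 0)"
      by (intro sum.cong) (auto simp: axis_def)
    also have "\<dots> = s j *\<^sub>R \<xi> j" by (simp add: scoef_unit)
    finally show ?thesis
      using has_vector_derivative_axis[OF pser_has_derivative_0[OF c(1) scoef_zero \<open>0 < r\<close>], of j] by simp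
  qed
  show "invariance_equation D A n lam (pser (scoef s))"
    unfolding invariance_equation_def
    using pser_invariance[OF c(1,3) B scoef_zero scoef_dom scoef_eq] by blast
qed

text \<open>With \<open>T = (z0 - A)\<^sup>-\<^sup>1\<close> bounded, the invariance equation reads \<open>Q = T (z0 Q - DQ \<Lambda>\<theta> + N(Q))\<close>.
  Comparing coefficients shows that those of \<open>Q\<close> lie in \<open>D\<close> and satisfy the homological equations,
  which non-resonance solves uniquely.\<close>

lemma parameterization_unique:
  assumes Q: "unstable_parameterization D A n lam \<xi> s Q"
    and \<theta>: "\<theta> \<in> B1"
  shows "Q \<theta> = pser (scoef s) \<theta>"
proof -
  from Q obtain q where q: "\<And>\<theta>. \<theta> \<in> B1 \<Longrightarrow> ((\<lambda>m. monom_at m \<theta> *\<^sub>R q m) has_sum Q \<theta>) UNIV"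
    unfolding unstable_parameterization_def analytic_on_B1_def monom_at_def by blast
  have Qp: "Q \<theta> = pser q \<theta>" if "\<theta> \<in> B1" for \<theta> using pser_eqI[OF q[OF that]] by simp
  obtain K where K: "majorized q (1/2) K"
    using analytic_on_B1_majorized[of q Q "1/2"] q by (auto simp: monom_at_def)
  have zB: "0 \<in> (B1 :: (real ^ 'd) set)" by (simp add: B1_def)
  have q0: "q (\<lambda>_. 0) = 0"
    using Q Qp[OF zB] by (simp add: unstable_parameterization_def pser_at_0)
  have q1: "q (unit_index j) = s j *\<^sub>R \<xi> j" for j
  proof -
    have "(pser q has_derivative (\<lambda>v. \<Sum>j\<in>UNIV. v $ j *\<^sub>R q (unit_index j))) (at 0)"
      by (rule pser_has_derivative_0[OF K q0]) simp
    then have "(Q has_derivative (\<lambda>v. \<Sum>j\<in>UNIV. v $ j *\<^sub>R q (unit_index j))) (at 0)"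
      by (rule has_derivative_transform_within_open[OF _ open_B1 zB]) (simp add: Qp)
    from has_vector_derivative_axis[OF this, of j]
    have "((\<lambda>h. Q (h *\<^sub>R axis j 1)) has_vector_derivative (\<Sum>i\<in>UNIV. axis j 1 $ i *\<^sub>R q (unit_index i))) (at 0)" .
    moreover have "(\<Sum>i\<in>UNIV. axis j 1 $ i *\<^sub>R q (unit_index i)) = (\<Sum>i\<in>UNIV. if i = j then q (unit_index j) else 0)"
      by (intro sum.cong) (auto simp: axis_def)
    ultimately have "((\<lambda>h. Q (h *\<^sub>R axis j 1)) has_vector_derivative q (unit_index j)) (at 0)" by simp
    moreover have "((\<lambda>h. Q (h *\<^sub>R axis j 1)) has_vector_derivative s j *\<^sub>R \<xi> j) (at 0)"
      using Q by (simp add: unstable_parameterization_def)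
    ultimately show ?thesis by (rule vector_derivative_unique_at)
  qed
  \<comment> \<open>As \<open>q\<close> has no constant term, passing from radius \<open>1/2\<close>
    to \<open>r\<close> gains the factor \<open>2 * r\<close>. This brings the bound
    \<open>K\<close> down to \<open>R\<close>, where the series of \<open>N\<close>
    converges.\<close>
  define r where "r = min (1/2) (R / (2 * (K + 1)))"
  have K0: "0 \<le> K" by (rule majorized_nonneg[OF K])
  have r: "0 < r" "r \<le> 1/2" using R_pos K0 unfolding r_def by (simp_all only: min_less_iff_conj min.cobounded1) simp
  have rK: "2 * r * K \<le> R"
  proof -
    have "2 * r * K \<le> 2 * (R / (2 * (K + 1))) * (K + 1)"
      using K0 R_pos r by (intro mult_mono mult_left_mono) (auto simp: r_def)
    also have "\<dots> = R" using K0 by (simp add: divide_simps)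
    finally show ?thesis .
  qed
  have mq: "majorized q r R"
    unfolding majorized_def
  proof (intro allI impI)
    fix F :: "('d \<Rightarrow> nat) set" assume F: "finite F"
    have "(\<Sum>m\<in>F. norm (q m) * r ^ mdeg m) \<le> (\<Sum>m\<in>F. 2 * r * (norm (q m) * (1/2) ^ mdeg m))"
    proof (rule sum_mono)
      fix m
      show "norm (q m) * r ^ mdeg m \<le> 2 * r * (norm (q m) * (1/2) ^ mdeg m)"
      proof (cases "mdeg m")
        case 0
        then show ?thesis using q0 r by (simp add: mdeg_eq_0_iff)
      next
        case (Suc k)
        have "r ^ k \<le> (1/2) ^ k" using r by (intro power_mono) auto
        then have "r * norm (q m) * r ^ k \<le> r * norm (q m) * (1/2) ^ k" using r by (intro mult_left_mono) auto
        then show ?thesis by (simp add: Suc mult_ac)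
      qed
    qed
    also have "\<dots> = 2 * r * (\<Sum>m\<in>F. norm (q m) * (1/2) ^ mdeg m)" by (simp add: sum_distrib_left)
    also have "\<dots> \<le> 2 * r * K" using r by (intro mult_left_mono majorizedD[OF K F]) auto
    finally show "(\<Sum>m\<in>F. norm (q m) * r ^ mdeg m) \<le> R" using rK by simp
  qed
  define y where "y m = z0 *\<^sub>R q m - wdot lam m *\<^sub>R q m + Ncoef n q m" for m
  \<comment> \<open>The family \<open>b\<close> gives the coefficients of the same function computed
    through the resolvent; they lie in \<open>D\<close> by construction.\<close>
  define b where "b m = Res z0 (y m)" for m
  have b: "((\<lambda>m. monom_at m \<theta> *\<^sub>R b m) has_sum Q \<theta>) UNIV" if \<theta>: "\<And>j. \<bar>\<theta> $ j\<bar> < r" for \<theta>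
  proof -
    have "\<bar>\<theta> $ j\<bar> < 1" for j using \<theta>[of j] r by linarith
    then have \<theta>B: "\<theta> \<in> B1" by (simp add: B1_def)
    have \<theta>': "\<And>j. \<bar>\<theta> $ j\<bar> \<le> r" using \<theta> by (simp add: less_imp_le)
    have "(Q has_derivative (\<lambda>v. \<Sum>\<^sub>\<infinity>m. dmonom m \<theta> v *\<^sub>R q m)) (at \<theta>)"
      by (rule has_derivative_transform_within_open[OF pser_has_derivative(1)[OF mq \<theta>] open_B1 \<theta>B]) (simp add: Qp)
    then have dQ: "(Q has_derivative frechet_derivative Q (at \<theta>)) (at \<theta>)"
      using frechet_derivative_works differentiable_def by blast
    have 1: "((\<lambda>m. monom_at m \<theta> *\<^sub>R (wdot lam m *\<^sub>R q m)) has_sum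
        frechet_derivative Q (at \<theta>) (diag_matrix lam *v \<theta>)) UNIV"
      unfolding wdot_def by (rule pser_derivative_diag[OF mq \<theta> dQ open_B1 \<theta>B Qp])
    have 2: "((\<lambda>m. monom_at m \<theta> *\<^sub>R Ncoef n q m) has_sum N_fun n (Q \<theta>)) UNIV"
      using pser_has_sum[OF majorized_Ncoef[OF mq less_imp_le[OF r(1)] N_sum] \<theta>'] pser_Ncoef[OF mq \<theta>' N_sum q0] Qp[OF \<theta>B]
      by simp
    have inv: "Q \<theta> \<in> D" "A (Q \<theta>) + N_fun n (Q \<theta>) = frechet_derivative Q (at \<theta>) (diag_matrix lam *v \<theta>)"
      using Q \<theta>B by (auto simp: unstable_parameterization_def invariance_equation_def F_fun_def)
    have "((\<lambda>m. monom_at m \<theta> *\<^sub>R y m) has_sum (z0 *\<^sub>R Q \<theta> - A (Q \<theta>))) UNIV"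
    proof -
      have "((\<lambda>m. z0 *\<^sub>R (monom_at m \<theta> *\<^sub>R q m) - (monom_at m \<theta> *\<^sub>R (wdot lam m *\<^sub>R q m) - monom_at m \<theta> *\<^sub>R Ncoef n q m))
        has_sum (z0 *\<^sub>R Q \<theta> - (frechet_derivative Q (at \<theta>) (diag_matrix lam *v \<theta>) - N_fun n (Q \<theta>)))) UNIV"
        by (intro has_sum_diff has_sum_scaleR q[OF \<theta>B] 1 2)
      moreover have "frechet_derivative Q (at \<theta>) (diag_matrix lam *v \<theta>) - N_fun n (Q \<theta>) = A (Q \<theta>)"
        using inv(2) by (simp add: algebra_simps)
      moreover have "z0 *\<^sub>R (monom_at m \<theta> *\<^sub>R q m) - (monom_at m \<theta> *\<^sub>R (wdot lam m *\<^sub>R q m) - monom_at m \<theta> *\<^sub>R Ncoef n q m)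
          = monom_at m \<theta> *\<^sub>R y m" for m
        by (simp add: y_def algebra_simps)
      ultimately show ?thesis by simp
    qed
    from has_sum_bounded_linear[OF Res(1)[OF z0] this]
    show ?thesis
      using Res(4)[OF z0 inv(1)]
      by (simp add: b_def linear_scale[OF bounded_linear.linear[OF Res(1)[OF z0]]])
  qed
  have "\<exists>L. majorized b (r/4) L"
  proof -
    have "((\<lambda>m. monom_at m (\<chi> j. r/2) *\<^sub>R b m) has_sum Q (\<chi> j. r/2)) UNIV"
      using r by (intro b) auto
    then obtain C where "\<And>m. norm (monom_at m (\<chi> j. r/2) *\<^sub>R b m) \<le> C" using has_sum_term_bounded by blast
    then have "norm (b m) * (r/2) ^ mdeg m \<le> C" for m
      using r by (simp add: monom_at_const abs_mult mult.commute)
    then show ?thesis by (rule majorized_of_bounded) (use r in auto)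
  qed
  then obtain L where L: "majorized b (r/4) L" by blast
  have bq: "b m = q m" for m
  proof (rule pser_coeff_unique[OF L majorized_mono[OF mq _ _ order_refl order_refl]])
    show "pser b \<theta> = pser q \<theta>" if \<theta>: "\<And>j. \<bar>\<theta> $ j\<bar> \<le> r/4" for \<theta>
    proof -
      have \<theta>': "\<bar>\<theta> $ j\<bar> < r" for j using \<theta>[of j] r by linarith
      have "\<bar>\<theta> $ j\<bar> < 1" for j using \<theta>'[of j] r by linarith
      then have "\<theta> \<in> B1" by (simp add: B1_def)
      then show ?thesis using pser_eqI[OF b[OF \<theta>']] Qp by simp
    qed
  qed (use r in auto)
  \<comment> \<open>Equality with \<open>b\<close> puts \<open>q m\<close> into the range of the
    resolvent. Applying \<open>z0 - A\<close> to \<open>q m = Res z0 (y m)\<close> cancels the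
    \<open>z0\<close> terms and leaves the homological equation.\<close>
  have qD: "q m \<in> D" and qA: "A (q m) = wdot lam m *\<^sub>R q m - Ncoef n q m" for m
    using Res(2,3)[OF z0, of "y m"] bq[of m] by (auto simp: b_def y_def algebra_simps)
  have "q m = scoef s m" for m
  proof (induction "mdeg m" arbitrary: m rule: less_induct)
    case less
    consider "mdeg m = 0" | "mdeg m = 1" | "2 \<le> mdeg m" by linarith
    then show ?case
    proof cases
      case 1
      then show ?thesis using q0 scoef_zero by (simp add: mdeg_eq_0_iff)
    next
      case 2
      then obtain j where "m = unit_index j" by (rule mdeg_eq_1D)
      then show ?thesis by (simp add: q1 scoef_unit)
    next
      case 3
      have "Ncoef n q m = Ncoef n (scoef s) m"
        using less q0 scoef_zero by (intro Ncoef_cong) auto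
      then show ?thesis
        using Res_wdot(3)[OF 3 qD[of m]] Res_wdot(3)[OF 3 scoef_dom[of s m]] by (simp add: qA scoef_eq)
    qed
  qed
  then have "q = scoef s" by blast
  then show ?thesis using Qp[OF \<theta>] by simp
qed

end

section \<open>Backward decay and the linear flow\<close>

lemma right_difference_quotient:
  fixes f :: "real \<Rightarrow> 'a::real_normed_vector"
  assumes "(f has_vector_derivative f') (at s)"
  shows "((\<lambda>h. (f (s + h) - f s) /\<^sub>R h) \<longlongrightarrow> f') (at_right 0)"
proof -
  have "((\<lambda>h. norm (f (s + h) - f s - h *\<^sub>R f') / norm h) \<longlongrightarrow> 0) (at 0)"
    using assms by (simp add: has_vector_derivative_def has_derivative_at)
  then have "((\<lambda>h. norm (f (s + h) - f s - h *\<^sub>R f') / norm h) \<longlongrightarrow> 0) (at_right 0)"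
    by (rule tendsto_mono[OF at_le, rotated]) simp
  then have "((\<lambda>h. norm ((f (s + h) - f s) /\<^sub>R h - f')) \<longlongrightarrow> 0) (at_right 0)"
  proof (rule Lim_transform_eventually)
    show "\<forall>\<^sub>F h in at_right 0. norm (f (s + h) - f s - h *\<^sub>R f') / norm h = norm ((f (s + h) - f s) /\<^sub>R h - f')"
      using eventually_at_right_less[of "0::real"]
    proof eventually_elim
      case (elim h)
      have "(f (s + h) - f s) /\<^sub>R h - f' = (f (s + h) - f s - h *\<^sub>R f') /\<^sub>R h"
        using elim by (simp add: scaleR_right_diff_distrib)
      then show ?case using elim by (simp add: divide_inverse mult.commute)
    qed
  qed
  from LIM_zero_cancel[OF tendsto_norm_zero_cancel[OF this]] show ?thesis .
qed

text \<open>After a tilt by a small slope, the last time at which the function does not exceed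
  \<open>g a\<close> cannot lie before \<open>b\<close>, because the one-sided bound extends it to
  the right.\<close>

lemma right_Dini_nonpos_imp_le:
  fixes g :: "real \<Rightarrow> real"
  assumes ab: "a \<le> b" and g: "continuous_on {a..b} g"
    and dini: "\<And>s \<epsilon>. a \<le> s \<Longrightarrow> s < b \<Longrightarrow> 0 < \<epsilon> \<Longrightarrow> \<forall>\<^sub>F h in at_right 0. g (s + h) \<le> g s + \<epsilon> * h"
  shows "g b \<le> g a"
proof (rule field_le_epsilon)
  fix e :: real assume e: "0 < e"
  \<comment> \<open>The denominator exceeds the length of the interval, so the tilt costs at most
    \<open>e\<close>, also for \<open>a = b\<close>.\<close>
  define \<epsilon> where "\<epsilon> = e / (b - a + 1)"
  have \<epsilon>: "0 < \<epsilon>" using e ab by (simp add: \<epsilon>_def)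
  define \<phi> where "\<phi> t = g t - \<epsilon> * (t - a)" for t
  have "\<phi> b \<le> g a"
  proof (rule ccontr)
    assume nb: "\<not> \<phi> b \<le> g a"
    define Z where "Z = {t \<in> {a..b}. \<phi> t \<le> g a}"
    have cont: "continuous_on {a..b} \<phi>"
    proof -
      have "continuous_on {a..b} (\<lambda>t. g t - \<epsilon> * (t - a))"
        by (rule continuous_on_diff[OF g]) (intro continuous_intros)
      then show ?thesis by (simp add: \<phi>_def[abs_def])
    qed
    have "closed Z" unfolding Z_def by (rule continuous_on_closed_Collect_le[OF cont continuous_on_const]) simp
    moreover have "bounded Z" unfolding Z_def by (rule bounded_subset[OF bounded_closed_interval[of a b]]) auto
    ultimately have "compact Z" by (simp add: compact_eq_bounded_closed)
    moreover have "a \<in> Z" using ab by (simp add: Z_def \<phi>_def)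
    then have "Z \<noteq> {}" by blast
    ultimately obtain s where s: "s \<in> Z" and s_max: "\<forall>t\<in>Z. t \<le> s"
      using compact_attains_sup[of Z] by blast
    have sb: "a \<le> s" "s < b" "\<phi> s \<le> g a" using s nb by (auto simp: Z_def less_le)
    have "\<forall>\<^sub>F h in at_right 0. h < b - s" using sb by (intro eventually_at_rightI[of 0 "b - s"]) auto
    with dini[OF sb(1,2) \<epsilon>] eventually_at_right_less[of "0::real"]
    have "\<forall>\<^sub>F h in at_right (0::real). False"
    proof eventually_elim
      case (elim h)
      have "\<phi> (s + h) \<le> \<phi> s" using elim by (simp add: \<phi>_def algebra_simps)
      then have "s + h \<in> Z" using elim sb by (simp add: Z_def)
      then show False using s_max elim by fastforce
    qed
    then show False by simp
  qed
  moreover have "\<epsilon> * (b - a) \<le> e"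
  proof -
    have "\<epsilon> * (b - a) \<le> \<epsilon> * (b - a + 1)" using \<epsilon> by simp
    also have "\<dots> = e" using ab by (simp add: \<epsilon>_def)
    finally show ?thesis .
  qed
  ultimately show "g b \<le> g a + e" by (simp add: \<phi>_def)
qed

lemma exp_scaled_at_bot: "0 < c \<Longrightarrow> ((\<lambda>a::real. exp (c * a) * B) \<longlongrightarrow> 0) at_bot" for c :: real
proof -
  assume c: "0 < c"
  have "filterlim (\<lambda>a::real. c * a) at_bot at_bot"
    using filterlim_tendsto_pos_mult_at_bot[OF tendsto_const c filterlim_ident] .
  then have "((\<lambda>a::real. exp (c * a)) \<longlongrightarrow> 0) at_bot" by (rule filterlim_compose[OF exp_at_bot])
  from tendsto_mult_right[OF this, of B] show ?thesis by simp
qed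

text \<open>The weight \<open>exp (c * t)\<close> cancels the decay, so the weighted function is
  nonincreasing. Comparing time 0 with time \<open>a\<close> gives
  \<open>f 0 \<le> exp (c * a) * B\<close>, which tends to 0 as \<open>a\<close> goes to minus
  infinity.\<close>

lemma backward_bounded_decay_zero:
  fixes f :: "real \<Rightarrow> real"
  assumes f: "continuous_on {..0} f" and B: "\<And>t. t \<le> 0 \<Longrightarrow> f t \<le> B" and c: "0 < c"
    and dini: "\<And>s \<epsilon>. s < 0 \<Longrightarrow> 0 < \<epsilon> \<Longrightarrow> \<forall>\<^sub>F h in at_right 0. f (s + h) \<le> f s * (1 - c * h) + \<epsilon> * h"
    and nonneg: "\<And>t. t \<le> 0 \<Longrightarrow> 0 \<le> f t"
  shows "f 0 = 0"
proof -
  have "f 0 \<le> exp (c * a) * B" if a: "a < 0" for a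
  proof -
    define g where "g t = exp (c * t) * f t" for t
    have cont: "continuous_on {a..0} g"
      unfolding g_def[abs_def]
      by (intro continuous_on_mult continuous_on_exp continuous_on_const continuous_on_id continuous_on_subset[OF f]) auto
    have "\<forall>\<^sub>F h in at_right 0. g (s + h) \<le> g s + \<epsilon> * h"
      if s: "a \<le> s" "s < 0" and \<epsilon>: "0 < \<epsilon>" for s \<epsilon>
    proof -
      have "\<forall>\<^sub>F h in at_right 0. h < - s" using s by (intro eventually_at_rightI[of 0 "- s"]) auto
      with dini[OF s(2) \<epsilon>] eventually_at_right_less[of "0::real"] show ?thesis
      proof eventually_elim
        case (elim h)
        have "g (s + h) \<le> exp (c * (s + h)) * (f s * (1 - c * h) + \<epsilon> * h)"
          unfolding g_def using elim by (intro mult_left_mono) auto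
        also have "\<dots> = exp (c * (s + h)) * (1 - c * h) * f s + exp (c * (s + h)) * (\<epsilon> * h)"
          by (simp add: algebra_simps)
        also have "\<dots> \<le> exp (c * s) * f s + \<epsilon> * h"
        proof -
          have "1 - c * h \<le> exp (- (c * h))" using exp_ge_add_one_self[of "- (c * h)"] by simp
          then have "exp (c * (s + h)) * (1 - c * h) \<le> exp (c * (s + h)) * exp (- (c * h))"
            by (intro mult_left_mono) auto
          also have "\<dots> = exp (c * s)" by (simp add: exp_add[symmetric] distrib_left)
          finally have 1: "exp (c * (s + h)) * (1 - c * h) * f s \<le> exp (c * s) * f s"
            by (rule mult_right_mono) (use s nonneg[of s] in simp)
          have "c * (s + h) \<le> 0" using c elim by (intro mult_nonneg_nonpos) auto
          then have "exp (c * (s + h)) * (\<epsilon> * h) \<le> 1 * (\<epsilon> * h)"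
            using \<epsilon> elim by (intro mult_right_mono) auto
          with 1 show ?thesis by simp
        qed
        finally show ?case by (simp add: g_def)
      qed
    qed
    then have "g 0 \<le> g a" using cont a by (intro right_Dini_nonpos_imp_le[of a 0 g]) simp_all
    also have "\<dots> \<le> exp (c * a) * B" unfolding g_def using B[of a] a by (intro mult_left_mono) auto
    finally show ?thesis by (simp add: g_def)
  qed
  then have "\<forall>\<^sub>F a in at_bot. f 0 \<le> exp (c * a) * B"
    unfolding eventually_at_bot_dense by blast
  then have "f 0 \<le> 0"
    by (rule tendsto_lowerbound[OF exp_scaled_at_bot[OF c]]) simp
  then show ?thesis using nonneg[of 0] by simp
qed

section \<open>The linear flow in parameter space\<close>

definition diag_flow :: "('d::finite \<Rightarrow> real) \<Rightarrow> real \<Rightarrow> real ^ 'd \<Rightarrow> real ^ 'd" where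
  "diag_flow lam t y = (\<chi> j. exp (lam j * t) * y $ j)"

lemma diag_matrix_nth: "(diag_matrix lam *v y) $ j = lam j * y $ j"
  by (simp add: diag_matrix_def matrix_vector_mult_def if_distrib[of "\<lambda>x. x * _"] cong: if_cong)

lemma diag_flow_sum: "diag_flow lam t y = (\<Sum>j\<in>UNIV. (exp (lam j * t) * y $ j) *\<^sub>R axis j 1)"
  by (simp add: diag_flow_def vec_eq_iff axis_def if_distrib cong: if_cong)

lemma diag_flow_derivative:
  "((\<lambda>t. diag_flow lam t y) has_vector_derivative (diag_matrix lam *v diag_flow lam t y)) (at t)"
proof -
  have "((\<lambda>t. \<Sum>j\<in>UNIV. (exp (lam j * t) * y $ j) *\<^sub>R (axis j 1 :: real ^ 'a)) has_vector_derivative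
      (\<Sum>j\<in>UNIV. (lam j * exp (lam j * t) * y $ j) *\<^sub>R axis j 1)) (at t)"
    by (intro has_vector_derivative_sum) (auto intro!: derivative_eq_intros)
  moreover have "(\<Sum>j\<in>UNIV. (lam j * exp (lam j * t) * y $ j) *\<^sub>R (axis j 1 :: real ^ 'a)) = diag_matrix lam *v diag_flow lam t y"
    by (simp add: vec_eq_iff diag_matrix_nth) (simp add: diag_flow_def axis_def if_distrib cong: if_cong)
  ultimately show ?thesis unfolding diag_flow_sum by simp
qed

lemma diag_flow_0 [simp]: "diag_flow lam 0 y = y"
  by (simp add: diag_flow_def vec_eq_iff)

lemma abs_diag_flow_le:
  assumes "\<And>j. 0 < lam j" "t \<le> 0"
  shows "\<bar>diag_flow lam t y $ j\<bar> \<le> \<bar>y $ j\<bar>"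
  using assms(1)[of j] assms(2) by (simp add: diag_flow_def abs_mult mult_left_le_one_le mult_le_0_iff)

lemma diag_flow_at_bot:
  assumes "\<And>j. 0 < lam j"
  shows "((\<lambda>t. diag_flow lam t y) \<longlongrightarrow> 0) at_bot"
proof (rule vec_tendstoI)
  fix j
  have "((\<lambda>t. exp (lam j * t) * y $ j) \<longlongrightarrow> 0) at_bot" by (rule exp_scaled_at_bot[OF assms])
  then show "((\<lambda>t. diag_flow lam t y $ j) \<longlongrightarrow> 0 $ j) at_bot" by (simp add: diag_flow_def)
qed

section \<open>Backward solutions lie on the graph\<close>

lemma B1_mult_box:
  assumes "\<And>j. s j \<noteq> 0"
  shows "(\<lambda>\<theta> :: real ^ 'd::finite. \<chi> j. s j * \<theta> $ j) ` B1 = {y. \<forall>j. \<bar>y $ j\<bar> < \<bar>s j\<bar>}"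
proof
  show "(\<lambda>\<theta> :: real ^ 'd. \<chi> j. s j * \<theta> $ j) ` B1 \<subseteq> {y. \<forall>j. \<bar>y $ j\<bar> < \<bar>s j\<bar>}"
    using assms by (auto simp: B1_def abs_mult mult_less_cancel_left2)
  show "{y. \<forall>j. \<bar>y $ j\<bar> < \<bar>s j\<bar>} \<subseteq> (\<lambda>\<theta> :: real ^ 'd. \<chi> j. s j * \<theta> $ j) ` B1"
  proof
    fix y :: "real ^ 'd" assume y: "y \<in> {y. \<forall>j. \<bar>y $ j\<bar> < \<bar>s j\<bar>}"
    then have "(\<chi> j. y $ j / s j) \<in> B1" using assms by (simp add: B1_def abs_divide)
    moreover have "y = (\<chi> j. s j * (\<chi> j. y $ j / s j) $ j)" using assms by (simp add: vec_eq_iff)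
    ultimately show "y \<in> (\<lambda>\<theta>. \<chi> j. s j * \<theta> $ j) ` B1" by blast
  qed
qed

context split_operator begin

text \<open>In the coordinates \<open>cc\<close> the chart is the identity plus a remainder with
  Lipschitz constant at most \<open>1 / 2\<close>. Hence distances shrink at most by the factor 2,
  and parameters can be recovered from unstable coordinates with Lipschitz dependence.\<close>

lemma chart_estimates:
  obtains \<delta> \<rho> t L C1 where "\<delta> > 0" "\<rho> \<le> R" "majorized coef \<delta> \<rho>" "t > 0" "t \<le> \<delta> / 2" "L > 0" "C1 > 0"
    "\<And>x. norm (cc x) \<le> C1 * norm x"
    "\<And>y y'. (\<And>j. \<bar>y $ j\<bar> \<le> t) \<Longrightarrow> (\<And>j. \<bar>y' $ j\<bar> \<le> t) \<Longrightarrow>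
      norm (pser coef y - pser coef y') \<le> L * norm (y - y')"
    "\<And>y y'. (\<And>j. \<bar>y $ j\<bar> \<le> t) \<Longrightarrow> (\<And>j. \<bar>y' $ j\<bar> \<le> t) \<Longrightarrow>
      norm (y - y') \<le> 2 * norm (cc (pser coef y) - cc (pser coef y'))"
proof -
  obtain \<delta> \<rho> where c: "\<delta> > 0" "\<rho> > 0" "\<rho> \<le> R" "majorized coef \<delta> \<rho>" using coef_majorized by blast
  obtain C1 where C1: "C1 > 0" "\<And>y. norm (cc y) \<le> norm y * C1"
    using bounded_linear.pos_bounded[OF cc_bl] by blast
  define C where "C = 2 * \<rho> / \<delta>\<^sup>2"
  have C: "C > 0" unfolding C_def using c by simp
  \<comment> \<open>The second entry makes the Lipschitz constant \<open>C1 * C * t\<close> of the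
    projected remainder at most \<open>1 / 2\<close>; the first is needed for the remainder estimate
    itself.\<close>
  define t where "t = min (\<delta> / 2) (1 / (2 * C1 * C))"
  have t: "t > 0" "t \<le> \<delta> / 2" using c C C1 by (auto simp: t_def)
  have tC: "C1 * (C * t) \<le> 1 / 2"
  proof -
    have "C1 * C * t \<le> C1 * C * (1 / (2 * C1 * C))" using C C1 by (intro mult_left_mono) (auto simp: t_def)
    also have "\<dots> = 1 / 2" using C C1 by simp
    finally show ?thesis by (simp add: mult.assoc)
  qed
  define g where "g = (\<lambda>m. if mdeg m \<le> 1 then 0 else coef m)"
  have g: "majorized g \<delta> \<rho>" unfolding g_def by (rule majorized_mono[OF c(4)]) (use c in auto)
  define E where "E = (\<Sum>j\<in>UNIV. norm (\<xi> j))"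
  have E: "0 \<le> E" unfolding E_def by (intro sum_nonneg) auto
  have G: "pser coef y = (\<Sum>j\<in>UNIV. y $ j *\<^sub>R \<xi> j) + pser g y" if "\<And>j. \<bar>y $ j\<bar> \<le> t" for y
  proof -
    have "\<bar>y $ j\<bar> \<le> \<delta>" for j using that[of j] t c(1) by linarith
    from pser_linear_part[OF c(4) coef_zero this] show ?thesis by (simp add: g_def coef_unit)
  qed
  have H: "norm (pser g y - pser g y') \<le> C * t * norm (y - y')"
    if "\<And>j. \<bar>y $ j\<bar> \<le> t" "\<And>j. \<bar>y' $ j\<bar> \<le> t" for y y'
    unfolding C_def by (rule pser_remainder_lipschitz[OF g c(1) _ t(2)]) (use that in \<open>auto simp: g_def\<close>)
  show thesis
  proof (rule that[OF c(1,3,4) t _ C1(1)])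
    show "E + C * t > 0" using E C t by (intro add_nonneg_pos) auto
    show "norm (cc x) \<le> C1 * norm x" for x using C1(2)[of x] by (simp add: mult.commute)
    fix y y' :: "real ^ 'd" assume y: "\<And>j. \<bar>y $ j\<bar> \<le> t" and y': "\<And>j. \<bar>y' $ j\<bar> \<le> t"
    have d: "pser coef y - pser coef y' = (\<Sum>j\<in>UNIV. (y - y') $ j *\<^sub>R \<xi> j) + (pser g y - pser g y')"
      unfolding G[OF y] G[OF y'] by (simp add: scaleR_left_diff_distrib sum_subtractf)
    have "norm (\<Sum>j\<in>UNIV. (y - y') $ j *\<^sub>R \<xi> j) \<le> (\<Sum>j\<in>UNIV. norm (y - y') * norm (\<xi> j))"
    proof (intro order_trans[OF norm_sum] sum_mono)
      show "norm ((y - y') $ j *\<^sub>R \<xi> j) \<le> norm (y - y') * norm (\<xi> j)" for j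
        using mult_right_mono[OF component_le_norm_cart norm_ge_zero, of "y - y'" j] by simp
    qed
    also have "\<dots> = E * norm (y - y')" by (simp add: E_def sum_distrib_left mult.commute)
    finally have "norm (pser coef y - pser coef y') \<le> E * norm (y - y') + C * t * norm (y - y')"
      unfolding d using H[OF y y'] by (intro order_trans[OF norm_triangle_ineq] add_mono)
    then show "norm (pser coef y - pser coef y') \<le> (E + C * t) * norm (y - y')" by (simp add: distrib_right)
    have "cc (pser coef y) - cc (pser coef y') = cc (\<Sum>j\<in>UNIV. (y - y') $ j *\<^sub>R \<xi> j) + cc (pser g y - pser g y')"
      unfolding cc_diff[symmetric] d by (rule linear_add[OF bounded_linear.linear[OF cc_bl]])
    also have "cc (\<Sum>j\<in>UNIV. (y - y') $ j *\<^sub>R \<xi> j) = y - y'" unfolding cc_sum_xi by (simp add: vec_eq_iff)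
    finally have e: "y - y' = (cc (pser coef y) - cc (pser coef y')) - cc (pser g y - pser g y')" by simp
    have "norm (cc (pser g y - pser g y')) \<le> C1 * (C * t * norm (y - y'))"
    proof -
      have "norm (pser g y - pser g y') * C1 \<le> C * t * norm (y - y') * C1"
        using C1(1) by (intro mult_right_mono[OF H[OF y y']]) simp
      with C1(2)[of "pser g y - pser g y'"] show ?thesis by (simp add: mult_ac)
    qed
    also have "\<dots> = C1 * (C * t) * norm (y - y')" by simp
    also have "\<dots> \<le> 1 / 2 * norm (y - y')" using tC by (rule mult_right_mono) simp
    finally show "norm (y - y') \<le> 2 * norm (cc (pser coef y) - cc (pser coef y'))"
      using norm_triangle_ineq4[of "cc (pser coef y) - cc (pser coef y')" "cc (pser g y - pser g y')"] e by simp
  qed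
qed

text \<open>The invariance equation says that \<open>pser coef\<close> carries the linear field to
  \<open>F\<close>, so it maps linear trajectories to solutions as long as they stay in the box of
  convergence.\<close>

lemma chart_derivative:
  assumes c: "majorized coef \<delta> \<rho>" "\<rho> \<le> R" and y: "\<And>j. \<bar>y $ j\<bar> < \<delta>"
    and fl: "diag_flow lam t w = y"
  shows "((\<lambda>t. pser coef (diag_flow lam t w)) has_vector_derivative F_fun A n (pser coef (diag_flow lam t w))) (at t)"
proof -
  have "(pser coef has_derivative frechet_derivative (pser coef) (at y)) (at y)"
    using pser_has_derivative(1)[OF c(1) y] frechet_derivative_works differentiable_def by blast
  then have 1: "(pser coef has_derivative frechet_derivative (pser coef) (at y)) (at (diag_flow lam t w))"
    using fl by simp
  have "((\<lambda>t. diag_flow lam t w) has_derivative (\<lambda>h. h *\<^sub>R (diag_matrix lam *v y))) (at t)"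
    using diag_flow_derivative[of lam w t] fl by (simp add: has_vector_derivative_def)
  from has_derivative_compose[OF this 1]
  have "((\<lambda>t. pser coef (diag_flow lam t w)) has_derivative
      (\<lambda>h. frechet_derivative (pser coef) (at y) (h *\<^sub>R (diag_matrix lam *v y)))) (at t)" .
  then have "((\<lambda>t. pser coef (diag_flow lam t w)) has_vector_derivative
      frechet_derivative (pser coef) (at y) (diag_matrix lam *v y)) (at t)"
    using linear_scale[OF has_derivative_linear[OF 1]] by (simp add: has_vector_derivative_def)
  then show ?thesis
    using pser_invariance(3)[OF c y coef_zero coef_dom coef_eq] fl by simp
qed

text \<open>Along a backward solution \<open>x\<close>, the deviation \<open>z = x - P(y)\<close> from the point of the graph with the
  same unstable coordinates decays in forward time, up to the nonlinear terms. Being bounded for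
  all negative times, it vanishes. Only one-sided difference quotients of \<open>z\<close> are available,
  because \<open>S\<close> is merely a semigroup.\<close>

lemma backward_solution_in_graph:
  assumes c: "majorized coef \<delta> \<rho>" "\<rho> \<le> R" and t0: "0 < t0" "t0 \<le> \<delta> / 2"
    and C1: "C1 > 0" "\<And>x. norm (cc x) \<le> C1 * norm x" and L: "L > 0"
    and lip: "\<And>y y'. (\<And>j. \<bar>y $ j\<bar> \<le> t0) \<Longrightarrow> (\<And>j. \<bar>y' $ j\<bar> \<le> t0) \<Longrightarrow>
      norm (pser coef y - pser coef y') \<le> L * norm (y - y')"
    and expand: "\<And>y y'. (\<And>j. \<bar>y $ j\<bar> \<le> t0) \<Longrightarrow> (\<And>j. \<bar>y' $ j\<bar> \<le> t0) \<Longrightarrow>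
      norm (y - y') \<le> 2 * norm (cc (pser coef y) - cc (pser coef y'))"
    and r: "r \<le> R / 2"
    and LN: "LN > 0" "\<And>x y. norm x \<le> r \<Longrightarrow> norm y \<le> r \<Longrightarrow> norm (N_fun n x - N_fun n y) \<le> LN * r * norm (x - y)"
    and small: "M * (1 + L * (2 * C1)) * (LN * r) \<le> \<mu> / 4"
    and x: "\<And>t. t \<le> 0 \<Longrightarrow> (x has_vector_derivative F_fun A n (x t)) (at t within {..0})"
      "\<And>t. t \<le> 0 \<Longrightarrow> x t \<in> D" "\<And>t. t \<le> 0 \<Longrightarrow> norm (x t) \<le> r"
    and y: "\<And>t j. t \<le> 0 \<Longrightarrow> \<bar>y t $ j\<bar> < t0" "\<And>t. t \<le> 0 \<Longrightarrow> cc (pser coef (y t)) = cc (x t)"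
      "\<And>t. t \<le> 0 \<Longrightarrow> norm (pser coef (y t)) \<le> r"
  shows "x 0 = pser coef (y 0)"
proof -
  let ?G = "pser coef"
  define z where "z t = x t - ?G (y t)" for t
  define K where "K = 1 + L * (2 * C1)"
  have K: "K \<ge> 1" unfolding K_def using L C1 by simp
  have yd: "\<bar>y t $ j\<bar> < \<delta>" if "t \<le> 0" for t j using y(1)[OF that, of j] t0 by linarith
  have ye: "\<bar>y t $ j\<bar> \<le> t0" if "t \<le> 0" for t j using y(1)[OF that, of j] by simp
  have GD: "?G (y t) \<in> D" if "t \<le> 0" for t
    by (rule pser_invariance(1)[OF c yd[OF that] coef_zero coef_dom coef_eq])
  have zX: "z t \<in> Xs" if "t \<le> 0" for t
    unfolding z_def cc_Xs[symmetric] using y(2)[OF that] by (simp add: cc_diff)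
  have zD: "z t \<in> D" if "t \<le> 0" for t
    unfolding z_def by (intro subspace_diff[OF D_sub] x GD that)
  \<comment> \<open>The parameters \<open>y\<close> are recovered from the unstable coordinates of
    \<open>x\<close> through \<open>expand\<close>, so \<open>z\<close> inherits its continuity from
    \<open>x\<close>.\<close>
  have z_lip: "norm (z t - z t') \<le> K * norm (x t - x t')" if "t \<le> 0" "t' \<le> 0" for t t'
  proof -
    have "norm (y t - y t') \<le> 2 * norm (cc (x t - x t'))"
      using expand[OF ye ye, OF that] y(2) that by (simp add: cc_diff)
    also have "\<dots> \<le> 2 * (C1 * norm (x t - x t'))" using C1(2) by simp
    finally have "L * norm (y t - y t') \<le> L * (2 * (C1 * norm (x t - x t')))"
      by (rule mult_left_mono) (use L in simp)
    with lip[OF ye ye, OF that] have "norm (?G (y t) - ?G (y t')) \<le> L * (2 * (C1 * norm (x t - x t')))"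
      by (rule order_trans)
    then show ?thesis
      unfolding z_def K_def using norm_triangle_ineq4[of "x t - x t'" "?G (y t) - ?G (y t')"]
      by (simp add: algebra_simps)
  qed
  define f where "f t = ns (z t)" for t
  have f_nonneg: "0 \<le> f t" if "t \<le> 0" for t
    unfolding f_def using order_trans[OF norm_ge_zero norm_le_ns[OF zX[OF that]]] .
  have f_lip: "f t \<le> f t' + M * (K * norm (x t - x t'))" if "t \<le> 0" "t' \<le> 0" for t t'
  proof -
    have d: "z t - z t' \<in> Xs" by (intro subspace_diff[OF Xs_sub] zX that)
    have "f t \<le> ns (z t') + ns (z t - z t')"
      unfolding f_def using ns_add_le[OF zX[OF that(2)] d] by simp
    also have "ns (z t - z t') \<le> M * (K * norm (x t - x t'))"
      using ns_le_norm[OF d] mult_left_mono[OF z_lip[OF that], of M] M_pos by linarith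
    finally show ?thesis by (simp add: f_def)
  qed
  have x_cont: "continuous_on {..0} x"
    unfolding continuous_on_eq_continuous_within using x(1) has_vector_derivative_continuous by blast
  have f_cont: "continuous_on {..0} f"
    unfolding continuous_on_iff
  proof (intro ballI allI impI)
    fix t e :: real assume t: "t \<in> {..0}" and e: "0 < e"
    have MK: "M * K > 0" using M_pos K by simp
    then have "0 < e / (M * K)" using e by simp
    then obtain d where d: "d > 0" "\<And>u. u \<in> {..0} \<Longrightarrow> dist u t < d \<Longrightarrow> dist (x u) (x t) < e / (M * K)"
      using x_cont t unfolding continuous_on_iff by meson
    show "\<exists>d>0. \<forall>u\<in>{..0}. dist u t < d \<longrightarrow> dist (f u) (f t) < e"
    proof (intro exI[of _ d] conjI ballI impI d(1))
      fix u assume u: "u \<in> {..0}" "dist u t < d"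
      have "M * (K * norm (x u - x t)) < e" using d(2)[OF u] MK by (simp add: dist_norm field_simps)
      then show "dist (f u) (f t) < e"
        using f_lip[of u t] f_lip[of t u] u(1) t by (simp add: dist_real_def abs_less_iff norm_minus_commute)
    qed
  qed
  have dini: "\<forall>\<^sub>F h in at_right 0. f (s + h) \<le> f s * (1 - \<mu> / 4 * h) + \<epsilon> * h" if s: "s < 0" and \<epsilon>: "0 < \<epsilon>" for s \<epsilon>
  proof -
    have s0: "s \<le> 0" using s by simp
    have MK: "M * K > 0" using M_pos K by simp
    \<comment> \<open>The comparison moves \<open>y s\<close> by the linear flow instead of
      following \<open>y (s + h)\<close>, whose differentiability is not known. The defect
      \<open>e\<close> is what \<open>x (s + h)\<close> differs by from this motion on the graph
      plus a stable semigroup step.\<close>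
    define X where "X h = ?G (diag_flow lam h (y s))" for h
    define e where "e h = x (s + h) - X h - S h (z s)" for h
    have "at s within {..0} = at s" using s by (intro at_within_interior) simp
    then have "(x has_vector_derivative F_fun A n (x s)) (at s)" using x(1)[OF s0] by simp
    then have lim_x: "((\<lambda>h. (x (s + h) - x s) /\<^sub>R h) \<longlongrightarrow> F_fun A n (x s)) (at_right 0)"
      by (rule right_difference_quotient)
    have lim_X: "((\<lambda>h. (X (0 + h) - X 0) /\<^sub>R h) \<longlongrightarrow> F_fun A n (?G (y s))) (at_right 0)"
      unfolding X_def using chart_derivative[OF c yd[OF s0], of 0 "y s"]
      by (intro right_difference_quotient) simp
    have "((\<lambda>h. (x (s + h) - x s) /\<^sub>R h - (X (0 + h) - X 0) /\<^sub>R h - (S h (z s) - z s) /\<^sub>R h)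
        \<longlongrightarrow> F_fun A n (x s) - F_fun A n (?G (y s)) - A (z s)) (at_right 0)"
      by (intro tendsto_diff lim_x lim_X S_derivative zD zX s0)
    moreover have "F_fun A n (x s) - F_fun A n (?G (y s)) - A (z s) = N_fun n (x s) - N_fun n (?G (y s))"
      unfolding z_def F_fun_def A_diff[OF x(2)[OF s0] GD[OF s0]] by simp
    moreover have "(x (s + h) - x s) /\<^sub>R h - (X (0 + h) - X 0) /\<^sub>R h - (S h (z s) - z s) /\<^sub>R h = e h /\<^sub>R h" for h
      by (simp add: e_def X_def z_def scaleR_right_diff_distrib[symmetric])
    ultimately have "((\<lambda>h. e h /\<^sub>R h) \<longlongrightarrow> N_fun n (x s) - N_fun n (?G (y s))) (at_right 0)"
      by (simp only:)
    then have "((\<lambda>h. norm (e h /\<^sub>R h)) \<longlongrightarrow> norm (N_fun n (x s) - N_fun n (?G (y s)))) (at_right 0)"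
      by (rule tendsto_norm)
    then have ev1: "\<forall>\<^sub>F h in at_right 0. norm (e h /\<^sub>R h) < norm (N_fun n (x s) - N_fun n (?G (y s))) + \<epsilon> / (M * K)"
      by (rule order_tendstoD(2)) (use \<epsilon> MK in simp)
    have "((\<lambda>h. diag_flow lam h (y s)) \<longlongrightarrow> diag_flow lam 0 (y s)) (at 0)"
      using has_vector_derivative_continuous[OF diag_flow_derivative[of lam "y s" 0]] unfolding continuous_at .
    then have "((\<lambda>h. diag_flow lam h (y s)) \<longlongrightarrow> y s) (at_right 0)"
      using tendsto_mono[OF at_le[of "{0<..}" UNIV "0::real"]] by simp
    then have ev2: "\<forall>\<^sub>F h in at_right 0. diag_flow lam h (y s) \<in> {w. \<forall>j. \<bar>w $ j\<bar> < t0}"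
      by (rule topological_tendstoD[OF _ open_box_set]) (use y(1)[OF s0] in simp)
    have ev3: "\<forall>\<^sub>F h in at_right 0. h < min (- s) (1 / \<mu>)"
      using s mu_pos by (intro eventually_at_rightI[of 0 "min (- s) (1 / \<mu>)"]) auto
    show ?thesis using ev1 ev2 ev3 eventually_at_right_less[of "0::real"]
    proof eventually_elim
      case (elim h)
      have h: "0 < h" "s + h \<le> 0" "\<mu> * h \<le> 1" using elim mu_pos by (auto simp: field_simps)
      have Sz: "S h (z s) \<in> Xs" using S_props(1) h zX[OF s0] by simp
      define w where "w = diag_flow lam h (y s)"
      have w: "\<bar>w $ j\<bar> \<le> t0" for j using elim(2) by (simp add: w_def less_imp_le)
      \<comment> \<open>In the limit the defect per unit time is the difference of \<open>N\<close>
        at the solution and at the graph point, and \<open>N\<close> has Lipschitz constant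
        \<open>LN * r\<close> there.\<close>
      have ne: "norm (e h) \<le> h * (LN * r * norm (z s) + \<epsilon> / (M * K))"
      proof -
        have "norm (e h) / h \<le> LN * r * norm (z s) + \<epsilon> / (M * K)"
          using elim(1) h(1) LN(2)[OF x(3)[OF s0] y(3)[OF s0]] by (simp add: z_def divide_inverse mult.commute)
        then show ?thesis using h(1) by (simp add: field_simps)
      qed
      \<comment> \<open>\<open>S h (z s)\<close> has no unstable coordinates, so only the defect
        separates \<open>w\<close> from the actual parameters \<open>y (s + h)\<close>.\<close>
      have "norm (w - y (s + h)) \<le> 2 * norm (cc (?G w) - cc (?G (y (s + h))))"
        by (rule expand[OF w ye[OF h(2)]])
      also have "cc (?G w) - cc (?G (y (s + h))) = - cc (e h)"
        using Sz y(2)[OF h(2)] cc_Xs by (simp add: e_def X_def w_def cc_diff)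
      also have "2 * norm (- cc (e h)) \<le> 2 * (C1 * norm (e h))" using C1(2) by simp
      finally have "L * norm (w - y (s + h)) \<le> L * (2 * (C1 * norm (e h)))"
        by (rule mult_left_mono) (use L in simp)
      with lip[OF w ye[OF h(2)]] have "norm (?G w - ?G (y (s + h))) \<le> L * (2 * (C1 * norm (e h)))"
        by (rule order_trans)
      then have "norm (z (s + h) - S h (z s)) \<le> K * norm (e h)"
        using norm_triangle_ineq[of "e h" "?G w - ?G (y (s + h))"]
        by (simp add: z_def e_def X_def w_def K_def algebra_simps)
      moreover have "M * (K * norm (e h)) \<le> M * K * (h * (LN * r * norm (z s) + \<epsilon> / (M * K)))"
        using mult_left_mono[OF ne, of "M * K"] MK by (simp add: mult.assoc)
      moreover have "M * K * (h * (LN * r * norm (z s) + \<epsilon> / (M * K))) = h * ((M * K * (LN * r)) * norm (z s)) + \<epsilon> * h"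
      proof -
        have "M * K * (\<epsilon> / (M * K)) = \<epsilon>" using M_pos K by simp
        then have "h * (M * K * (\<epsilon> / (M * K))) = \<epsilon> * h" by simp
        then show ?thesis by (simp only: distrib_left mult.assoc mult.left_commute)
      qed
      moreover have dX: "z (s + h) - S h (z s) \<in> Xs" by (intro subspace_diff[OF Xs_sub] zX h Sz)
      ultimately have 1: "ns (z (s + h) - S h (z s)) \<le> h * ((M * K * (LN * r)) * norm (z s)) + \<epsilon> * h"
        using ns_le_norm[OF dX] mult_left_mono[of "norm (z (s + h) - S h (z s))" "K * norm (e h)" M] M_pos by linarith
      have "M * K * (LN * r) * norm (z s) \<le> \<mu> / 4 * norm (z s)"
        using small by (intro mult_right_mono) (auto simp: K_def)
      also have "\<dots> \<le> \<mu> / 4 * f s" unfolding f_def using norm_le_ns[OF zX[OF s0]] mu_pos by (intro mult_left_mono) auto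
      finally have 2: "h * (M * K * (LN * r) * norm (z s)) \<le> h * (\<mu> / 4 * f s)"
        using h by (intro mult_left_mono) auto
      \<comment> \<open>Valid because \<open>\<mu> * h \<le> 1\<close>. Of the rate
        \<open>\<mu> / 2\<close> kept here the nonlinear terms consume \<open>\<mu> / 4\<close>,
        which leaves the claimed decay.\<close>
      have "1 / (1 + \<mu> * h) \<le> 1 - \<mu> / 2 * h"
      proof -
        have "(\<mu> * h) * (\<mu> * h) \<le> \<mu> * h * 1" using h mu_pos by (intro mult_left_mono) auto
        then have "1 \<le> (1 - \<mu> / 2 * h) * (1 + \<mu> * h)" by (simp add: algebra_simps)
        moreover have "0 < 1 + \<mu> * h" using h mu_pos by (simp add: add_pos_pos)
        ultimately show ?thesis by (simp add: divide_le_eq)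
      qed
      then have "f s * (1 / (1 + \<mu> * h)) \<le> f s * (1 - \<mu> / 2 * h)"
        using f_nonneg[OF s0] by (rule mult_left_mono)
      then have 3: "ns (S h (z s)) \<le> f s * (1 - \<mu> / 2 * h)"
        using ns_S_le'[OF zX[OF s0], of h] h by (simp add: f_def)
      have "f (s + h) \<le> ns (S h (z s)) + ns (z (s + h) - S h (z s))"
        unfolding f_def using ns_add_le[OF Sz dX] by simp
      then show ?case using 1 2 3 by (simp add: algebra_simps)
    qed
  qed
  have bound: "f t \<le> M * (r + r)" if "t \<le> 0" for t
  proof -
    have "norm (z t) \<le> r + r"
      unfolding z_def using norm_triangle_ineq4[of "x t" "?G (y t)"] x(3)[OF that] y(3)[OF that] by linarith
    then have "M * norm (z t) \<le> M * (r + r)" using M_pos by (intro mult_left_mono) auto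
    then show ?thesis unfolding f_def using ns_le_norm[OF zX[OF that]] by linarith
  qed
  have "f 0 = 0"
    by (rule backward_bounded_decay_zero[OF f_cont bound _ dini f_nonneg]) (use mu_pos in auto)
  then have "norm (z 0) \<le> 0" using norm_le_ns[OF zX[of 0]] by (simp add: f_def)
  then show ?thesis by (simp add: z_def)
qed

end

section \<open>The local unstable manifold\<close>

lemma expanding_imp_homeomorphism:
  fixes f :: "'b::metric_space \<Rightarrow> 'c::metric_space"
  assumes f: "continuous_on S f" and c: "0 < c" "\<And>x y. x \<in> S \<Longrightarrow> y \<in> S \<Longrightarrow> dist x y \<le> c * dist (f x) (f y)"
  shows "homeomorphism S (f ` S) f (inv_into S f)"
proof -
  have inj: "inj_on f S"
  proof (rule inj_onI)
    fix x y assume "x \<in> S" "y \<in> S" "f x = f y"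
    then show "x = y" using c(2)[of x y] by simp
  qed
  have "continuous_on (f ` S) (inv_into S f)"
    unfolding continuous_on_iff
  proof (intro ballI allI impI)
    fix u e assume u: "u \<in> f ` S" and e: "(0::real) < e"
    show "\<exists>d>0. \<forall>v\<in>f ` S. dist v u < d \<longrightarrow> dist (inv_into S f v) (inv_into S f u) < e"
    proof (intro exI[of _ "e / c"] conjI ballI impI)
      fix v assume v: "v \<in> f ` S" "dist v u < e / c"
      have "dist (inv_into S f v) (inv_into S f u) \<le> c * dist v u"
        using c(2)[OF inv_into_into[OF v(1)] inv_into_into[OF u]] f_inv_into_f[OF v(1)] f_inv_into_f[OF u] by simp
      also have "\<dots> < e" using v(2) c(1) by (simp add: field_simps)
      finally show "dist (inv_into S f v) (inv_into S f u) < e" .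
    qed (use e c in simp)
  qed
  then show ?thesis
    using f inj unfolding homeomorphism_def by (auto simp: inv_into_f_f f_inv_into_f inv_into_into)
qed

text \<open>Along a direction in the kernel of the derivative, \<open>f\<close> would change by less
  than linear order, against the expansion bound near \<open>x\<close>.\<close>

lemma expanding_imp_inj_derivative:
  fixes f :: "'b::real_normed_vector \<Rightarrow> 'c::real_normed_vector"
  assumes f': "(f has_derivative f') (at x)" and S: "open S" "x \<in> S"
    and c: "0 < c" "\<And>y. y \<in> S \<Longrightarrow> norm (y - x) \<le> c * norm (f y - f x)"
  shows "inj f'"
proof -
  have lin: "linear f'" by (rule has_derivative_linear[OF f'])
  have "v = 0" if v: "f' v = 0" for v
  proof (rule ccontr)
    assume nz: "v \<noteq> 0"
    obtain d1 where d1: "d1 > 0" "ball x d1 \<subseteq> S" using S openE by blast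
    have "0 < 1 / (2 * c)" using c by simp
    then obtain d2 where d2: "d2 > 0" "\<And>y. norm (y - x) < d2 \<Longrightarrow> norm (f y - f x - f' (y - x)) \<le> 1 / (2 * c) * norm (y - x)"
      using f' unfolding has_derivative_at_alt by meson
    define h where "h = min d1 d2 / (2 * norm v)"
    have h: "h > 0" using d1 d2 nz by (simp add: h_def)
    have "norm (h *\<^sub>R v) = min d1 d2 / 2" using d1 d2 nz by (simp add: h_def)
    then have n: "norm (h *\<^sub>R v) < d1" "norm (h *\<^sub>R v) < d2" using d1 d2 by auto
    have "x + h *\<^sub>R v \<in> S" using d1(2) n(1) by (auto simp: subset_iff dist_norm)
    then have "norm (h *\<^sub>R v) \<le> c * norm (f (x + h *\<^sub>R v) - f x)" using c(2) by fastforce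
    also have "\<dots> \<le> c * (1 / (2 * c) * norm (h *\<^sub>R v))"
    proof (rule mult_left_mono)
      have "f' (h *\<^sub>R v) = 0" using v linear_scale[OF lin] by simp
      then show "norm (f (x + h *\<^sub>R v) - f x) \<le> 1 / (2 * c) * norm (h *\<^sub>R v)"
        using d2(2)[of "x + h *\<^sub>R v"] n(2) by simp
    qed (use c in simp)
    also have "\<dots> = norm (h *\<^sub>R v) / 2" using c by simp
    finally show False using h nz by simp
  qed
  then show ?thesis using linear_injective_0[OF lin] by blast
qed

lemma range_scaled_sum:
  fixes \<xi> :: "'d::finite \<Rightarrow> 'a::real_normed_vector"
  assumes s: "\<And>j. s j \<noteq> 0"
  shows "range (\<lambda>v :: real ^ 'd. \<Sum>j\<in>UNIV. v $ j *\<^sub>R s j *\<^sub>R \<xi> j) = span (range \<xi>)"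
proof
  show "range (\<lambda>v :: real ^ 'd. \<Sum>j\<in>UNIV. v $ j *\<^sub>R s j *\<^sub>R \<xi> j) \<subseteq> span (range \<xi>)"
    unfolding image_subset_iff by (intro ballI span_sum span_scale) (simp add: span_base)
  have "linear (\<lambda>v :: real ^ 'd. \<Sum>j\<in>UNIV. v $ j *\<^sub>R s j *\<^sub>R \<xi> j)"
    by (intro bounded_linear.linear bounded_linear_sum bounded_linear_scaleR_const bounded_linear_vec_nth)
  then have "subspace (range (\<lambda>v :: real ^ 'd. \<Sum>j\<in>UNIV. v $ j *\<^sub>R s j *\<^sub>R \<xi> j))"
    using linear_subspace_image subspace_UNIV by blast
  moreover have "\<xi> j \<in> range (\<lambda>v :: real ^ 'd. \<Sum>j\<in>UNIV. v $ j *\<^sub>R s j *\<^sub>R \<xi> j)" for j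
  proof (rule range_eqI[of _ _ "axis j (1 / s j)"])
    have "(\<Sum>i\<in>UNIV. axis j (1 / s j) $ i *\<^sub>R s i *\<^sub>R \<xi> i) = (\<Sum>i\<in>UNIV. if i = j then \<xi> j else 0)"
      using s by (intro sum.cong) (auto simp: axis_def)
    then show "\<xi> j = (\<Sum>i\<in>UNIV. axis j (1 / s j) $ i *\<^sub>R s i *\<^sub>R \<xi> i)" by simp
  qed
  ultimately show "span (range \<xi>) \<subseteq> range (\<lambda>v :: real ^ 'd. \<Sum>j\<in>UNIV. v $ j *\<^sub>R s j *\<^sub>R \<xi> j)"
    by (intro span_minimal) auto
qed

context split_operator begin

lemma local_manifold_exists:
  "\<exists>\<sigma>>0. \<forall>s :: 'd \<Rightarrow> real. (\<forall>j. s j \<noteq> 0) \<and> (\<forall>j. \<bar>s j\<bar> \<le> \<sigma>) \<longrightarrow>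
     unstable_parameterization D A n lam \<xi> s (pser (scoef s)) \<and>
     local_unstable_manifold D A n \<xi> (pser (scoef s) ` B1)"
proof -
  obtain \<delta> \<rho> t0 L C1 where \<delta>: "\<delta> > 0" and \<rho>: "\<rho> \<le> R" and c: "majorized coef \<delta> \<rho>"
    and t0: "t0 > 0" "t0 \<le> \<delta> / 2" and L: "L > 0" and C1: "C1 > 0" "\<And>x. norm (cc x) \<le> C1 * norm x"
    and lip: "\<And>y y'. (\<And>j. \<bar>y $ j\<bar> \<le> t0) \<Longrightarrow> (\<And>j. \<bar>y' $ j\<bar> \<le> t0) \<Longrightarrow>
      norm (pser coef y - pser coef y') \<le> L * norm (y - y')"
    and expand: "\<And>y y'. (\<And>j. \<bar>y $ j\<bar> \<le> t0) \<Longrightarrow> (\<And>j. \<bar>y' $ j\<bar> \<le> t0) \<Longrightarrow>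
      norm (y - y') \<le> 2 * norm (cc (pser coef y) - cc (pser coef y'))"
    using chart_estimates by metis
  obtain LN where LN: "LN > 0" "\<And>\<rho> x y. \<rho> \<le> R / 2 \<Longrightarrow> norm x \<le> \<rho> \<Longrightarrow> norm y \<le> \<rho> \<Longrightarrow>
       norm (N_fun n x - N_fun n y) \<le> LN * \<rho> * norm (x - y)"
    using N_fun_lipschitz[OF R_pos N_sum] by metis
  let ?G = "pser coef"
  define K where "K = 1 + L * (2 * C1)"
  have K: "K > 0" unfolding K_def using L C1 by (simp add: add_pos_pos)
  \<comment> \<open>On this ball the Lipschitz constant \<open>LN * r\<close> of \<open>N\<close> is
    small against the decay rate, even after the factors \<open>M\<close> and \<open>K\<close> by
    which a defect is amplified.\<close>
  define r where "r = min (R / 2) (\<mu> / (4 * (M * K * LN)))"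
  have MKL: "M * K * LN > 0" using M_pos K LN by simp
  have r: "r > 0" "r \<le> R / 2" using R_pos mu_pos MKL by (auto simp: r_def)
  have small: "M * (1 + L * (2 * C1)) * (LN * r) \<le> \<mu> / 4"
  proof -
    have "M * K * LN * r \<le> M * K * LN * (\<mu> / (4 * (M * K * LN)))"
      using MKL by (intro mult_left_mono) (auto simp: r_def)
    also have "\<dots> = \<mu> / 4" using M_pos K LN by simp
    finally show ?thesis by (simp add: K_def mult.assoc)
  qed
  \<comment> \<open>\<open>t0\<close> keeps the rescaled parameters in the chart box. The second
    entry keeps the image of \<open>B1\<close> inside the ball of radius \<open>r\<close>; the
    number of coordinates comes from the l1 bound on the norm.\<close>
  define \<sigma> where "\<sigma> = min t0 (r / (2 * L * real CARD('d)))"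
  have cd: "real CARD('d) > 0" by simp
  have \<sigma>: "\<sigma> > 0" "\<sigma> \<le> t0" using t0 r L cd by (auto simp: \<sigma>_def)
  have \<sigma>r: "L * (real CARD('d) * \<sigma>) < r"
  proof -
    have "L * real CARD('d) * \<sigma> \<le> L * real CARD('d) * (r / (2 * L * real CARD('d)))"
      using L by (intro mult_left_mono) (auto simp: \<sigma>_def)
    also have "\<dots> = r / 2" using L cd by simp
    also have "\<dots> < r" using r by simp
    finally show ?thesis by (simp add: mult.assoc)
  qed
  have "unstable_parameterization D A n lam \<xi> s (pser (scoef s)) \<and>
     local_unstable_manifold D A n \<xi> (pser (scoef s) ` B1)"
    if s: "\<And>j. s j \<noteq> 0" "\<And>j. \<bar>s j\<bar> \<le> \<sigma>" for s :: "'d \<Rightarrow> real"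
  proof
    \<comment> \<open>The radius 2 is available because \<open>2 * \<sigma> \<le> \<delta>\<close>,
      and it leaves a margin around the unit box.\<close>
    have cs: "majorized (scoef s) 2 \<rho>"
      by (rule scoef_majorized[OF c s(2)]) (use \<sigma> t0 in auto)
    show par: "unstable_parameterization D A n lam \<xi> s (pser (scoef s))"
      by (rule parameterization[OF cs _ \<rho>]) simp
    define Bs where "Bs = {y :: real ^ 'd. \<forall>j. \<bar>y $ j\<bar> < \<bar>s j\<bar>}"
    have Bs_eq: "(\<lambda>\<theta> :: real ^ 'd. \<chi> j. s j * \<theta> $ j) ` B1 = Bs" unfolding Bs_def by (rule B1_mult_box[OF s(1)])
    have W: "pser (scoef s) ` B1 = ?G ` Bs" unfolding Bs_eq[symmetric] image_image pser_scoef ..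
    have Bt: "\<bar>y $ j\<bar> < t0" if "y \<in> Bs" for y j
      using that s(2)[of j] \<sigma> by (auto simp: Bs_def dest!: spec[of _ j])
    have Bt': "\<bar>y $ j\<bar> \<le> t0" if "y \<in> Bs" for y j using Bt[OF that, of j] by simp
    have Bd: "\<bar>y $ j\<bar> < \<delta>" if "y \<in> Bs" for y j using Bt[OF that, of j] t0 \<delta> by linarith
    have G0: "?G 0 = 0" by (simp add: pser_at_0 coef_zero)
    have zB: "0 \<in> Bs" using s(1) by (simp add: Bs_def)
    have Gr: "norm (?G y) < r" if y: "y \<in> Bs" for y
    proof -
      have "norm (?G y) \<le> L * norm y" using lip[OF Bt'[OF y] Bt'[OF zB]] by (simp add: G0)
      also have "norm y \<le> (\<Sum>j\<in>UNIV. \<bar>y $ j\<bar>)" by (rule norm_le_l1_cart)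
      also have "(\<Sum>j\<in>UNIV. \<bar>y $ j\<bar>) \<le> (\<Sum>j\<in>(UNIV :: 'd set). \<sigma>)"
        using y s(2) by (intro sum_mono) (auto simp: Bs_def intro: less_imp_le less_le_trans)
      finally have "norm (?G y) \<le> L * (real CARD('d) * \<sigma>)" using L by simp
      then show ?thesis using \<sigma>r by simp
    qed
    have G_cont: "continuous_on Bs ?G"
    proof (intro continuous_at_imp_continuous_on ballI)
      fix y assume "y \<in> Bs"
      show "isCont ?G y" using has_derivative_continuous[OF pser_has_derivative(1)[OF c Bd[OF \<open>y \<in> Bs\<close>]]] .
    qed
    have cG_cont: "continuous_on Bs (\<lambda>y. cc (?G y))"
      by (rule bounded_linear.continuous_on[OF cc_bl G_cont])
    have cG_inj: "inj_on (\<lambda>y. cc (?G y)) Bs"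
    proof (rule inj_onI)
      fix y y' assume "y \<in> Bs" "y' \<in> Bs" "cc (?G y) = cc (?G y')"
      then show "y = y'" using expand[OF Bt' Bt', of y y'] by simp
    qed
    have "Bs = (\<Inter>j. {y. \<bar>y $ j\<bar> < \<bar>s j\<bar>})" by (auto simp: Bs_def)
    then have Bs_open: "open Bs"
      by (simp only:) (intro open_INT ballI open_Collect_less continuous_intros; simp)
    \<comment> \<open>The chart followed by \<open>cc\<close> is a continuous injection between
      Euclidean spaces of the same dimension.\<close>
    have Vo: "open ((\<lambda>y. cc (?G y)) ` Bs)"
      by (rule invariance_of_domain[OF cG_cont Bs_open cG_inj])
    \<comment> \<open>Every point of \<open>U\<close> has a companion on the graph with the same
      unstable coordinates, whatever its stable part; the ball keeps the nonlinear terms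
      small.\<close>
    define U where "U = ball 0 r \<inter> cc -` ((\<lambda>y. cc (?G y)) ` Bs)"
    have U_open: "open U"
      unfolding U_def using continuous_open_vimage[OF Vo] linear_continuous_at[OF cc_bl] by (intro open_Int) auto
    have zU: "0 \<in> U" unfolding U_def using r zB G0 by (force intro: image_eqI[of _ _ 0])
    have "?G ` Bs = local_unstable_set D A n U"
    proof
      show "?G ` Bs \<subseteq> local_unstable_set D A n U"
      proof
        fix x0 assume "x0 \<in> ?G ` Bs"
        then obtain y where y: "y \<in> Bs" "x0 = ?G y" by blast
        define x where "x t = ?G (diag_flow lam t y)" for t
        \<comment> \<open>All \<open>lam j\<close> are positive, so the backward linear flow shrinks
          every coordinate.\<close>
        have fB: "diag_flow lam t y \<in> Bs" if "t \<le> 0" for t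
          using y(1) abs_diag_flow_le[of lam t y, OF lam_pos that] unfolding Bs_def
          by (auto intro: le_less_trans)
        have "x t \<in> U \<inter> D \<inter> N_dom n" if t: "t \<le> 0" for t
          using Gr[OF fB[OF t]] fB[OF t] pser_invariance(1,2)[OF c \<rho> Bd[OF fB[OF t]] coef_zero coef_dom coef_eq]
          by (auto simp: U_def x_def)
        moreover have "(x has_vector_derivative F_fun A n (x t)) (at t within {..0})" if t: "t \<le> 0" for t
          unfolding x_def[abs_def]
          by (rule has_vector_derivative_at_within[OF chart_derivative[OF c \<rho> Bd[OF fB[OF t]] refl]])
        moreover have "(x \<longlongrightarrow> 0) at_bot"
        proof -
          have "isCont ?G 0" using has_derivative_continuous[OF pser_has_derivative(1)[OF c Bd[OF zB]]] .
          from isCont_tendsto_compose[OF this diag_flow_at_bot[OF lam_pos]]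
          show ?thesis by (simp add: x_def[abs_def] G0)
        qed
        moreover have "x 0 = x0" by (simp add: x_def y)
        ultimately show "x0 \<in> local_unstable_set D A n U" unfolding local_unstable_set_def by blast
      qed
      show "local_unstable_set D A n U \<subseteq> ?G ` Bs"
      proof
        fix x0 assume "x0 \<in> local_unstable_set D A n U"
        then obtain x where x: "x 0 = x0" "\<And>t. t \<le> 0 \<Longrightarrow> x t \<in> U" "\<And>t. t \<le> 0 \<Longrightarrow> x t \<in> D"
          "\<And>t. t \<le> 0 \<Longrightarrow> (x has_vector_derivative F_fun A n (x t)) (at t within {..0})"
          unfolding local_unstable_set_def by blast
        have "\<exists>y\<in>Bs. cc (?G y) = cc (x t)" if "t \<le> 0" for t using x(2)[OF that] by (auto simp: U_def)
        then obtain y where y: "\<And>t. t \<le> 0 \<Longrightarrow> y t \<in> Bs" "\<And>t. t \<le> 0 \<Longrightarrow> cc (?G (y t)) = cc (x t)" by metis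
        have "x 0 = ?G (y 0)"
        proof (rule backward_solution_in_graph[OF c \<rho> t0 C1 L lip expand r(2) LN(1) LN(2)[OF r(2)] small x(4,3)])
          show "norm (x t) \<le> r" if "t \<le> 0" for t using x(2)[OF that] by (simp add: U_def)
          show "norm (?G (y t)) \<le> r" if "t \<le> 0" for t using Gr[OF y(1)[OF that]] by simp
          show "\<bar>y t $ j\<bar> < t0" if "t \<le> 0" for t j by (rule Bt[OF y(1)[OF that]])
        qed (use y in auto)
        then show "x0 \<in> ?G ` Bs" using x(1) y(1) by auto
      qed
    qed
    then have LU: "\<exists>U. open U \<and> 0 \<in> U \<and> pser (scoef s) ` B1 = local_unstable_set D A n U"
      unfolding W using U_open zU by blast
    let ?P = "pser (scoef s)"
    \<comment> \<open>Undoing the scaling by \<open>s\<close> costs the sum of the reciprocals;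
      \<open>2 * C1\<close> combines the expansion constant of the chart with the norm bound of
      \<open>cc\<close>.\<close>
    define c0 where "c0 = (\<Sum>j\<in>UNIV. 1 / \<bar>s j\<bar>) * (2 * C1)"
    have c0: "c0 > 0" unfolding c0_def using s(1) C1(1) by (intro mult_pos_pos sum_pos) auto
    have exp: "norm (\<theta> - \<theta>') \<le> c0 * norm (?P \<theta> - ?P \<theta>')" if \<theta>: "\<theta> \<in> B1" "\<theta>' \<in> B1" for \<theta> \<theta>'
    proof -
      define y y' where "y = (\<chi> j. s j * \<theta> $ j)" and "y' = (\<chi> j. s j * \<theta>' $ j)"
      have yB: "y \<in> Bs" "y' \<in> Bs" using \<theta> unfolding Bs_eq[symmetric] y_def y'_def by auto
      have "norm (\<theta> - \<theta>') \<le> (\<Sum>j\<in>UNIV. \<bar>(\<theta> - \<theta>') $ j\<bar>)" by (rule norm_le_l1_cart)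
      also have "\<dots> \<le> (\<Sum>j\<in>UNIV. 1 / \<bar>s j\<bar> * norm (y - y'))"
      proof (rule sum_mono)
        fix j
        have "\<bar>s j\<bar> * \<bar>(\<theta> - \<theta>') $ j\<bar> = \<bar>(y - y') $ j\<bar>"
          by (simp add: y_def y'_def abs_mult[symmetric] right_diff_distrib)
        also have "\<dots> \<le> norm (y - y')" by (rule component_le_norm_cart)
        finally show "\<bar>(\<theta> - \<theta>') $ j\<bar> \<le> 1 / \<bar>s j\<bar> * norm (y - y')" using s(1)[of j] by (simp add: field_simps)
      qed
      also have "\<dots> = (\<Sum>j\<in>UNIV. 1 / \<bar>s j\<bar>) * norm (y - y')" by (simp add: sum_distrib_right)
      also have "\<dots> \<le> (\<Sum>j\<in>UNIV. 1 / \<bar>s j\<bar>) * (2 * (C1 * norm (?G y - ?G y')))"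
      proof (rule mult_left_mono)
        show "norm (y - y') \<le> 2 * (C1 * norm (?G y - ?G y'))"
          using expand[OF Bt'[OF yB(1)] Bt'[OF yB(2)]] C1(2)[of "?G y - ?G y'"] by (simp add: cc_diff)
      qed (auto intro: sum_nonneg)
      finally show ?thesis by (simp add: c0_def pser_scoef y_def y'_def)
    qed
    have P_der: "(?P has_derivative frechet_derivative ?P (at \<theta>)) (at \<theta>)" if "\<theta> \<in> B1" for \<theta>
    proof -
      have "\<bar>\<theta> $ j\<bar> < 2" for j using that by (auto simp: B1_def dest!: spec[of _ j])
      from pser_has_derivative(1)[OF cs this] show ?thesis
        using frechet_derivative_works differentiable_def by blast
    qed
    have P_cont: "continuous_on B1 ?P"
      by (intro continuous_at_imp_continuous_on ballI has_derivative_continuous[OF P_der])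
    have "homeomorphism B1 (?P ` B1) ?P (inv_into B1 ?P)"
      by (rule expanding_imp_homeomorphism[OF P_cont c0]) (simp add: dist_norm exp)
    moreover have "inj (frechet_derivative ?P (at \<theta>))" if "\<theta> \<in> B1" for \<theta>
      by (rule expanding_imp_inj_derivative[OF P_der[OF that] open_B1 that c0 exp[OF _ that]])
    moreover have "range (frechet_derivative ?P (at 0)) = span (range \<xi>)"
    proof -
      have "(\<lambda>v. \<Sum>j\<in>UNIV. v $ j *\<^sub>R scoef s (unit_index j)) = frechet_derivative ?P (at 0)"
        by (rule frechet_derivative_at[OF pser_has_derivative_0[OF cs scoef_zero]]) simp
      then show ?thesis using range_scaled_sum[of s \<xi>, OF s(1)] by (simp only: scoef_unit)
    qed
    ultimately show "local_unstable_manifold D A n \<xi> (?P ` B1)"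
      unfolding local_unstable_manifold_def using LU par unfolding unstable_parameterization_def by blast
  qed
  then show ?thesis using \<sigma>(1) by blast
qed

end

section \<open>Splitting and resolvent\<close>

text \<open>Applying \<open>A - lam k\<close> to a linear relation removes \<open>\<xi> k\<close>
  and multiplies the other coefficients by the non-zero differences \<open>lam j - lam k\<close>,
  which reduces to a smaller set.\<close>

lemma eigenvectors_coefficients_zero:
  fixes \<xi> :: "'d \<Rightarrow> 'a::real_normed_vector"
  assumes A: "linear_on_dom D A" and lam: "inj lam"
    and \<xi>: "\<And>j. \<xi> j \<in> D" "\<And>j. A (\<xi> j) = lam j *\<^sub>R \<xi> j" "\<And>j. \<xi> j \<noteq> 0"
    and J: "finite J"
  shows "(\<Sum>j\<in>J. c j *\<^sub>R \<xi> j) = 0 \<Longrightarrow> j \<in> J \<Longrightarrow> c j = (0::real)"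
  using J
proof (induction J arbitrary: c j rule: finite_induct)
  case (insert k J)
  have D: "subspace D" and add: "\<And>x y. x \<in> D \<Longrightarrow> y \<in> D \<Longrightarrow> A (x + y) = A x + A y"
    and scale: "\<And>c x. x \<in> D \<Longrightarrow> A (c *\<^sub>R x) = c *\<^sub>R A x"
    using A by (auto simp: linear_on_dom_def)
  have A0: "A 0 = 0" using scale[OF \<xi>(1), of 0] by simp
  have sum_D: "(\<Sum>j\<in>I. c j *\<^sub>R \<xi> j) \<in> D" for I
    by (intro subspace_sum[OF D] subspace_scale[OF D] \<xi>)
  have A_sum: "A (\<Sum>j\<in>I. c j *\<^sub>R \<xi> j) = (\<Sum>j\<in>I. (c j * lam j) *\<^sub>R \<xi> j)" if "finite I" for I
    using that
  proof (induction I rule: finite_induct)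
    case (insert i I)
    then show ?case using add[OF subspace_scale[OF D \<xi>(1)] sum_D] scale[OF \<xi>(1)] by (simp add: \<xi>(2))
  qed (simp add: A0)
  have "(\<Sum>j\<in>insert k J. (c j * lam j) *\<^sub>R \<xi> j) = 0"
    using A_sum[of "insert k J"] insert.prems(1) insert.hyps A0 by simp
  moreover have "lam k *\<^sub>R (\<Sum>j\<in>insert k J. c j *\<^sub>R \<xi> j) = 0" using insert.prems(1) by simp
  ultimately have "(\<Sum>j\<in>insert k J. (c j * lam j) *\<^sub>R \<xi> j) - lam k *\<^sub>R (\<Sum>j\<in>insert k J. c j *\<^sub>R \<xi> j) = 0"
    by simp
  then have "(\<Sum>j\<in>insert k J. (c j * (lam j - lam k)) *\<^sub>R \<xi> j) = 0"
    unfolding scaleR_sum_right sum_subtractf[symmetric] by (simp add: algebra_simps)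
  then have s: "(\<Sum>j\<in>J. (c j * (lam j - lam k)) *\<^sub>R \<xi> j) = 0" using insert.hyps by simp
  have cJ: "c i = 0" if "i \<in> J" for i
  proof -
    have "c i * (lam i - lam k) = 0" by (rule insert.IH[OF s that])
    moreover have "lam i \<noteq> lam k" using lam that insert.hyps by (auto dest: injD)
    ultimately show ?thesis by simp
  qed
  then have "c k *\<^sub>R \<xi> k = 0" using insert.prems(1) insert.hyps by simp
  then have "c k = 0" using \<xi>(3)[of k] by simp
  then show ?case using cJ insert.prems(2) by auto
qed simp

text \<open>The projection along the closed subspace \<open>Y\<close> is bounded because the distance to \<open>Y\<close> is bounded
  below on the compact unit sphere of the finite-dimensional complement.\<close>

lemma bounded_coordinates_along_closed_subspace:
  fixes \<xi> :: "'d::finite \<Rightarrow> 'a::real_normed_vector"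
  assumes Y: "subspace Y" "closed Y" "span (range \<xi>) \<inter> Y = {0}"
      "{u + v | u v. u \<in> span (range \<xi>) \<and> v \<in> Y} = UNIV"
    and ind: "\<And>c. (\<Sum>j\<in>UNIV. c j *\<^sub>R \<xi> j) = 0 \<Longrightarrow> \<forall>j. c j = (0::real)"
  obtains cc :: "'a \<Rightarrow> real ^ 'd" where "bounded_linear cc" "\<And>j. cc (\<xi> j) = axis j 1" "\<And>v. cc v = 0 \<longleftrightarrow> v \<in> Y"
proof -
  define E where "E v = (\<Sum>j\<in>UNIV. v $ j *\<^sub>R \<xi> j)" for v :: "real ^ 'd"
  have E_bl: "bounded_linear E" unfolding E_def[abs_def]
    by (intro bounded_linear_sum bounded_linear_scaleR_const bounded_linear_vec_nth)
  note E_lin = bounded_linear.linear[OF E_bl]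
  have E_span: "range E = span (range \<xi>)"
    using range_scaled_sum[of "\<lambda>_. 1" \<xi>] by (simp add: E_def[abs_def])
  have E0: "v = 0" if "E v = 0" for v
    using ind[of "\<lambda>j. v $ j"] that by (simp add: E_def vec_eq_iff)
  have ex: "\<exists>v. x - E v \<in> Y" for x
  proof -
    obtain u w where "x = u + w" "u \<in> span (range \<xi>)" "w \<in> Y" using Y(4) by blast
    moreover then obtain v where "u = E v" using E_span by blast
    ultimately have "x - E v \<in> Y" by simp
    then show ?thesis ..
  qed
  have uniq: "v = w" if "x - E v \<in> Y" "x - E w \<in> Y" for x v w
  proof -
    have "E (v - w) \<in> Y" using subspace_diff[OF Y(1) that(2,1)] by (simp add: linear_diff[OF E_lin])
    moreover have "E (v - w) \<in> span (range \<xi>)" using E_span by auto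
    ultimately have "E (v - w) = 0" using Y(3) by blast
    then show ?thesis using E0[of "v - w"] by simp
  qed
  define cc where "cc x = (SOME v. x - E v \<in> Y)" for x
  have cc: "x - E (cc x) \<in> Y" for x unfolding cc_def by (rule someI_ex[OF ex])
  have cc_eq: "cc x = v" if "x - E v \<in> Y" for x v by (rule uniq[OF cc that])
  obtain \<kappa> where \<kappa>: "\<kappa> > 0" "\<And>v. norm v = 1 \<Longrightarrow> \<kappa> \<le> infdist (E v) Y"
  proof -
    have Yne: "Y \<noteq> {}" using subspace_0[OF Y(1)] by blast
    have "continuous_on (sphere 0 1) (\<lambda>v. infdist (E v) Y)"
      by (intro continuous_on_infdist bounded_linear.continuous_on[OF E_bl] continuous_on_id)
    moreover have "sphere (0 :: real ^ 'd) 1 \<noteq> {}" by simp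
    ultimately obtain v0 where v0: "v0 \<in> sphere 0 1" "\<And>v. v \<in> sphere 0 1 \<Longrightarrow> infdist (E v0) Y \<le> infdist (E v) Y"
      using continuous_attains_inf[OF compact_sphere] by blast
    have "infdist (E v0) Y \<noteq> 0"
    proof
      assume "infdist (E v0) Y = 0"
      then have "E v0 \<in> Y" using in_closed_iff_infdist_zero[OF Y(2) Yne] by simp
      moreover have "E v0 \<in> span (range \<xi>)" using E_span by auto
      ultimately have "E v0 = 0" using Y(3) by blast
      then show False using E0[of v0] v0(1) by simp
    qed
    then have "infdist (E v0) Y > 0" using infdist_nonneg[of "E v0" Y] by linarith
    then show thesis using v0(2) by (intro that[of "infdist (E v0) Y"]) auto
  qed
  have bd: "\<kappa> * norm (cc x) \<le> norm x" for x
  proof (cases "cc x = 0")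
    case False
    define a where "a = norm (cc x)"
    have a: "a > 0" using False by (simp add: a_def)
    define w where "w = - ((1 / a) *\<^sub>R (x - E (cc x)))"
    have w: "w \<in> Y" unfolding w_def by (intro subspace_neg[OF Y(1)] subspace_scale[OF Y(1)] cc)
    have "\<kappa> \<le> infdist (E ((1 / a) *\<^sub>R cc x)) Y" using a by (intro \<kappa>(2)) (simp add: a_def)
    also have "\<dots> \<le> dist (E ((1 / a) *\<^sub>R cc x)) w" by (rule infdist_le[OF w])
    also have "\<dots> = norm ((1 / a) *\<^sub>R x)"
      by (simp add: dist_norm w_def linear_scale[OF E_lin] scaleR_right_diff_distrib)
    also have "\<dots> = norm x / a" using a by simp
    finally show ?thesis using a by (simp add: a_def field_simps)
  qed simp
  show thesis
  proof (rule that[of cc])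
    show "bounded_linear cc"
    proof (rule bounded_linear_intro[where K = "1 / \<kappa>"])
      show "cc (x + y) = cc x + cc y" for x y
      proof (rule cc_eq)
        have "(x - E (cc x)) + (y - E (cc y)) \<in> Y" by (intro subspace_add[OF Y(1)] cc)
        then show "x + y - E (cc x + cc y) \<in> Y" by (simp add: linear_add[OF E_lin] algebra_simps)
      qed
      show "cc (r *\<^sub>R x) = r *\<^sub>R cc x" for r x
      proof (rule cc_eq)
        have "r *\<^sub>R (x - E (cc x)) \<in> Y" by (intro subspace_scale[OF Y(1)] cc)
        then show "r *\<^sub>R x - E (r *\<^sub>R cc x) \<in> Y" by (simp add: linear_scale[OF E_lin] scaleR_right_diff_distrib)
      qed
      show "norm (cc x) \<le> norm x * (1 / \<kappa>)" for x using bd[of x] \<kappa>(1) by (simp add: field_simps)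
    qed
    show "cc (\<xi> j) = axis j 1" for j
    proof (rule cc_eq)
      have "E (axis j 1) = (\<Sum>i\<in>UNIV. if i = j then \<xi> j else 0)"
        unfolding E_def by (intro sum.cong) (auto simp: axis_def)
      then show "\<xi> j - E (axis j 1) \<in> Y" using subspace_0[OF Y(1)] by simp
    qed
    show "cc v = 0 \<longleftrightarrow> v \<in> Y" for v
      using cc[of v] cc_eq[of v 0] by (auto simp: linear_0[OF E_lin])
  qed
qed

text \<open>At a real point the complexified operator acts separately on real and imaginary parts,
  so the first component of the complex resolvent on vectors \<open>(y, 0)\<close> is a real
  resolvent.\<close>

lemma real_resolvent:
  assumes A: "linear_on_dom D A" and z: "complex_of_real z \<in> resolvent_set D A"
  shows "\<exists>T. bounded_linear T \<and> (\<forall>y. T y \<in> D \<and> z *\<^sub>R T y - A (T y) = y) \<and> (\<forall>x\<in>D. T (z *\<^sub>R x - A x) = x)"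
proof -
  define f where "f w = cscale (complex_of_real z) w - map_prod A A w" for w
  have f: "f w = (z *\<^sub>R fst w - A (fst w), z *\<^sub>R snd w - A (snd w))" for w
    by (simp add: f_def cscale_def prod_eq_iff)
  have bij: "bij_betw f (D \<times> D) UNIV" and bl: "bounded_linear (resolvent D A (complex_of_real z))"
    using z by (auto simp: resolvent_set_def f_def[abs_def])
  have res: "resolvent D A (complex_of_real z) = inv_into (D \<times> D) f"
    by (simp add: resolvent_def f_def[abs_def])
  define T where "T y = fst (resolvent D A (complex_of_real z) (y, 0))" for y
  have "bounded_linear (\<lambda>y :: 'a. (y, 0 :: 'a))"
    by (intro bounded_linear_Pair bounded_linear_ident bounded_linear_zero)
  then have "bounded_linear T"
    unfolding T_def[abs_def] by (intro bounded_linear_fst_comp bounded_linear_compose[OF bl])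
  moreover have "T y \<in> D \<and> z *\<^sub>R T y - A (T y) = y" for y
  proof -
    have im: "(y, 0) \<in> f ` (D \<times> D)" using bij by (auto simp: bij_betw_def)
    have 1: "resolvent D A (complex_of_real z) (y, 0) \<in> D \<times> D" unfolding res by (rule inv_into_into[OF im])
    have 2: "f (resolvent D A (complex_of_real z) (y, 0)) = (y, 0)" unfolding res by (rule f_inv_into_f[OF im])
    show ?thesis using 1 2 unfolding f T_def by (auto simp: mem_Times_iff)
  qed
  moreover have "T (z *\<^sub>R x - A x) = x" if "x \<in> D" for x
  proof -
    have sub: "subspace D" and sc: "\<And>c x. x \<in> D \<Longrightarrow> A (c *\<^sub>R x) = c *\<^sub>R A x"
      using A by (auto simp: linear_on_dom_def)
    have D0: "0 \<in> D" by (rule subspace_0[OF sub])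
    have "A 0 = 0" using sc[OF D0, of 0] by simp
    then have "f (x, 0) = (z *\<^sub>R x - A x, 0)" by (simp add: f)
    moreover have "inv_into (D \<times> D) f (f (x, 0)) = (x, 0)"
      using bij that D0 by (intro inv_into_f_f) (auto simp: bij_betw_def)
    ultimately show ?thesis by (simp add: T_def res)
  qed
  ultimately show ?thesis by blast
qed

text \<open>Uniqueness takes the form of equality on \<open>B1\<close>, because a total function
  representing the map is arbitrary elsewhere.\<close>

theorem theorem3p2:
  fixes D :: "'a::{banach,real_normed_algebra,comm_ring} set"
    and A A0 B :: "'a \<Rightarrow> 'a"
    and n :: "nat \<Rightarrow> 'a"
    and R M \<mu> :: real
    and lam :: "'d::finite \<Rightarrow> real"
    and \<xi> :: "'d \<Rightarrow> 'a"
    and Xs :: "'a set"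
    and S :: "real \<Rightarrow> 'a \<Rightarrow> 'a"
  assumes sectorial: "sectorial D A0"
    and compact_resolvent: "compact_resolvent D A0"
    and perturbation: "bounded_linear B" "\<And>x. x \<in> D \<Longrightarrow> A x = A0 x + B x"
    and nonlinearity: "R > 0" "summable (\<lambda>j. norm (n (j + 2)) * R ^ (j + 2))"
    and hyperbolic: "\<And>z. op_eigenvalue D A z \<Longrightarrow> Re z \<noteq> 0"
    and unstable_spectrum: "{z \<in> op_spectrum D A. Re z > 0} = complex_of_real ` range lam"
    and multiplicity_one: "inj lam" "\<And>j. alg_multiplicity D A (lam j) = 1"
    and eigenvectors: "\<And>j. \<xi> j \<in> D" "\<And>j. A (\<xi> j) = lam j *\<^sub>R \<xi> j" "\<And>j. norm (\<xi> j) = 1"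
    and splitting: "subspace Xs" "closed Xs" "span (range \<xi>) \<inter> Xs = {0}"
      "{u + v | u v. u \<in> span (range \<xi>) \<and> v \<in> Xs} = UNIV" "A ` (D \<inter> Xs) \<subseteq> Xs"
    and stable_semigroup: "generates_on Xs (D \<inter> Xs) A S" "\<And>t. t > 0 \<Longrightarrow> compact_op_on Xs (S t)"
    and decay: "M > 0" "\<mu> > 0" "\<And>t x. t \<ge> 0 \<Longrightarrow> x \<in> Xs \<Longrightarrow> norm (S t x) \<le> M * exp (- \<mu> * t) * norm x"
    and nonresonant: "nonresonant lam"
  shows "\<exists>\<delta>>0. \<forall>s :: 'd \<Rightarrow> real.
           (\<forall>j. s j \<noteq> 0) \<and> Max (range (\<lambda>j. \<bar>s j\<bar>)) \<le> \<delta> \<longrightarrow>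
           (\<exists>P :: real ^ 'd \<Rightarrow> 'a.
              unstable_parameterization D A n lam \<xi> s P \<and>
              (\<forall>Q. unstable_parameterization D A n lam \<xi> s Q \<longrightarrow> (\<forall>\<theta>\<in>B1. Q \<theta> = P \<theta>)) \<and>
              local_unstable_manifold D A n \<xi> (P ` B1))"
proof -
  have A0_lin: "linear_on_dom D A0"
    using sectorial by (simp add: sectorial_def closed_operator_def)
  then have D_sub: "subspace D" by (simp add: linear_on_dom_def)
  interpret B: bounded_linear B by (rule perturbation(1))
  have A_lin: "linear_on_dom D A"
    unfolding linear_on_dom_def
  proof (intro conjI ballI allI D_sub)
    fix x y c assume "x \<in> D" "y \<in> D"
    then show "A (x + y) = A x + A y"
      using A0_lin by (simp add: linear_on_dom_def perturbation(2) subspace_add[OF D_sub] B.add)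
  next
    fix c x assume "x \<in> D"
    then show "A (c *\<^sub>R x) = c *\<^sub>R A x"
      using A0_lin by (simp add: linear_on_dom_def perturbation(2) subspace_scale[OF D_sub] B.scaleR scaleR_add_right)
  qed
  \<comment> \<open>Positivity is read off from the unstable spectrum being exactly the set of the
    \<open>lam j\<close>; the same equality puts every other positive point into the resolvent
    set.\<close>
  have lam_pos: "0 < lam j" for j
  proof -
    have "complex_of_real (lam j) \<in> {z \<in> op_spectrum D A. Re z > 0}" unfolding unstable_spectrum by simp
    then show ?thesis by simp
  qed
  have resolv: "\<exists>T. bounded_linear T \<and> (\<forall>y. T y \<in> D \<and> z *\<^sub>R T y - A (T y) = y) \<and> (\<forall>x\<in>D. T (z *\<^sub>R x - A x) = x)"
    if z: "0 < z" "z \<notin> range lam" for z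
  proof (rule real_resolvent[OF A_lin])
    have "complex_of_real z \<notin> {z \<in> op_spectrum D A. Re z > 0}" unfolding unstable_spectrum using z(2) by auto
    then show "complex_of_real z \<in> resolvent_set D A" using z(1) by (simp add: op_spectrum_def)
  qed
  have xi0: "\<xi> j \<noteq> 0" for j using eigenvectors(3)[of j] by auto
  have ind: "\<forall>j. c j = 0" if "(\<Sum>j\<in>UNIV. c j *\<^sub>R \<xi> j) = 0" for c :: "'d \<Rightarrow> real"
    using eigenvectors_coefficients_zero[OF A_lin multiplicity_one(1) eigenvectors(1,2) xi0 finite that] by blast
  obtain cc :: "'a \<Rightarrow> real ^ 'd" where cc: "bounded_linear cc" "\<And>j. cc (\<xi> j) = axis j 1" "\<And>v. cc v = 0 \<longleftrightarrow> v \<in> Xs"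
    using bounded_coordinates_along_closed_subspace[OF splitting(1-4) ind] by blast
  interpret split_operator D A n R M \<mu> lam \<xi> Xs S cc
  proof (rule split_operator.intro)
    show "A v \<in> Xs" if "v \<in> D" "v \<in> Xs" for v using that splitting(5) by blast
  qed (fact A_lin lam_pos eigenvectors cc resolv stable_semigroup(1) decay nonlinearity nonresonant)+
  obtain \<sigma> where \<sigma>: "\<sigma> > 0" "\<And>s. (\<And>j. s j \<noteq> 0) \<Longrightarrow> (\<And>j. \<bar>s j\<bar> \<le> \<sigma>) \<Longrightarrow>
      unstable_parameterization D A n lam \<xi> s (pser (scoef s)) \<and>
      local_unstable_manifold D A n \<xi> (pser (scoef s) ` B1)"
    using local_manifold_exists by blast
  show ?thesis
  proof (intro exI[of _ \<sigma>] conjI \<sigma>(1) allI impI)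
    fix s :: "'d \<Rightarrow> real" assume s: "(\<forall>j. s j \<noteq> 0) \<and> Max (range (\<lambda>j. \<bar>s j\<bar>)) \<le> \<sigma>"
    have P: "unstable_parameterization D A n lam \<xi> s (pser (scoef s))"
      "local_unstable_manifold D A n \<xi> (pser (scoef s) ` B1)"
      using \<sigma>(2)[of s] s by auto
    with parameterization_unique show "\<exists>P :: real ^ 'd \<Rightarrow> 'a.
              unstable_parameterization D A n lam \<xi> s P \<and>
              (\<forall>Q. unstable_parameterization D A n lam \<xi> s Q \<longrightarrow> (\<forall>\<theta>\<in>B1. Q \<theta> = P \<theta>)) \<and>
              local_unstable_manifold D A n \<xi> (P ` B1)"
      by blast
  qed
qed

end
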